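(* Fix $p\ge 1$, $v\in\mathbb{R}^p$, and a $p\times p$ matrix $Q$ that is either positive definite or zero. Let $\{(X_i,Y_i)\}_{i=1}^\infty$ be random pairs with $X_i\in\mathbb{R}^p$, $Y_i\in\{0,1\}$, satisfying: (A1) the pairs are i.i.d. and $Y_i\mid X_i\sim\mathrm{Bernoulli}(G(X_i))$ for some measurable $G:\mathbb{R}^p\to(0,1)$; (A2) $\mathbb{E}X_1X_1^T$ is finite and positive definite; (A3) for every $j\in\{1,\dots,2^p\}$ and every $\beta\neq 0$, $\mathbb{P}\big((1_{S_j}(X_1)+1_{S_j}(-X_1))X_1^T\beta\neq 0\big)>0$, where $S_1,\dots,S_{2^p}$ are the open orthants of $\mathbb{R}^p$. For $n\ge1$ let $\mathcal{D}_n=\{(X_i,Y_i)\}_{i=1}^n$ and let $\rho_*(\mathcal{D}_n)$ be the geometric convergence rate of the Albert–Chib chain built from $\mathcal{D}_n$ and the prior $(v,Q)$ (defined whenever the corresponding posterior is proper, which almost surely holds for all sufficiently large $n$). Then there exists a constant $\rho<1$ such that, almost surely, $\limsup_{n\to\infty}\rho_*(\mathcal{D}_n)\le\rho$.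
   Context: Probit setting: given covariates $X_1,\dots,X_n\in\mathbb{R}^p$ and responses $Y_1,\dots,Y_n\in\{0,1\}$, let $X$ be the $n\times p$ matrix with $i$th row $X_i^T$. $\Phi,\phi$ denote the standard normal cdf and pdf. The prior density is $\omega(\beta)\propto\exp\{-\frac12(\beta-v)^TQ(\beta-v)\}$ and the posterior density is $\pi(\beta)\propto\prod_{i=1}^n\Phi(X_i^T\beta)^{Y_i}(1-\Phi(X_i^T\beta))^{1-Y_i}\omega(\beta)$, assumed proper; then $\Sigma:=X^TX+Q$ is nonsingular. $\mathrm{TN}(\theta,1;1)$ (resp. $\mathrm{TN}(\theta,1;0)$) denotes $N(\theta,1)$ truncated to $(0,\infty)$ (resp. $(-\infty,0)$). The Albert–Chib chain on $\mathbb{R}^p$ moves from $\beta$ as follows: draw $Z_i\sim\mathrm{TN}(X_i^T\beta,1;Y_i)$ independently, $Z=(Z_1,\dots,Z_n)^T$, then draw the new state from $N_p(\Sigma^{-1}(X^TZ+Qv),\Sigma^{-1})$. It is Harris ergodic with invariant distribution the posterior $\Pi$. For a Markov transition function $K$ with invariant probability $\Pi$, the geometric convergence rate is $\rho_*=\inf\{\rho\in[0,1]:$ there is $M:\mathbb{R}^p\to[0,\infty)$ with $\|K^m(x,\cdot)-\Pi\|_{TV}\le M(x)\rho^m$ for all $x$ and $m\in\mathbb{N}\}$. *)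

theory Defs
  imports "HOL-Probability.Probability"
begin

definition pos_def :: "real^'p^'p \<Rightarrow> bool" where
  "pos_def A \<longleftrightarrow> (\<forall>i j. A $ i $ j = A $ j $ i) \<and> (\<forall>x. x \<noteq> 0 \<longrightarrow> x \<bullet> (A *v x) > 0)"

text \<open>Open orthant of R^p determined by a sign pattern s (True = positive coordinate).
  The 2^p sign patterns enumerate the orthants S_1, ..., S_(2^p).\<close>
definition open_orthant :: "('p::finite \<Rightarrow> bool) \<Rightarrow> (real^'p) set" where
  "open_orthant s = {x. \<forall>i. if s i then x $ i > 0 else x $ i < 0}"

definition Phi :: "real \<Rightarrow> real" where
  "Phi t = measure (density lborel std_normal_density) {..t}"

definition tn_measure :: "real \<Rightarrow> bool \<Rightarrow> real measure" where
  "tn_measure \<theta> y = density lborel (\<lambda>z.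
     if y then indicator {0<..} z * normal_density \<theta> 1 z / Phi \<theta>
     else indicator {..<0} z * normal_density \<theta> 1 z / (1 - Phi \<theta>))"

definition mvn_prec :: "real^'p \<Rightarrow> real^'p^'p \<Rightarrow> (real^'p) measure" where
  "mvn_prec m S = density lborel (\<lambda>x. sqrt (det S) / (2 * pi) powr (real CARD('p) / 2)
       * exp (- ((x - m) \<bullet> (S *v (x - m))) / 2))"

text \<open>Data: covariates xs 0, ..., xs (n-1); responses ys i (True means Y_i = 1).\<close>
definition Sigma_mat :: "(nat \<Rightarrow> real^'p) \<Rightarrow> nat \<Rightarrow> real^'p^'p \<Rightarrow> real^'p^'p" where
  "Sigma_mat xs n Q = (\<Sum>i<n. (\<chi> j k. xs i $ j * xs i $ k)) + Q"

definition ac_kernel :: "(nat \<Rightarrow> real^'p) \<Rightarrow> (nat \<Rightarrow> bool) \<Rightarrow> nat \<Rightarrow> real^'p \<Rightarrow> real^'p^'p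
    \<Rightarrow> real^'p \<Rightarrow> (real^'p) measure" where
  "ac_kernel xs ys n v Q \<beta> =
     bind (PiM {..<n} (\<lambda>i. tn_measure (xs i \<bullet> \<beta>) (ys i)))
       (\<lambda>z. mvn_prec (matrix_inv (Sigma_mat xs n Q) *v ((\<Sum>i<n. z i *\<^sub>R xs i) + Q *v v))
                     (Sigma_mat xs n Q))"

primrec ac_iter :: "(nat \<Rightarrow> real^'p) \<Rightarrow> (nat \<Rightarrow> bool) \<Rightarrow> nat \<Rightarrow> real^'p \<Rightarrow> real^'p^'p
    \<Rightarrow> nat \<Rightarrow> real^'p \<Rightarrow> (real^'p) measure" where
  "ac_iter xs ys n v Q 0 \<beta> = return borel \<beta>"
| "ac_iter xs ys n v Q (Suc m) \<beta> = bind (ac_iter xs ys n v Q m \<beta>) (ac_kernel xs ys n v Q)"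

definition likelihood :: "(nat \<Rightarrow> real^'p) \<Rightarrow> (nat \<Rightarrow> bool) \<Rightarrow> nat \<Rightarrow> real^'p \<Rightarrow> real" where
  "likelihood xs ys n \<beta> = (\<Prod>i<n. if ys i then Phi (xs i \<bullet> \<beta>) else 1 - Phi (xs i \<bullet> \<beta>))"

definition prior_dens :: "real^'p \<Rightarrow> real^'p^'p \<Rightarrow> real^'p \<Rightarrow> real" where
  "prior_dens v Q \<beta> = exp (- ((\<beta> - v) \<bullet> (Q *v (\<beta> - v))) / 2)"

definition posterior_proper :: "(nat \<Rightarrow> real^'p) \<Rightarrow> (nat \<Rightarrow> bool) \<Rightarrow> nat \<Rightarrow> real^'p \<Rightarrow> real^'p^'p \<Rightarrow> bool" where
  "posterior_proper xs ys n v Q \<longleftrightarrow>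
     (\<integral>\<^sup>+ \<beta>. ennreal (likelihood xs ys n \<beta> * prior_dens v Q \<beta>) \<partial>lborel) < \<infinity>"

definition posterior :: "(nat \<Rightarrow> real^'p) \<Rightarrow> (nat \<Rightarrow> bool) \<Rightarrow> nat \<Rightarrow> real^'p \<Rightarrow> real^'p^'p
    \<Rightarrow> (real^'p) measure" where
  "posterior xs ys n v Q = density lborel (\<lambda>\<beta>. likelihood xs ys n \<beta> * prior_dens v Q \<beta> /
      (\<integral>b. likelihood xs ys n b * prior_dens v Q b \<partial>lborel))"

definition tv_dist :: "('a::topological_space) measure \<Rightarrow> 'a measure \<Rightarrow> real" where
  "tv_dist \<mu> \<nu> = (SUP A \<in> sets borel. \<bar>measure \<mu> A - measure \<nu> A\<bar>)"

definition geo_rate :: "(nat \<Rightarrow> 'a \<Rightarrow> ('a::topological_space) measure) \<Rightarrow> 'a measure \<Rightarrow> real" where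
  "geo_rate K PI = Inf {\<rho>. 0 \<le> \<rho> \<and> \<rho> \<le> 1 \<and>
      (\<exists>M::'a \<Rightarrow> real. \<forall>x. 0 \<le> M x \<and> (\<forall>m. tv_dist (K m x) PI \<le> M x * \<rho> ^ m))}"

definition ac_rate :: "(nat \<Rightarrow> real^'p) \<Rightarrow> (nat \<Rightarrow> bool) \<Rightarrow> nat \<Rightarrow> real^'p \<Rightarrow> real^'p^'p \<Rightarrow> real" where
  "ac_rate xs ys n v Q = geo_rate (ac_iter xs ys n v Q) (posterior xs ys n v Q)"

end

theory Submission
  imports Defs "HOL-Real_Asymp.Real_Asymp"
begin

text \<open>Write \<open>\<Sigma> = X\<^sup>T X + Q\<close>. In the norm of \<open>\<Sigma>\<close>, the conditional mean of one step of the chain is a contraction: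
  its derivative is \<open>\<Sigma>\<inverse> X\<^sup>T D X\<close> with \<open>D\<close> the diagonal matrix of truncated normal variances, which are at most
  1, and at most 1/2 when the truncation cuts off the mode. At every \<open>\<beta>\<close> the latter happens for all observations whose
  covariate lies in a suitable orthant (up to sign, depending on the response), and by the law of large
  numbers these carry a fixed proportion of \<open>X\<^sup>T X\<close>. The noise of a step has variance at most of the order of the
  dimension in this norm. The squared distance to the fixed point of the mean map therefore satisfies a drift
  condition, and its sublevel sets a minorization condition, with constants that do not depend on the sample size.
  Harris' theorem in the form of Hairer and Mattingly turns them into a bound on the convergence rate.\<close>

section \<open>Truncated normal distributions\<close>

text \<open>The obstacle is uniformity, both in \<beta> and in the sample size. For \<beta>, the
  choice of observations depends only on its sign pattern, so a supremum over R^p reduces to 2^p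
  sums, each of which needs no more than a lower bound. For the sample size, everything is measured
  in coordinates in which Sigma becomes the identity: the Gaussian draw is then standard in p
  dimensions, and the latent noise has total variance at most the trace of Sigma^{-1} X^T X, hence
  at most p, however many latent variables there are. Centring the drift function at the fixed point
  of the mean map keeps \<open>v\<close> and the location of the posterior out of the constants.
  What remains is a rate that is a function of p and the contraction factor alone. That factor is
  \<open>1 - \<delta>\<close>, where \<delta> compares a lower bound for the informative part of X^T
  X with an upper bound for Sigma, both linear in the sample size. Crude constants suffice on both
  sides, so no exact limit of the averages is needed: the lower bound works with bounded statistics,
  the upper one with the first moment of |X|^2.\<close>

abbreviation \<phi> :: "real \<Rightarrow> real" where "\<phi> \<equiv> std_normal_density"

lemma Phi_eq_cdf: "Phi = cdf std_normal_distribution"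
  by (auto simp: fun_eq_iff Phi_def cdf_def)

lemma real_distribution_std_normal: "real_distribution std_normal_distribution"
proof -
  interpret prob_space std_normal_distribution
    by (rule prob_space_normal_density) simp
  show ?thesis by unfold_locales auto
qed

lemma Phi_at_top: "(Phi \<longlongrightarrow> 1) at_top"
  unfolding Phi_eq_cdf by (rule real_distribution.cdf_lim_at_top_prob[OF real_distribution_std_normal])

lemma Phi_at_bot: "(Phi \<longlongrightarrow> 0) at_bot"
  unfolding Phi_eq_cdf
  by (rule finite_borel_measure.cdf_lim_at_bot)
     (rule real_distribution.finite_borel_measure_M[OF real_distribution_std_normal])

lemma std_normal_density_continuous: "continuous_on A \<phi>"
  unfolding normal_density_def by (intro continuous_intros) auto

lemma Phi_diff:
  assumes "a \<le> b"
  shows "Phi b - Phi a = integral {a..b} \<phi>"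
proof -
  interpret D: prob_space std_normal_distribution
    by (rule prob_space_normal_density) simp
  have "Phi b - Phi a = measure std_normal_distribution ({..b} - {..a})"
    unfolding Phi_def using assms by (subst D.finite_measure_Diff) auto
  also have "{..b} - {..a} = {a<..b}" by auto
  also have "measure std_normal_distribution {a<..b} = integral {a..b} \<phi>"
  proof -
    have si: "set_integrable lborel {a..b} \<phi>"
      unfolding set_integrable_def by (rule borel_integrable_compact) (auto intro!: std_normal_density_continuous)
    have "emeasure std_normal_distribution {a<..b} = (\<integral>\<^sup>+x. ennreal (indicator {a..b} x * \<phi> x) \<partial>lborel)"
      by (auto simp: emeasure_density indicator_def of_bool_def
          intro!: nn_integral_cong_AE AE_I[where N="{a}"] split: if_splits)
    also have "\<dots> = ennreal (\<integral>x. indicator {a..b} x * \<phi> x \<partial>lborel)"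
      using si by (intro nn_integral_eq_integral) (auto simp: set_integrable_def)
    finally have "measure std_normal_distribution {a<..b} = (LINT x:{a..b}|lborel. \<phi> x)"
      by (auto simp: measure_def set_lebesgue_integral_def intro!: integral_nonneg_AE)
    also have "\<dots> = integral {a..b} \<phi>"
      by (rule set_borel_integral_eq_integral(2)[OF si])
    finally show ?thesis .
  qed
  finally show ?thesis .
qed

text \<open>Near any point \<open>Phi\<close> is a constant plus an integral with a fixed left end,
  so the fundamental theorem applies. The composed form lets the derivative rules chain.\<close>

lemma DERIV_Phi [derivative_intros]:
  assumes "(f has_real_derivative f') (at x within S)"
  shows "((\<lambda>x. Phi (f x)) has_real_derivative \<phi> (f x) * f') (at x within S)"
proof -
  have "(Phi has_real_derivative \<phi> t) (at t)" for t
  proof -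
    have "((\<lambda>x. integral {t-1..x} \<phi>) has_real_derivative \<phi> t) (at t within {t-1..t+1})"
      by (rule integral_has_real_derivative) (auto intro: std_normal_density_continuous)
    then have "((\<lambda>x. Phi (t-1) + integral {t-1..x} \<phi>) has_real_derivative \<phi> t) (at t within {t-1..t+1})"
      by (auto intro!: derivative_eq_intros)
    then have "(Phi has_real_derivative \<phi> t) (at t within {t-1..t+1})"
      by (rule has_field_derivative_transform_within[where d=1]) (auto simp flip: Phi_diff)
    moreover have "t \<in> interior {t-1..t+1}" by auto
    ultimately show ?thesis by (metis at_within_interior)
  qed
  from DERIV_chain2[OF this assms] show ?thesis .
qed

lemma DERIV_std_normal_density [derivative_intros]:
  assumes "(f has_real_derivative f') (at x within S)"
  shows "((\<lambda>x. \<phi> (f x)) has_real_derivative - f x * \<phi> (f x) * f') (at x within S)"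
proof -
  have "(\<phi> has_real_derivative - t * \<phi> t) (at t)" for t
    unfolding std_normal_density_def[abs_def]
    by (rule DERIV_cong, (rule derivative_intros)+) auto
  from DERIV_chain2[OF this assms] show ?thesis .
qed

lemma std_normal_density_minus: "\<phi> (- x) = \<phi> x"
  by (simp add: std_normal_density_def)

lemma Phi_strict_mono: "a < b \<Longrightarrow> Phi a < Phi b"
  by (rule DERIV_pos_imp_increasing) (auto intro!: derivative_eq_intros exI[of _ "\<phi> x" for x] simp: normal_density_pos)

lemma Phi_nonneg: "0 \<le> Phi t" by (simp add: Phi_def)

lemma Phi_pos: "0 < Phi t"
  using Phi_strict_mono[of "t - 1" t] Phi_nonneg[of "t-1"] by simp

text \<open>The even function \<open>Phi x + Phi (- x)\<close> has derivative zero, so it equals its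
  limit at infinity.\<close>

lemma Phi_minus: "Phi (- t) = 1 - Phi t"
proof -
  have "((\<lambda>x. Phi x + Phi (- x)) has_real_derivative 0) (at x)" for x
    by (rule derivative_eq_intros refl)+ (simp add: normal_density_def)
  then have c: "Phi x + Phi (- x) = Phi t + Phi (- t)" for x
    using DERIV_isconst_all by blast
  have "((\<lambda>x. Phi x + Phi (- x)) \<longlongrightarrow> 1 + 0) at_top"
    by (intro tendsto_add Phi_at_top filterlim_compose[OF Phi_at_bot] filterlim_uminus_at_bot_at_top)
  then have "((\<lambda>x. Phi t + Phi (- t)) \<longlongrightarrow> 1 + 0) (at_top :: real filter)"
    by (subst (asm) c)
  then show ?thesis by (auto dest: tendsto_unique[rotated 1, OF tendsto_const] simp: tendsto_const_iff)
qed

lemma Phi_less_1: "Phi t < 1"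
  using Phi_pos[of "-t"] by (simp add: Phi_minus)

text \<open>The conjugate product 2 rewrites \<open>t + r\<close> as \<open>2 / (r - t)\<close>; in
  that form the bound of \<open>Phi_le_neg\<close> is Komatu's inequality for the Mills
  ratio.\<close>

lemma sqrt_sq_add_2:
  fixes t :: real
  defines "r \<equiv> sqrt (t\<^sup>2 + 2)"
  shows "0 < r" and "- t < r" and "(r + t) * (r - t) = 2"
proof -
  have r: "r\<^sup>2 = t\<^sup>2 + 2" by (simp add: r_def)
  show "0 < r" by (simp add: r_def add_nonneg_pos)
  then show "- t < r" using r by - (rule power2_less_imp_less, auto)
  show "(r + t) * (r - t) = 2" using r by (simp add: power2_eq_square algebra_simps)
qed

text \<open>The upper bound is an antiderivative comparison: the difference of both sides has a nonnegative
  derivative on the negative half line and vanishes at \<open>-\<infinity>\<close>.\<close>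
lemma Phi_le_neg:
  assumes "t \<le> 0"
  shows "Phi t \<le> \<phi> t * (t + sqrt (t\<^sup>2 + 2))"
proof -
  define g where "g x = \<phi> x * (x + sqrt (x\<^sup>2 + 2)) - Phi x" for x
  have d: "(g has_real_derivative (- x * \<phi> x * (x + sqrt (x\<^sup>2 + 2) - 1 / sqrt (x\<^sup>2+2)))) (at x)" for x
  proof -
    have p: "0 < x\<^sup>2 + 2" by (simp add: add_nonneg_pos)
    define r where "r = sqrt (x\<^sup>2 + 2)"
    have r: "r > 0" "r * r = x * x + 2" using p by (auto simp: r_def power2_eq_square)
    have "((\<lambda>x. x + sqrt (x\<^sup>2 + 2)) has_real_derivative 1 + x / r) (at x)"
      using p unfolding r_def by (auto intro!: derivative_eq_intros simp: field_simps)
    moreover have "(\<phi> has_real_derivative - x * \<phi> x) (at x)"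
      using DERIV_std_normal_density[OF DERIV_ident] by simp
    moreover have "(Phi has_real_derivative \<phi> x) (at x)"
      using DERIV_Phi[OF DERIV_ident] by simp
    ultimately have "(g has_real_derivative - x * \<phi> x * (x + r) + (1 + x / r) * \<phi> x - \<phi> x) (at x)"
      unfolding g_def r_def by (intro DERIV_diff) (drule (1) DERIV_mult'[rotated], simp add: algebra_simps)
    moreover have "- x * \<phi> x * (x + r) + (1 + x / r) * \<phi> x - \<phi> x
       = - x * \<phi> x * (x + r - 1 / r)"
      by (simp add: field_simps)
    ultimately show ?thesis by (simp add: r_def)
  qed
  have nn: "0 \<le> - x * \<phi> x * (x + sqrt (x\<^sup>2 + 2) - 1 / sqrt (x\<^sup>2+2))" if "x \<le> 0" for x :: real
  proof -
    define r where "r = sqrt (x\<^sup>2 + 2)"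
    note r = sqrt_sq_add_2[of x, folded r_def]
    have "(r + x) * (r - x) \<le> (r + x) * (2 * r)" using r(2) that by (intro mult_left_mono) auto
    with r(3) have "1 \<le> (x + r) * r" by (simp add: algebra_simps)
    then have "1 / r \<le> x + r" using r(1) by (simp add: field_simps)
    then show ?thesis using that unfolding r_def[symmetric]
      by (intro mult_nonneg_nonneg) auto
  qed
  have lim: "(g \<longlongrightarrow> 0) at_bot"
  proof -
    have "((\<lambda>x. \<phi> x * (x + sqrt (x\<^sup>2 + 2))) \<longlongrightarrow> 0) at_bot"
      unfolding std_normal_density_def by real_asymp
    from tendsto_diff[OF this Phi_at_bot] show ?thesis by (simp add: g_def[abs_def])
  qed
  have "g x \<le> g t" if "x \<le> t" for x
    using that assms by (intro DERIV_nonneg_imp_nondecreasing[OF that]) (auto intro!: exI d nn)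
  then have "\<forall>\<^sub>F x in at_bot. g x \<le> g t" by (auto simp: eventually_at_bot_linorder)
  with lim have "0 \<le> g t" by (intro tendsto_upperbound) auto
  then show ?thesis by (simp add: g_def)
qed

text \<open>In \<open>Phi_le_neg\<close> the factor next to the density is at most
  \<open>sqrt 2\<close>. This is the source of the Gaussian decay of the likelihood.\<close>

lemma Phi_le_exp:
  assumes "t \<le> 0"
  shows "Phi t \<le> exp (- t\<^sup>2 / 2)"
proof -
  have "sqrt (t\<^sup>2 + 2) \<le> sqrt (t\<^sup>2) + sqrt 2" by (rule sqrt_add_le_add_sqrt) auto
  then have "t + sqrt (t\<^sup>2 + 2) \<le> sqrt 2" using assms by simp
  then have "Phi t \<le> \<phi> t * sqrt 2"
    using Phi_le_neg[OF assms] by (meson mult_left_mono normal_density_nonneg order_trans)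
  also have "\<dots> = 1 / sqrt pi * exp (- t\<^sup>2 / 2)"
    by (simp add: std_normal_density_def real_sqrt_mult)
  also have "\<dots> \<le> 1 * exp (- t\<^sup>2 / 2)"
    using pi_gt3 by (intro mult_right_mono) auto
  finally show ?thesis by simp
qed

section \<open>Mean and variance formulas through the inverse Mills ratio\<close>

definition mills :: "real \<Rightarrow> real" where "mills t = \<phi> t / Phi t"

text \<open>For N(t,1) truncated to the positive half line. Here and in \<open>tn_var\<close> these
  are mere formulas; \<open>tn_moments\<close> identifies them with the actual mean and
  variance.\<close>

definition tn_mean :: "real \<Rightarrow> real" where "tn_mean t = t + mills t"

definition tn_var :: "real \<Rightarrow> real" where "tn_var t = 1 - mills t * (t + mills t)"

lemma mills_pos: "0 < mills t"
  by (simp add: mills_def Phi_pos normal_density_pos)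

lemma mills_ge:
  assumes "t \<le> 0"
  shows "(sqrt (t\<^sup>2 + 2) - t) / 2 \<le> mills t"
proof -
  define r where "r = sqrt (t\<^sup>2 + 2)"
  note r = sqrt_sq_add_2[of t, folded r_def]
  have "(r - t) / 2 * Phi t \<le> (r - t) / 2 * (\<phi> t * (t + r))"
    using Phi_le_neg[OF assms] assms r(1) unfolding r_def[symmetric] by (intro mult_left_mono) auto
  also have "\<dots> = \<phi> t * ((r + t) * (r - t)) / 2" by (simp add: field_simps)
  also have "\<dots> = \<phi> t" by (simp add: r(3))
  finally show ?thesis
    using Phi_pos[of t] unfolding mills_def r_def[symmetric] by (simp add: pos_le_divide_eq)
qed

text \<open>For negative \<open>t\<close> the bound of \<open>mills_ge\<close> exceeds
  \<open>- t\<close>, because the square root does. Proved before the formula is known to be a mean,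
  since the computation of the moments relies on it.\<close>

lemma tn_mean_pos: "0 < tn_mean t"
proof (cases "t \<le> 0")
  case True
  from mills_ge[OF True] sqrt_sq_add_2(2)[of t] show ?thesis by (simp add: tn_mean_def)
next
  case False
  then show ?thesis using mills_pos[of t] by (simp add: tn_mean_def)
qed

lemma tn_var_le_1: "tn_var t \<le> 1"
  using tn_mean_pos[of t] mills_pos[of t] by (simp add: tn_var_def tn_mean_def)

text \<open>The lower bounds for \<open>mills t\<close> and \<open>t + mills t\<close> are halves of
  conjugate factors with product 2, so their product is exactly 1/2.\<close>

lemma tn_var_le_half:
  assumes "t \<le> 0"
  shows "tn_var t \<le> 1 / 2"
proof -
  define r where "r = sqrt (t\<^sup>2 + 2)"
  note r = sqrt_sq_add_2[of t, folded r_def]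
  have "1/2 = (r - t) / 2 * ((r + t) / 2)"
    using r(3) by (simp add: mult.commute)
  also have "\<dots> \<le> mills t * (t + mills t)"
    using mills_ge[OF assms] assms r(1,2) unfolding r_def[symmetric]
    by (intro mult_mono) auto
  finally show ?thesis by (simp add: tn_var_def)
qed

text \<open>The exponential family identity: the derivative of the mean in the location parameter is
  the variance. It links the variance bounds to the contraction of the mean map.\<close>

lemma DERIV_tn_mean [derivative_intros]:
  assumes "(f has_real_derivative f') (at x within S)"
  shows "((\<lambda>x. tn_mean (f x)) has_real_derivative tn_var (f x) * f') (at x within S)"
proof -
  have "(tn_mean has_real_derivative tn_var t) (at t)" for t
    unfolding tn_mean_def tn_var_def mills_def using Phi_pos[of t]
    by (auto intro!: derivative_eq_intros simp: field_simps power2_eq_square)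
  from DERIV_chain2[OF this assms] show ?thesis .
qed

section \<open>Moments of truncated normals from explicit antiderivatives\<close>

lemma Phi_shift_at_top: "((\<lambda>z. Phi (z - \<theta>)) \<longlongrightarrow> 1) at_top"
  by (rule filterlim_compose[OF Phi_at_top]) real_asymp

text \<open>Reduces every moment to an antiderivative \<open>F\<close> of \<open>w\<close> times the
  shifted density and its limit at infinity. For the moments 0, 1 and 2 such an \<open>F\<close> is
  a combination of \<open>Phi\<close> and its density.\<close>

lemma nn_integral_tn_True:
  assumes "\<And>z. 0 \<le> z \<Longrightarrow> 0 \<le> w z" "w \<in> borel_measurable borel"
    and "\<And>z. (F has_real_derivative w z * \<phi> (z - \<theta>)) (at z)"
    and "(F \<longlongrightarrow> T) at_top"
  shows "(\<integral>\<^sup>+z. ennreal (w z) \<partial>tn_measure \<theta> True) = ennreal ((T - F 0) / Phi \<theta>)"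
proof -
  have [measurable]: "w \<in> borel_measurable borel" by fact
  have "(\<integral>\<^sup>+z. ennreal (w z) \<partial>tn_measure \<theta> True)
      = (\<integral>\<^sup>+z. ennreal (indicator {0<..} z * normal_density \<theta> 1 z / Phi \<theta>) * ennreal (w z) \<partial>lborel)"
    unfolding tn_measure_def by (subst nn_integral_density) auto
  also have "\<dots> = (\<integral>\<^sup>+z. ennreal (w z * \<phi> (z - \<theta>)) * indicator {0..} z * ennreal (1 / Phi \<theta>) \<partial>lborel)"
  \<comment> \<open>The truncation uses the open half line and the fundamental theorem the closed
    one; they differ in a null point.\<close>
  proof (rule nn_integral_cong_AE, rule AE_mp[OF AE_lborel_singleton[of 0]], intro AE_I2 impI)
    fix z :: real assume z: "z \<noteq> 0"
    show "ennreal (indicator {0<..} z * normal_density \<theta> 1 z / Phi \<theta>) * ennreal (w z)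
      = ennreal (w z * \<phi> (z - \<theta>)) * indicator {0..} z * ennreal (1 / Phi \<theta>)"
    proof (cases "0 < z")
      case True
      then show ?thesis using assms(1)[of z] Phi_pos[of \<theta>]
        by (simp add: ennreal_mult'[symmetric] ennreal_mult''[symmetric])
           (simp add: normal_density_def mult_ac)
    qed (use z in simp)
  qed
  also have "\<dots> = (\<integral>\<^sup>+z. ennreal (w z * \<phi> (z - \<theta>)) * indicator {0..} z \<partial>lborel) * ennreal (1 / Phi \<theta>)"
    by (rule nn_integral_multc) measurable
  also have "(\<integral>\<^sup>+z. ennreal (w z * \<phi> (z - \<theta>)) * indicator {0..} z \<partial>lborel) = ennreal (T - F 0)"
    by (rule nn_integral_FTC_atLeast) (use assms in auto)
  finally show ?thesis
    using Phi_pos[of \<theta>] by (simp add: ennreal_mult''[symmetric])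
qed

lemma sets_tn_measure [measurable_cong, simp]: "sets (tn_measure \<theta> y) = sets borel"
  by (simp add: tn_measure_def)

lemma emeasure_tn_True: "(\<integral>\<^sup>+z. 1 \<partial>tn_measure \<theta> True) = 1"
proof -
  have "(\<integral>\<^sup>+z. ennreal 1 \<partial>tn_measure \<theta> True) = ennreal ((1 - Phi (0 - \<theta>)) / Phi \<theta>)"
    by (rule nn_integral_tn_True[OF _ _ _ Phi_shift_at_top]) (auto intro!: derivative_eq_intros)
  also have "(1 - Phi (0 - \<theta>)) / Phi \<theta> = 1" using Phi_pos[of \<theta>] Phi_minus[of \<theta>] by simp
  finally show ?thesis by simp
qed

lemma nn_integral_tn_True_1: "(\<integral>\<^sup>+z. ennreal \<bar>z\<bar> \<partial>tn_measure \<theta> True) = ennreal (tn_mean \<theta>)"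
proof -
  have "(\<integral>\<^sup>+z. ennreal \<bar>z\<bar> \<partial>tn_measure \<theta> True) = (\<integral>\<^sup>+z. ennreal z \<partial>tn_measure \<theta> True)"
    unfolding tn_measure_def
    by (subst (1 2) nn_integral_density) (auto intro!: nn_integral_cong split: split_indicator)
  also have "\<dots> = ennreal ((\<theta> - (\<theta> * Phi (0 - \<theta>) - \<phi> (0 - \<theta>))) / Phi \<theta>)"
  proof (rule nn_integral_tn_True[where F="\<lambda>z. \<theta> * Phi (z - \<theta>) - \<phi> (z - \<theta>)"])
    have "((\<lambda>z. \<phi> (z - \<theta>)) \<longlongrightarrow> 0) at_top"
      unfolding std_normal_density_def by real_asymp
    from tendsto_diff[OF tendsto_mult_left[OF Phi_shift_at_top] this]
    show "((\<lambda>z. \<theta> * Phi (z - \<theta>) - \<phi> (z - \<theta>)) \<longlongrightarrow> \<theta>) at_top" by simp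
  qed (auto intro!: derivative_eq_intros simp: algebra_simps)
  also have "(\<theta> - (\<theta> * Phi (0 - \<theta>) - \<phi> (0 - \<theta>))) / Phi \<theta> = tn_mean \<theta>"
    using Phi_pos[of \<theta>]
    by (simp add: tn_mean_def mills_def Phi_minus std_normal_density_minus) (simp add: field_simps)
  finally show ?thesis .
qed

lemma nn_integral_tn_True_2: "(\<integral>\<^sup>+z. ennreal (z\<^sup>2) \<partial>tn_measure \<theta> True) = ennreal (1 + \<theta> * tn_mean \<theta>)"
proof -
  have "(\<integral>\<^sup>+z. ennreal (z\<^sup>2) \<partial>tn_measure \<theta> True)
      = ennreal (((1 + \<theta>\<^sup>2) - ((1 + \<theta>\<^sup>2) * Phi (0 - \<theta>) - (0 + \<theta>) * \<phi> (0 - \<theta>))) / Phi \<theta>)"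
  proof (rule nn_integral_tn_True[where F="\<lambda>z. (1 + \<theta>\<^sup>2) * Phi (z - \<theta>) - (z + \<theta>) * \<phi> (z - \<theta>)"])
    have "((\<lambda>z. (z + \<theta>) * \<phi> (z - \<theta>)) \<longlongrightarrow> 0) at_top"
      unfolding std_normal_density_def by real_asymp
    from tendsto_diff[OF tendsto_mult_left[OF Phi_shift_at_top] this]
    show "((\<lambda>z. (1 + \<theta>\<^sup>2) * Phi (z - \<theta>) - (z + \<theta>) * \<phi> (z - \<theta>)) \<longlongrightarrow> 1 + \<theta>\<^sup>2) at_top" by simp
  qed (auto intro!: derivative_eq_intros simp: algebra_simps power2_eq_square)
  also have "((1 + \<theta>\<^sup>2) - ((1 + \<theta>\<^sup>2) * Phi (0 - \<theta>) - (0 + \<theta>) * \<phi> (0 - \<theta>))) / Phi \<theta> = 1 + \<theta> * tn_mean \<theta>"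
    using Phi_pos[of \<theta>]
    by (simp add: tn_mean_def mills_def Phi_minus std_normal_density_minus) (simp add: field_simps power2_eq_square)
  finally show ?thesis .
qed

text \<open>With responses coded as signs, both truncations become the positive one at location
  \<open>ysign y * \<theta>\<close>, so that a single set of formulas serves both.\<close>

definition ysign :: "bool \<Rightarrow> real" where "ysign y = (if y then 1 else - 1)"

lemma ysign_simps [simp]: "ysign y * ysign y = 1" "ysign y * (ysign y * a) = a" "(ysign y)\<^sup>2 = 1" "\<bar>ysign y\<bar> = 1"
  by (auto simp: ysign_def)

lemma tn_measure_False: "tn_measure \<theta> False = distr (tn_measure (- \<theta>) True) borel uminus"
proof (rule measure_eqI)
  fix A assume "A \<in> sets (tn_measure \<theta> False)"
  then have [measurable]: "A \<in> sets borel" by simp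
  have "emeasure (distr (tn_measure (- \<theta>) True) borel uminus) A
      = (\<integral>\<^sup>+z. ennreal (indicator {0<..} z * normal_density (- \<theta>) 1 z / Phi (- \<theta>)) * indicator A (- z) \<partial>lborel)"
    unfolding tn_measure_def
    by (subst nn_integral_indicator[symmetric], simp, subst nn_integral_distr, simp, simp, subst nn_integral_density)
       auto
  also have "\<dots> = (\<integral>\<^sup>+z. ennreal (indicator {0<..} (- z) * normal_density (- \<theta>) 1 (- z) / Phi (- \<theta>)) * indicator A (- (- z)) \<partial>lborel)"
    by (subst lborel_distr_uminus[symmetric], subst nn_integral_distr) auto
  also have "\<dots> = emeasure (tn_measure \<theta> False) A"
    unfolding tn_measure_def
    by (subst emeasure_density, simp, simp, rule nn_integral_cong)
       (auto simp: Phi_minus normal_density_def power2_commute[of _ \<theta>] power2_eq_square algebra_simps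
         split: split_indicator)
  finally show "emeasure (tn_measure \<theta> False) A = emeasure (distr (tn_measure (- \<theta>) True) borel uminus) A" ..
qed simp

lemma tn_measure_distr: "tn_measure \<theta> y = distr (tn_measure (ysign y * \<theta>) True) borel (\<lambda>z. ysign y * z)"
  by (cases y) (auto simp: ysign_def tn_measure_False intro!: distr_id2[symmetric])

lemma prob_space_tn: "prob_space (tn_measure \<theta> y)"
proof -
  have "prob_space (tn_measure t True)" for t
    using emeasure_tn_True[of t] by (intro prob_spaceI) simp
  then show ?thesis unfolding tn_measure_distr[of \<theta> y]
    by (intro prob_space.prob_space_distr) measurable
qed

lemma tn_True_moments:
  shows "integrable (tn_measure \<theta> True) (\<lambda>z. z)" (is ?A)
    and "integrable (tn_measure \<theta> True) (\<lambda>z. z\<^sup>2)" (is ?B)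
    and "(\<integral>z. z \<partial>tn_measure \<theta> True) = tn_mean \<theta>" (is ?C)
    and "(\<integral>z. z\<^sup>2 \<partial>tn_measure \<theta> True) = 1 + \<theta> * tn_mean \<theta>" (is ?D)
proof -
  show ?A by (rule integrableI_bounded) (auto simp: nn_integral_tn_True_1)
  show ?B by (rule integrableI_bounded) (auto simp: nn_integral_tn_True_2)
  have pos: "AE z in tn_measure \<theta> True. 0 \<le> z"
    unfolding tn_measure_def by (subst AE_density) (auto split: split_indicator)
  then have "(\<integral>z. z \<partial>tn_measure \<theta> True) = (\<integral>z. \<bar>z\<bar> \<partial>tn_measure \<theta> True)"
    by (intro integral_cong_AE) auto
  also have "\<dots> = tn_mean \<theta>"
    by (subst integral_eq_nn_integral) (use tn_mean_pos[of \<theta>] in \<open>auto simp: nn_integral_tn_True_1\<close>)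
  finally show ?C .
  \<comment> \<open>\<open>ennreal\<close> sends negative numbers to 0, so the sign must be settled
    before the real integral can be read off. A negative value would make the second moment 0,
    against the positive mean.\<close>
  have "0 \<le> 1 + \<theta> * tn_mean \<theta>"
  proof (rule ccontr)
    assume "\<not> ?thesis"
    then have "(\<integral>\<^sup>+z. ennreal (z\<^sup>2) \<partial>tn_measure \<theta> True) = 0"
      by (simp add: nn_integral_tn_True_2 ennreal_neg)
    then have "AE z in tn_measure \<theta> True. z = 0" by (subst (asm) nn_integral_0_iff_AE) auto
    then have "(\<integral>z. z \<partial>tn_measure \<theta> True) = (\<integral>z. 0 \<partial>tn_measure \<theta> True)"
      by (intro integral_cong_AE) auto
    with \<open>?C\<close> tn_mean_pos[of \<theta>] show False by simp
  qed
  then show ?D by (subst integral_eq_nn_integral) (auto simp: nn_integral_tn_True_2)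
qed

lemma tn_moments:
  shows "integrable (tn_measure \<theta> y) (\<lambda>z. z)" (is ?A)
    and "integrable (tn_measure \<theta> y) (\<lambda>z. z\<^sup>2)" (is ?B)
    and "(\<integral>z. z \<partial>tn_measure \<theta> y) = ysign y * tn_mean (ysign y * \<theta>)" (is ?C)
    and "(\<integral>z. (z - ysign y * tn_mean (ysign y * \<theta>))\<^sup>2 \<partial>tn_measure \<theta> y) = tn_var (ysign y * \<theta>)" (is ?D)
proof -
  let ?t = "ysign y * \<theta>"
  note d = tn_measure_distr[of \<theta> y]
  show A: ?A unfolding d by (subst integrable_distr_eq) (auto intro: tn_True_moments)
  show B: ?B unfolding d by (subst integrable_distr_eq) (auto intro: tn_True_moments simp: power_mult_distrib)
  show C: ?C unfolding d by (subst integral_distr) (auto simp: tn_True_moments)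
  have D: "(\<integral>z. z\<^sup>2 \<partial>tn_measure \<theta> y) = 1 + ?t * tn_mean ?t"
    unfolding d by (subst integral_distr) (auto simp: tn_True_moments power_mult_distrib)
  interpret prob_space "tn_measure \<theta> y" by (rule prob_space_tn)
  have "variance (\<lambda>z. z) = 1 + ?t * tn_mean ?t - (ysign y * tn_mean ?t)\<^sup>2"
    using A B by (subst variance_eq) (auto simp: C D)
  also have "\<dots> = tn_var ?t"
    by (simp add: power_mult_distrib tn_var_def tn_mean_def power2_eq_square algebra_simps)
  finally show ?D by (simp add: C)
qed

text \<open>No estimate of the inverse Mills ratio is needed, since the formula is a genuine
  variance.\<close>

lemma tn_var_nonneg: "0 \<le> tn_var t"
proof -
  have "0 \<le> (\<integral>z. (z - ysign True * tn_mean (ysign True * t))\<^sup>2 \<partial>tn_measure t True)"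
    by (rule integral_nonneg_AE) simp
  then show ?thesis unfolding tn_moments(4) by (simp add: ysign_def)
qed

section \<open>Lebesgue measure under linear maps\<close>

text \<open>The change of variables theorems of the library ask for a wellordered index type.\<close>

definition scales_volume :: "real^'n^'n \<Rightarrow> bool" where
  "scales_volume A \<longleftrightarrow> (\<forall>f::real^'n \<Rightarrow> ennreal. f \<in> borel_measurable borel \<longrightarrow> det A \<noteq> 0 \<longrightarrow>
     (\<integral>\<^sup>+x. f x \<partial>lborel) = ennreal \<bar>det A\<bar> * (\<integral>\<^sup>+x. f (A *v x) \<partial>lborel))"

lemma borel_measurable_matrix_vector_mult [measurable]:
  fixes A :: "real^'n^'m"
  shows "(\<lambda>x. A *v x) \<in> borel_measurable borel"
  by (intro borel_measurable_continuous_onI linear_continuous_on) (simp add: linear_linear)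

lemma scales_volumeD:
  fixes f :: "real^'n \<Rightarrow> ennreal"
  shows "scales_volume A \<Longrightarrow> f \<in> borel_measurable borel \<Longrightarrow> det A \<noteq> 0 \<Longrightarrow>
    (\<integral>\<^sup>+x. f x \<partial>lborel) = ennreal \<bar>det A\<bar> * (\<integral>\<^sup>+x. f (A *v x) \<partial>lborel)"
  unfolding scales_volume_def by blast

lemma scales_volume_mult:
  fixes A B :: "real^'n^'n"
  assumes "scales_volume A" "scales_volume B"
  shows "scales_volume (A ** B)"
  unfolding scales_volume_def
proof (intro allI impI)
  fix f :: "real^'n \<Rightarrow> ennreal" assume f [measurable]: "f \<in> borel_measurable borel"
  assume "det (A ** B) \<noteq> 0"
  then have d: "det A \<noteq> 0" "det B \<noteq> 0" by (auto simp: det_mul)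
  have "(\<integral>\<^sup>+x. f x \<partial>lborel) = ennreal \<bar>det A\<bar> * (\<integral>\<^sup>+x. f (A *v x) \<partial>lborel)"
    using assms(1) f d(1) by (rule scales_volumeD)
  also have "(\<integral>\<^sup>+x. f (A *v x) \<partial>lborel) = ennreal \<bar>det B\<bar> * (\<integral>\<^sup>+x. f (A *v (B *v x)) \<partial>lborel)"
    by (rule scales_volumeD[OF assms(2) _ d(2)]) measurable
  finally show "(\<integral>\<^sup>+x. f x \<partial>lborel) = ennreal \<bar>det (A ** B)\<bar> * (\<integral>\<^sup>+x. f (A ** B *v x) \<partial>lborel)"
    by (simp add: det_mul abs_mult ennreal_mult matrix_vector_mul_assoc mult.assoc)
qed

lemma prod_Basis_vec: "(\<Prod>j\<in>(Basis::(real^'n) set). g j) = (\<Prod>i\<in>UNIV. g (axis i 1))"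
proof -
  have B: "Basis = (\<lambda>i. axis i (1::real)) ` (UNIV::'n set)" by (auto simp: Basis_vec_def)
  show ?thesis unfolding B by (subst prod.reindex) (auto simp: inj_on_def axis_eq_axis)
qed

lemma sum_Basis_vec: "(\<Sum>j\<in>(Basis::(real^'n) set). g j) = (\<Sum>i\<in>UNIV. g (axis i 1))"
proof -
  have B: "Basis = (\<lambda>i. axis i (1::real)) ` (UNIV::'n set)" by (auto simp: Basis_vec_def)
  show ?thesis unfolding B by (subst sum.reindex) (auto simp: inj_on_def axis_eq_axis)
qed

text \<open>A coordinatewise scaling; \<open>c\<close> below reads off the diagonal entry belonging
  to a basis vector, as the affine transformation rule for \<open>lborel\<close> expects.\<close>

lemma scales_volume_diagonal:
  fixes A :: "real^'n^'n"
  assumes d: "\<And>i j. i \<noteq> j \<Longrightarrow> A$i$j = 0"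
  shows "scales_volume A"
  unfolding scales_volume_def
proof (intro allI impI)
  fix f :: "real^'n \<Rightarrow> ennreal" assume [measurable]: "f \<in> borel_measurable borel"
  assume "det A \<noteq> 0"
  have det: "det A = (\<Prod>i\<in>UNIV. A$i$i)" using d by (rule det_diagonal)
  with \<open>det A \<noteq> 0\<close> have nz: "A$i$i \<noteq> 0" for i by auto
  define c where "c b = b \<bullet> (A *v b)" for b
  have Av: "(A *v x) $ i = A$i$i * x$i" for x i
    unfolding matrix_vector_mult_def using d by (simp add: sum.remove[of UNIV i])
  have c: "c (axis i 1) = A$i$i" for i
    by (simp add: c_def inner_axis' Av)
  have T: "0 + (\<Sum>j\<in>Basis. (c j * (x \<bullet> j)) *\<^sub>R j) = A *v x" for x
  proof -
    have "0 + (\<Sum>j\<in>Basis. (c j * (x \<bullet> j)) *\<^sub>R j) = (\<Sum>i\<in>UNIV. (A$i$i * x$i) *\<^sub>R axis i 1)"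
      by (simp add: sum_Basis_vec c inner_axis)
    also have "\<dots> = A *v x"
      by (simp add: vec_eq_iff Av axis_def if_distrib cong: if_cong)
    finally show ?thesis .
  qed
  have nzc: "c j \<noteq> 0" if "j \<in> Basis" for j using that nz by (auto simp: Basis_vec_def c)
  have eq: "(lborel::(real^'n) measure) = density (distr lborel borel (\<lambda>x. A *v x)) (\<lambda>_. (\<Prod>j\<in>Basis. \<bar>c j\<bar>))"
    using lborel_affine_euclidean[where c=c and t=0, OF nzc] unfolding T by simp
  have "(\<Prod>j\<in>(Basis::(real^'n) set). \<bar>c j\<bar>) = \<bar>det A\<bar>"
    by (simp add: prod_Basis_vec c det abs_prod)
  with eq have eq: "(lborel::(real^'n) measure) = density (distr lborel borel (\<lambda>x. A *v x)) (\<lambda>_. \<bar>det A\<bar>)" by simp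
  show "(\<integral>\<^sup>+x. f x \<partial>lborel) = ennreal \<bar>det A\<bar> * (\<integral>\<^sup>+x. f (A *v x) \<partial>lborel)"
    by (subst eq) (simp add: nn_integral_density nn_integral_distr nn_integral_cmult)
qed

text \<open>Exchanging two coordinates maps boxes to boxes with the same side lengths, and the
  values on boxes characterise Lebesgue measure.\<close>

lemma scales_volume_swap:
  fixes m n :: "'n::finite"
  shows "scales_volume (\<chi> i j. mat 1 $ i $ Transposition.transpose m n j :: real^'n^'n)" (is "scales_volume ?A")
  unfolding scales_volume_def
proof (intro allI impI)
  fix f :: "real^'n \<Rightarrow> ennreal" assume [measurable]: "f \<in> borel_measurable borel"
  let ?t = "Transposition.transpose m n"
  have Av: "(?A *v x) $ i = x $ ?t i" for x i
    by (simp add: matrix_vector_mult_def mat_def if_distrib[of "\<lambda>u. u * _"] cong: if_cong)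
       (subst sum.remove[of UNIV "?t i"], auto intro!: sum.neutral split: if_splits)
  have "\<bar>det ?A\<bar> = 1"
  proof -
    have "?t permutes UNIV" by (simp add: permutes_swap_id)
    then have "det ?A = of_int (sign ?t) * det (mat 1 :: real^'n^'n)" by (rule det_permute_columns)
    then show ?thesis by (simp add: sign_def)
  qed
  moreover have "(lborel::(real^'n) measure) = distr lborel borel (\<lambda>x. ?A *v x)"
  proof (rule lborel_eqI)
    fix l u :: "real^'n" assume lu: "\<And>b. b \<in> Basis \<Longrightarrow> l \<bullet> b \<le> u \<bullet> b"
    then have lu: "l $ i \<le> u $ i" for i
      using lu[of "axis i 1"] by (simp add: axis_in_Basis_iff inner_axis)
    have "(\<lambda>x. ?A *v x) -` box l u \<inter> space lborel = box (?A *v l) (?A *v u)"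
    proof -
      have "(\<forall>i. l $ i < x $ ?t i \<and> x $ ?t i < u $ i) \<longleftrightarrow> (\<forall>i. l $ ?t i < x $ i \<and> x $ i < u $ ?t i)" for x
        by (metis transpose_involutory)
      then show ?thesis by (auto simp: mem_box_cart Av)
    qed
    then have "emeasure (distr lborel borel (\<lambda>x. ?A *v x)) (box l u) = emeasure lborel (box (?A *v l) (?A *v u))"
      by (subst emeasure_distr) auto
    also have "\<dots> = (\<Prod>b\<in>Basis. (?A *v u - ?A *v l) \<bullet> b)"
      by (rule emeasure_lborel_box) (use lu in \<open>auto simp: Basis_vec_def inner_axis Av\<close>)
    also have "(\<Prod>b\<in>Basis. (?A *v u - ?A *v l) \<bullet> b) = (\<Prod>i\<in>UNIV. u $ ?t i - l $ ?t i)"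
      by (simp add: prod_Basis_vec inner_axis Av)
    also have "\<dots> = (\<Prod>i\<in>UNIV. u $ i - l $ i)"
      by (rule prod.reindex_bij_betw) simp
    also have "\<dots> = (\<Prod>b\<in>Basis. (u - l) \<bullet> b)" by (simp add: prod_Basis_vec inner_axis)
    finally show "emeasure (distr lborel borel (\<lambda>x. ?A *v x)) (box l u) = (\<Prod>b\<in>Basis. (u - l) \<bullet> b)" .
  qed simp
  from arg_cong[OF this, of "\<lambda>M. \<integral>\<^sup>+x. f x \<partial>M"]
  have "(\<integral>\<^sup>+x. f x \<partial>lborel) = (\<integral>\<^sup>+x. f (?A *v x) \<partial>lborel)"
    by (subst (asm) nn_integral_distr) auto
  ultimately show "(\<integral>\<^sup>+x. f x \<partial>lborel) = ennreal \<bar>det ?A\<bar> * (\<integral>\<^sup>+x. f (?A *v x) \<partial>lborel)" by simp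
qed

text \<open>By Fubini coordinate \<open>m\<close> is integrated innermost. There the shear is a
  translation by coordinate \<open>n\<close>, which is constant in that integral.\<close>

lemma scales_volume_shear:
  fixes m n :: "'n::finite"
  assumes "m \<noteq> n"
  shows "scales_volume (\<chi> i j. of_bool (i = m \<and> j = n \<or> i = j) :: real^'n^'n)" (is "scales_volume ?A")
  unfolding scales_volume_def
proof (intro allI impI)
  fix f :: "real^'n \<Rightarrow> ennreal" assume [measurable]: "f \<in> borel_measurable borel"
  have "?A = (\<chi> k. if k = m then row m (mat 1) + 1 *s row n (mat 1) else row k (mat 1))"
    using assms by (auto simp: vec_eq_iff row_def mat_def)
  then have "det ?A = 1" using assms by (simp add: det_row_operation)
  have Av: "?A *v x = x + x $ n *\<^sub>R axis m 1" for x
  proof -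
    have "(?A *v x) $ i = (x + x $ n *\<^sub>R axis m 1) $ i" for i
    proof (cases "i = m")
      case True
      then show ?thesis using assms
        by (simp add: matrix_vector_mult_def if_distrib[of "\<lambda>u. u * _"] of_bool_def axis_def
            sum.remove[of UNIV m] sum.remove[of "UNIV - {m}" n] cong: if_cong)
    next
      case False
      then show ?thesis
        by (simp add: matrix_vector_mult_def of_bool_def axis_def if_distrib[of "\<lambda>u. u * _"] cong: if_cong)
    qed
    then show ?thesis by (simp add: vec_eq_iff)
  qed
  let ?b = "axis m 1 :: real^'n"
  define J where "J = (Basis :: (real^'n) set) - {?b}"
  have B: "Basis = insert ?b J" "?b \<notin> J" "finite J"
    by (auto simp: J_def axis_in_Basis_iff)
  have nJ: "axis n 1 \<in> J" using assms by (auto simp: J_def axis_in_Basis_iff axis_eq_axis)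
  interpret P: product_sigma_finite "\<lambda>b::real^'n. lborel :: real measure" ..
  define F :: "(real^'n \<Rightarrow> real) \<Rightarrow> real^'n" where "F g = (\<Sum>b\<in>Basis. g b *\<^sub>R b)" for g
  have [measurable]: "F \<in> (\<Pi>\<^sub>M b\<in>Basis. lborel) \<rightarrow>\<^sub>M borel" unfolding F_def by measurable
  have [measurable]: "F \<in> (\<Pi>\<^sub>M b\<in>insert ?b J. lborel) \<rightarrow>\<^sub>M borel" unfolding B(1)[symmetric] by measurable
  have red: "(\<integral>\<^sup>+x. h x \<partial>lborel) = (\<integral>\<^sup>+g. \<integral>\<^sup>+y. h (F (g(?b := y))) \<partial>lborel \<partial>(\<Pi>\<^sub>M b\<in>J. lborel))"
    if [measurable]: "h \<in> borel_measurable borel" for h :: "real^'n \<Rightarrow> ennreal"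
  proof -
    have "(\<integral>\<^sup>+x. h x \<partial>lborel) = (\<integral>\<^sup>+g. h (F g) \<partial>(\<Pi>\<^sub>M b\<in>Basis. lborel))"
      by (subst lborel_eq, subst nn_integral_distr) (simp_all add: F_def)
    also have "\<dots> = (\<integral>\<^sup>+g. \<integral>\<^sup>+y. h (F (g(?b := y))) \<partial>lborel \<partial>(\<Pi>\<^sub>M b\<in>J. lborel))"
      unfolding B(1) by (rule P.product_nn_integral_insert) (use B in \<open>auto simp del: F_def\<close>)
    finally show ?thesis .
  qed
  have Fn: "F g $ n = g (axis n 1)" for g
    by (simp add: F_def sum_Basis_vec axis_def if_distrib cong: if_cong)
  have shift: "?A *v F (g(?b := y)) = F (g(?b := g (axis n 1) + 1 * y))" for g y
  proof -
    have "F (g(?b := y)) = y *\<^sub>R ?b + (\<Sum>b\<in>J. g b *\<^sub>R b)" for y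
      unfolding F_def B(1) using B(2,3) by (simp, intro sum.cong) auto
    moreover have "F (g(?b := y)) $ n = g (axis n 1)"
      unfolding Fn using nJ B(2) by auto
    ultimately show ?thesis unfolding Av by (simp add: algebra_simps)
  qed
  have "(\<integral>\<^sup>+x. f (?A *v x) \<partial>lborel) = (\<integral>\<^sup>+g. \<integral>\<^sup>+y. f (?A *v F (g(?b := y))) \<partial>lborel \<partial>(\<Pi>\<^sub>M b\<in>J. lborel))"
    by (rule red) measurable
  also have "\<dots> = (\<integral>\<^sup>+g. \<integral>\<^sup>+y. f (F (g(?b := y))) \<partial>lborel \<partial>(\<Pi>\<^sub>M b\<in>J. lborel))"
  proof (rule nn_integral_cong)
    fix g assume g: "g \<in> space (\<Pi>\<^sub>M b\<in>J. lborel :: real measure)"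
    have "(\<lambda>y. F (g(?b := y))) \<in> borel_measurable borel"
      unfolding F_def fun_upd_def by measurable
    then have m: "(\<lambda>y. f (F (g(?b := y)))) \<in> borel_measurable borel" by measurable
    show "(\<integral>\<^sup>+y. f (?A *v F (g(?b := y))) \<partial>lborel) = (\<integral>\<^sup>+y. f (F (g(?b := y))) \<partial>lborel)"
      unfolding shift using nn_integral_real_affine[OF m, of 1 "g (axis n 1)"] by simp
  qed
  also have "\<dots> = (\<integral>\<^sup>+x. f x \<partial>lborel)" by (rule red[symmetric]) measurable
  finally show "(\<integral>\<^sup>+x. f x \<partial>lborel) = ennreal \<bar>det ?A\<bar> * (\<integral>\<^sup>+x. f (?A *v x) \<partial>lborel)"
    using \<open>det ?A = 1\<close> by simp
qed

text \<open>Every matrix is a product of elementary ones and matrices with a zero row; the latter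
  are singular, where the claim is vacuous.\<close>

lemma scales_volume:
  fixes A :: "real^'n^'n"
  shows "scales_volume A"
proof (rule induct_matrix_elementary_alt[of scales_volume])
  fix A :: "real^'n^'n" and i assume "row i A = 0"
  then have "det A = 0" by (rule det_zero_row(2))
  then show "scales_volume A" by (simp add: scales_volume_def)
next
  fix A :: "real^'n^'n" assume "\<And>i j. i \<noteq> j \<Longrightarrow> A $ i $ j = 0"
  then show "scales_volume A" by (rule scales_volume_diagonal)
qed (simp_all only: scales_volume_mult scales_volume_swap scales_volume_shear not_False_eq_True)

lemma nn_integral_linear_substitution:
  fixes A :: "real^'n^'n"
  assumes [measurable]: "f \<in> borel_measurable borel" and "det A \<noteq> 0"
  shows "(\<integral>\<^sup>+x. f x \<partial>lborel) = ennreal \<bar>det A\<bar> * (\<integral>\<^sup>+x. f (m + A *v x) \<partial>lborel)"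
proof -
  have "(\<integral>\<^sup>+x. f x \<partial>lborel) = (\<integral>\<^sup>+x. f (m + x) \<partial>lborel)"
    by (subst lborel_distr_plus[of m, symmetric], subst nn_integral_distr) auto
  also have "\<dots> = ennreal \<bar>det A\<bar> * (\<integral>\<^sup>+x. f (m + A *v x) \<partial>lborel)"
    by (rule scales_volumeD[OF scales_volume _ assms(2)]) measurable
  finally show ?thesis .
qed

section \<open>Multivariate normal distributions\<close>

lemma inner_matrix_transpose: "x \<bullet> ((A::real^'n^'m) *v y) = (transpose A *v x) \<bullet> y"
  by (metis dot_lmul_matrix transpose_matrix_vector)

lemma pos_def_inner_commute:
  assumes "pos_def (S::real^'p^'p)"
  shows "x \<bullet> (S *v y) = (S *v x) \<bullet> y"
proof -
  have "transpose S = S" using assms by (simp add: pos_def_def vec_eq_iff transpose_def)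
  then show ?thesis by (simp add: inner_matrix_transpose)
qed

text \<open>Gram-Schmidt for the inner product given by \<open>S\<close>: fewer than p vectors
  \<open>S *v b j\<close> leave a nonzero vector orthogonal to all of them, which is then
  normalised.\<close>

lemma pos_def_orthonormal_family:
  assumes "pos_def (S::real^'p^'p)"
  shows "\<exists>b. \<forall>i\<in>I. \<forall>j\<in>I. b i \<bullet> (S *v b j) = of_bool (i = (j::'p))"
  using finite[of I]
proof (induction I rule: finite_induct)
  case (insert k I)
  then obtain b where b: "\<forall>i\<in>I. \<forall>j\<in>I. b i \<bullet> (S *v b j) = of_bool (i = j)" by blast
  have "dim ((\<lambda>j. S *v b j) ` I) \<le> card ((\<lambda>j. S *v b j) ` I)" by (rule dim_le_card') simp
  also have "\<dots> \<le> card I" by (rule card_image_le) simp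
  also have "\<dots> < CARD('p)" using insert by (metis UNIV_I card_seteq finite not_le subset_UNIV)
  finally obtain x where x: "x \<noteq> 0" "\<And>y. y \<in> span ((\<lambda>j. S *v b j) ` I) \<Longrightarrow> orthogonal x y"
    using orthogonal_to_subspace_exists[of "(\<lambda>j. S *v b j) ` I"] by (auto simp: DIM_cart)
  have xj: "x \<bullet> (S *v b j) = 0" if "j \<in> I" for j
    using x(2)[of "S *v b j"] that by (auto simp: orthogonal_def intro: span_base)
  have c: "0 < x \<bullet> (S *v x)" using assms x(1) by (simp add: pos_def_def)
  define y where "y = x /\<^sub>R sqrt (x \<bullet> (S *v x))"
  have yy: "y \<bullet> (S *v y) = 1" using c by (simp add: y_def matrix_vector_mult_scaleR field_simps)
  have yj: "y \<bullet> (S *v b j) = 0" "b j \<bullet> (S *v y) = 0" if "j \<in> I" for j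
    using xj[OF that] pos_def_inner_commute[OF assms, of "b j" y] by (simp_all add: y_def inner_commute)
  show ?case
    using b insert.hyps by (intro exI[of _ "b(k := y)"]) (auto simp: yy yj)
qed simp

text \<open>In coordinates \<open>u\<close> with \<open>x = B *v u\<close> the quadratic form of
  \<open>S\<close> is the squared Euclidean norm. \<open>C\<close> below is the inverse of
  \<open>B\<close>.\<close>

locale whitened =
  fixes S B :: "real^'p^'p"
  assumes pd: "pos_def S" and white: "transpose B ** S ** B = mat 1"
begin

lemma white': "B ** transpose B ** S = mat 1"
  using white matrix_left_right_inverse[of "transpose B ** S" B] by (simp add: matrix_mul_assoc)

lemma matrix_inv_S: "matrix_inv S = B ** transpose B"
proof -
  have "S ** (B ** transpose B) = mat 1" using white' matrix_left_right_inverse by blast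
  \<comment> \<open>\<open>matrix_inv\<close> is a choice among two-sided inverses, of which there
    is only one.\<close>
  then show ?thesis
    unfolding matrix_inv_def using white'
    by (intro some_equality) (auto simp: matrix_mul_assoc, metis matrix_mul_assoc matrix_mul_lid matrix_mul_rid)
qed

lemma det_white: "(det B)\<^sup>2 * det S = 1"
proof -
  have "det (transpose B ** S ** B) = 1" by (simp add: white)
  then show ?thesis by (simp add: det_mul power2_eq_square mult_ac)
qed

lemma det_B_nonzero: "det B \<noteq> 0"
  using det_white by auto

lemma sqrt_det_white: "\<bar>det B\<bar> * sqrt (det S) = 1"
proof -
  have "\<bar>det B\<bar> * sqrt (det S) = sqrt ((det B)\<^sup>2 * det S)" by (simp add: real_sqrt_mult)
  then show ?thesis by (simp add: det_white)
qed

lemma inner_B: "(B *v u) \<bullet> (S *v (B *v w)) = u \<bullet> w"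
proof -
  have "(B *v u) \<bullet> (S *v (B *v w)) = u \<bullet> ((transpose B ** S ** B) *v w)"
    using inner_matrix_transpose[of "S *v (B *v w)" B u]
    by (simp add: inner_commute flip: matrix_vector_mul_assoc)
  then show ?thesis by (simp add: white)
qed

definition C :: "real^'p^'p" where "C = transpose B ** S"

lemma C_B: "C *v (B *v u) = u"
  using white by (simp add: C_def matrix_vector_mul_assoc)

lemma B_C: "B *v (C *v x) = x"
  using white' by (simp add: C_def matrix_vector_mul_assoc matrix_mul_assoc)

lemma norm_C: "(norm (C *v x))\<^sup>2 = x \<bullet> (S *v x)"
  using inner_B[of "C *v x" "C *v x"] by (simp add: B_C power2_norm_eq_inner)

lemma S_inverse: "S *v (matrix_inv S *v x) = x"
proof -
  have "S ** (B ** transpose B) = mat 1" using white' matrix_left_right_inverse by blast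
  then show ?thesis by (simp add: matrix_inv_S matrix_vector_mul_assoc)
qed

lemma C_matrix_inv: "C *v (matrix_inv S *v x) = transpose B *v x"
  using S_inverse[of x] unfolding C_def by (simp flip: matrix_vector_mul_assoc)

end

lemma pos_def_whitening:
  assumes "pos_def (S::real^'p^'p)"
  shows "\<exists>B. whitened S B"
proof -
  obtain b where b: "\<And>i j. b i \<bullet> (S *v b j) = of_bool (i = (j::'p))"
    using pos_def_orthonormal_family[OF assms, of UNIV] by auto
  define B :: "real^'p^'p" where "B = (\<chi> i j. b j $ i)"
  have "(transpose B ** (S ** B)) $ i $ j = b i \<bullet> (S *v b j)" for i j
    by (simp add: B_def matrix_matrix_mult_def matrix_vector_mult_def transpose_def inner_vec_def)
  then have "transpose B ** S ** B = mat 1"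
    by (simp add: b vec_eq_iff mat_def flip: matrix_mul_assoc)
  with assms show ?thesis by (auto simp: whitened_def)
qed

section \<open>Gaussian integrals and densities on R^p\<close>

lemma nn_integral_gaussian_1:
  assumes "0 < c"
  shows "(\<integral>\<^sup>+x. ennreal (exp (- (c * x\<^sup>2))) \<partial>lborel) = ennreal (sqrt (pi / c))"
proof -
  let ?s = "1 / sqrt (2 * c)"
  have "ennreal (exp (- (c * x\<^sup>2))) = ennreal (sqrt (pi / c)) * ennreal (normal_density 0 ?s x)" for x
    using assms by (subst ennreal_mult[symmetric])
      (auto simp: normal_density_def power_divide real_sqrt_divide field_simps)
  then have "(\<integral>\<^sup>+x. ennreal (exp (- (c * x\<^sup>2))) \<partial>lborel) = ennreal (sqrt (pi / c)) * (\<integral>\<^sup>+x. ennreal (normal_density 0 ?s x) \<partial>lborel)"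
    by (simp add: nn_integral_cmult)
  also have "(\<integral>\<^sup>+x. ennreal (normal_density 0 ?s x) \<partial>lborel) = 1"
    using assms by (subst nn_integral_eq_integral) auto
  finally show ?thesis by simp
qed

lemma nn_integral_gaussian:
  assumes "0 < c"
  shows "(\<integral>\<^sup>+u. ennreal (exp (- (c * (u \<bullet> u)))) \<partial>(lborel :: (real^'p) measure)) = ennreal (sqrt (pi / c) ^ CARD('p))"
proof -
  have "ennreal (exp (- (c * (u \<bullet> u)))) = (\<Prod>b\<in>Basis. ennreal (exp (- (c * (u \<bullet> b)\<^sup>2))))" for u :: "real^'p"
    by (simp add: prod_ennreal exp_sum[symmetric] sum_negf sum_distrib_left[symmetric] euclidean_inner[of u u] power2_eq_square)
  then have "(\<integral>\<^sup>+u. ennreal (exp (- (c * (u \<bullet> u)))) \<partial>(lborel :: (real^'p) measure))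
      = (\<Prod>b\<in>(Basis :: (real^'p) set). \<integral>\<^sup>+x. ennreal (exp (- (c * x\<^sup>2))) \<partial>lborel)"
    by (simp only:) (rule nn_integral_lborel_prod, auto)
  also have "\<dots> = ennreal (sqrt (pi / c) ^ CARD('p))"
    using assms by (simp add: nn_integral_gaussian_1 ennreal_power DIM_cart)
  finally show ?thesis .
qed

definition gdens :: "real^'p \<Rightarrow> real" where
  "gdens u = exp (- (u \<bullet> u) / 2) / (2 * pi) powr (real CARD('p) / 2)"

lemma gdens_pos: "0 < gdens u" by (simp add: gdens_def)

lemma gdens_measurable [measurable]: "gdens \<in> borel_measurable borel"
  unfolding gdens_def by measurable

lemma two_pi_powr: "(2 * pi) powr (real CARD('p) / 2) = sqrt (2 * pi) ^ CARD('p)"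
proof -
  have "(2 * pi) powr (real CARD('p) / 2) = ((2 * pi) powr (1/2)) powr real CARD('p)"
    by (simp add: powr_powr)
  also have "\<dots> = sqrt (2 * pi) ^ CARD('p)"
    by (subst powr_realpow[symmetric]) (auto simp: powr_half_sqrt)
  finally show ?thesis .
qed

lemma nn_integral_gdens: "(\<integral>\<^sup>+u. ennreal (gdens u) \<partial>(lborel :: (real^'p) measure)) = 1"
proof -
  have "ennreal (gdens u) = ennreal (1 / sqrt (2 * pi) ^ CARD('p)) * ennreal (exp (- ((1/2) * (u \<bullet> u))))" for u :: "real^'p"
    by (simp add: gdens_def two_pi_powr ennreal_mult'[symmetric])
  then have "(\<integral>\<^sup>+u. ennreal (gdens u) \<partial>(lborel :: (real^'p) measure))
     = ennreal (1 / sqrt (2 * pi) ^ CARD('p)) * ennreal (sqrt (pi / (1/2)) ^ CARD('p))"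
    by (simp only:) (subst nn_integral_cmult, simp, subst nn_integral_gaussian, auto)
  also have "\<dots> = 1" by (subst ennreal_mult'[symmetric]) (auto simp: mult.commute)
  finally show ?thesis .
qed

text \<open>The estimate \<open>s \<le> exp s\<close> at \<open>s = (u \<bullet> u) / 4\<close>
  trades the quadratic factor for a wider Gaussian. Not sharp, but any constant depending only on
  the dimension will do.\<close>

lemma nn_integral_gdens_norm2:
  "(\<integral>\<^sup>+u. ennreal (gdens u * (norm u)\<^sup>2) \<partial>(lborel :: (real^'p) measure)) \<le> ennreal (4 * sqrt 2 ^ CARD('p))"
proof -
  have "gdens u * (norm u)\<^sup>2 \<le> 4 / sqrt (2 * pi) ^ CARD('p) * exp (- ((1/4) * (u \<bullet> u)))" for u :: "real^'p"
  proof -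
    have "(u \<bullet> u) / 4 \<le> exp ((u \<bullet> u) / 4)" using exp_ge_add_one_self[of "(u \<bullet> u)/4"] by linarith
    then have "exp (- (u \<bullet> u) / 2) * (u \<bullet> u) \<le> exp (- (u \<bullet> u) / 2) * (4 * exp ((u \<bullet> u) / 4))"
      by (intro mult_left_mono) auto
    also have "\<dots> = 4 * exp (- ((1/4) * (u \<bullet> u)))" by (simp add: mult_exp_exp)
    finally show ?thesis
      by (simp add: gdens_def two_pi_powr power2_norm_eq_inner divide_right_mono)
  qed
  then have "(\<integral>\<^sup>+u. ennreal (gdens u * (norm u)\<^sup>2) \<partial>(lborel :: (real^'p) measure))
     \<le> (\<integral>\<^sup>+u. ennreal (4 / sqrt (2 * pi) ^ CARD('p)) * ennreal (exp (- ((1/4) * (u \<bullet> u)))) \<partial>(lborel :: (real^'p) measure))"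
    by (intro nn_integral_mono) (simp add: ennreal_mult''[symmetric] del: minus_mult_left)
  also have "\<dots> = ennreal (4 / sqrt (2 * pi) ^ CARD('p)) * ennreal (sqrt (pi / (1/4)) ^ CARD('p))"
    by (subst nn_integral_cmult, simp, subst nn_integral_gaussian, auto)
  also have "\<dots> = ennreal (4 * sqrt 2 ^ CARD('p))"
  proof -
    have "sqrt (pi / (1/4)) = sqrt 2 * sqrt (2 * pi)" by (simp flip: real_sqrt_mult)
    then show ?thesis by (subst ennreal_mult'[symmetric]) (auto simp: power_mult_distrib)
  qed
  finally show ?thesis .
qed

definition mvn_dens :: "real^'p \<Rightarrow> real^'p^'p \<Rightarrow> real^'p \<Rightarrow> real" where
  "mvn_dens m S x = sqrt (det S) / (2 * pi) powr (real CARD('p) / 2) * exp (- ((x - m) \<bullet> (S *v (x - m))) / 2)"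

lemma mvn_prec_eq: "mvn_prec m S = density lborel (\<lambda>x. ennreal (mvn_dens m S x))"
  by (simp add: mvn_prec_def mvn_dens_def)

lemma measurable_mvn_dens [measurable]:
  assumes [measurable]: "f \<in> borel_measurable M" "g \<in> borel_measurable M"
  shows "(\<lambda>x. mvn_dens (f x) S (g x)) \<in> borel_measurable M"
  unfolding mvn_dens_def by measurable

lemma sets_mvn_prec [measurable_cong, simp]: "sets (mvn_prec m S) = sets borel"
  by (simp add: mvn_prec_def)

context whitened
begin

lemma det_S_pos: "0 < det S"
  using det_white by (metis zero_less_mult_pos zero_less_one zero_less_power2 det_B_nonzero)

lemma mvn_dens_white: "\<bar>det B\<bar> * mvn_dens m S (m + B *v u) = gdens u"
  using sqrt_det_white by (simp add: mvn_dens_def inner_B gdens_def field_simps)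

lemma nn_integral_mvn:
  assumes [measurable]: "f \<in> borel_measurable borel"
  shows "(\<integral>\<^sup>+x. f x \<partial>mvn_prec m S) = (\<integral>\<^sup>+u. ennreal (gdens u) * f (m + B *v u) \<partial>lborel)"
proof -
  have "(\<integral>\<^sup>+x. f x \<partial>mvn_prec m S) = (\<integral>\<^sup>+x. ennreal (mvn_dens m S x) * f x \<partial>lborel)"
    unfolding mvn_prec_eq by (subst nn_integral_density) auto
  also have "\<dots> = ennreal \<bar>det B\<bar> * (\<integral>\<^sup>+u. ennreal (mvn_dens m S (m + B *v u)) * f (m + B *v u) \<partial>lborel)"
    by (rule nn_integral_linear_substitution) (auto simp: det_B_nonzero)
  also have "\<dots> = (\<integral>\<^sup>+u. ennreal (gdens u) * f (m + B *v u) \<partial>lborel)"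
    by (subst nn_integral_cmult[symmetric])
       (auto simp: mvn_dens_white[of m, symmetric] ennreal_mult' mult.assoc)
  finally show ?thesis .
qed

lemma prob_space_mvn: "prob_space (mvn_prec m S)"
  by (rule prob_spaceI) (use nn_integral_mvn[of "\<lambda>_. 1" m] in \<open>simp add: nn_integral_gdens\<close>)

end

section \<open>Geometric ergodicity from drift and minorization\<close>

locale markov_kernel =
  fixes K :: "'a::topological_space \<Rightarrow> 'a measure"
  assumes K_measurable [measurable]: "K \<in> borel \<rightarrow>\<^sub>M subprob_algebra borel"
    and K_prob: "\<And>x. prob_space (K x)"
begin

lemma sets_K [simp, measurable_cong]: "sets (K x) = sets borel"
  by (rule subprob_measurableD(2)[OF K_measurable]) simp

lemma space_K [simp]: "space (K x) = UNIV"
  using sets_eq_imp_space_eq[OF sets_K] by simp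

lemma measure_K_UNIV [simp]: "measure (K x) UNIV = 1"
  using prob_space.prob_space[OF K_prob[of x]] by simp

definition step :: "('a \<Rightarrow> real) \<Rightarrow> 'a \<Rightarrow> real" where "step f x = (\<integral>y. f y \<partial>K x)"

text \<open>A class of test functions that contains the indicators, hence determines total
  variation, is closed under \<open>step\<close>, and is integrable for every finite
  measure.\<close>

definition unit_fun :: "('a \<Rightarrow> real) \<Rightarrow> bool" where
  "unit_fun f \<longleftrightarrow> f \<in> borel_measurable borel \<and> (\<forall>x. 0 \<le> f x \<and> f x \<le> 1)"

lemma unit_fun_integrable:
  assumes "unit_fun f" "finite_measure M" "sets M = sets borel"
  shows "integrable M f"
proof -
  interpret finite_measure M by fact
  have "f \<in> borel_measurable M" using assms by (simp add: unit_fun_def cong: measurable_cong_sets)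
  then show ?thesis using assms(1) by (intro integrable_const_bound[where B=1]) (auto simp: unit_fun_def)
qed

lemma unit_fun_step:
  assumes "unit_fun f"
  shows "unit_fun (step f)"
proof -
  have [measurable]: "f \<in> borel_measurable borel" using assms by (simp add: unit_fun_def)
  have "step f \<in> borel_measurable borel" unfolding step_def by measurable
  moreover have "0 \<le> step f x" for x
    using assms unfolding step_def by (intro integral_nonneg_AE) (auto simp: unit_fun_def)
  moreover have "step f x \<le> 1" for x
  proof -
    interpret prob_space "K x" by (rule K_prob)
    have "step f x \<le> (\<integral>y. 1 \<partial>K x)" unfolding step_def
      using assms by (intro integral_mono unit_fun_integrable) (auto simp: unit_fun_def finite_measure_axioms)
    then show ?thesis by simp
  qed
  ultimately show ?thesis by (simp add: unit_fun_def)
qed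

lemma integral_bind_K:
  assumes "unit_fun f" "prob_space M" "sets M = sets borel"
  shows "(\<integral>y. f y \<partial>(M \<bind> K)) = (\<integral>x. step f x \<partial>M)"
  unfolding step_def
proof (rule integral_bind[where B=1 and B'=1 and K=borel])
  show "f \<in> borel_measurable borel" "\<bar>f x\<bar> \<le> 1" for x using assms by (auto simp: unit_fun_def)
  show "K \<in> M \<rightarrow>\<^sub>M subprob_algebra borel" using assms by (simp cong: measurable_cong_sets)
  show "finite_measure M" using assms(2) by (rule prob_space.finite_measure)
  have "emeasure (K x) (space (K x)) = 1" for x by (rule prob_space.emeasure_space_1[OF K_prob])
  then show "AE x in M. emeasure (K x) (space (K x)) \<le> ennreal 1" by simp
qed

primrec iter :: "nat \<Rightarrow> 'a \<Rightarrow> 'a measure" where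
  "iter 0 x = return borel x"
| "iter (Suc m) x = iter m x \<bind> K"

lemma iter_prob: "prob_space (iter m x) \<and> sets (iter m x) = sets borel"
proof (induction m)
  case (Suc m)
  then interpret prob_space "iter m x" by simp
  have [measurable_cong]: "sets (iter m x) = sets borel" using Suc by simp
  have "prob_space (iter m x \<bind> K)"
    by (rule prob_space_bind[where S=borel]) (auto simp: K_prob)
  moreover have "sets (iter m x \<bind> K) = sets borel"
    by (rule sets_bind) (auto simp: not_empty)
  ultimately show ?case by simp
qed (simp add: prob_space_return)

text \<open>Duality between measures and functions: the last transition of the chain acts first on
  the test function, so the induction varies \<open>f\<close>.\<close>

lemma integral_iter: "unit_fun f \<Longrightarrow> (\<integral>y. f y \<partial>iter m x) = (step ^^ m) f x"
proof (induction m arbitrary: f)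
  case 0
  then show ?case by (simp add: integral_return unit_fun_def)
next
  case (Suc m)
  have "(\<integral>y. f y \<partial>iter (Suc m) x) = (\<integral>y. step f y \<partial>iter m x)"
    using iter_prob Suc.prems by (simp add: integral_bind_K)
  also have "\<dots> = (step ^^ m) (step f) x" by (rule Suc.IH[OF unit_fun_step[OF Suc.prems]])
  finally show ?case by (simp add: funpow_Suc_right del: funpow.simps)
qed

lemma unit_fun_funpow_step: "unit_fun f \<Longrightarrow> unit_fun ((step ^^ m) f)"
  by (induction m) (auto intro: unit_fun_step)

lemma integral_invariant:
  assumes "unit_fun f" "prob_space \<pi>" "sets \<pi> = sets borel" "\<pi> \<bind> K = \<pi>"
  shows "(\<integral>x. (step ^^ m) f x \<partial>\<pi>) = (\<integral>x. f x \<partial>\<pi>)"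
proof (induction m)
  case (Suc m)
  have "(\<integral>x. (step ^^ Suc m) f x \<partial>\<pi>) = (\<integral>x. (step ^^ m) f x \<partial>(\<pi> \<bind> K))"
    by (subst integral_bind_K[OF unit_fun_funpow_step[OF assms(1)] assms(2,3)]) simp
  then show ?case using Suc assms(4) by simp
qed simp

end

text \<open>The first two entries come from pairs of states for which minorization is available,
  \<open>1 - \<alpha> / 2\<close> for the constant part and \<gamma> for the \<open>V\<close> part
  of the metric. The third is the contraction of distant pairs at the threshold, where the weighted
  sum of the two values of \<open>V\<close> is \<open>2 * \<alpha> / (1 - \<gamma>)\<close>.\<close>

definition harris_rate :: "real \<Rightarrow> real \<Rightarrow> real" where
  "harris_rate \<alpha> \<gamma> = max (max (1 - \<alpha> / 2) \<gamma>)
     ((2 + (1 + \<gamma>) / 2 * (2 * \<alpha> / (1 - \<gamma>))) / (2 + 2 * \<alpha> / (1 - \<gamma>)))"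

lemma harris_rate:
  assumes "0 < \<alpha>" "0 \<le> \<gamma>" "\<gamma> < 1"
  shows "0 \<le> harris_rate \<alpha> \<gamma>" "harris_rate \<alpha> \<gamma> < 1"
proof -
  show "0 \<le> harris_rate \<alpha> \<gamma>" using assms by (simp add: harris_rate_def le_max_iff_disj)
  define r where "r = 2 * \<alpha> / (1 - \<gamma>)"
  have r: "0 < r" using assms by (simp add: r_def)
  then have "2 + (1 + \<gamma>) / 2 * r < 2 + r" using assms by simp
  with r have "(2 + (1 + \<gamma>) / 2 * r) / (2 + r) < 1" by simp
  then show "harris_rate \<alpha> \<gamma> < 1" using assms by (simp add: harris_rate_def r_def)
qed

text \<open>The measure \<nu> is not normalised: its mass carries the minorization constant. The
  level \<open>4 * L / (1 - \<gamma>)\<close> is chosen for sums \<open>V x + V y\<close>: above it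
  the term \<open>2 * L\<close> costs at most \<open>(1 - \<gamma>) / 2\<close> times the sum, below
  it both states lie in the small set.\<close>

locale harris_chain = markov_kernel +
  fixes V :: "'a \<Rightarrow> real" and \<gamma> L \<alpha> :: real and \<nu> :: "'a measure"
  assumes V_measurable [measurable]: "V \<in> borel_measurable borel"
    and V_nonneg: "\<And>x. 0 \<le> V x"
    and \<gamma>: "0 \<le> \<gamma>" "\<gamma> < 1" and L: "0 < L" and \<alpha>: "0 < \<alpha>" "\<alpha> \<le> 1"
    and drift: "\<And>x. (\<integral>\<^sup>+y. ennreal (V y) \<partial>K x) \<le> ennreal (\<gamma> * V x + L)"
    and sets_\<nu> [simp, measurable_cong]: "sets \<nu> = sets borel"
    and \<nu>_mass: "ennreal \<alpha> \<le> emeasure \<nu> UNIV"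
    and minorization: "\<And>x f. V x \<le> 4 * L / (1 - \<gamma>) \<Longrightarrow> f \<in> borel_measurable borel \<Longrightarrow>
      (\<integral>\<^sup>+y. f y \<partial>\<nu>) \<le> (\<integral>\<^sup>+y. f y \<partial>K x)"
begin

text \<open>With this weight, the constant of the drift costs half of the mass gained from the minorization
  (see \<open>osc_le_step\<close>).\<close>
definition wt :: real where "wt = \<alpha> / (2 * L)"

definition rate :: real where "rate = harris_rate \<alpha> \<gamma>"

lemma wt_pos: "0 < wt" using \<alpha> L by (simp add: wt_def)

lemma space_\<nu> [simp]: "space \<nu> = UNIV"
  using sets_eq_imp_space_eq[OF sets_\<nu>] by simp

lemma V_integrable: "integrable (K x) V" and V_drift: "(\<integral>y. V y \<partial>K x) \<le> \<gamma> * V x + L"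
proof -
  have n: "0 \<le> \<gamma> * V x + L" using \<gamma> L V_nonneg[of x] by simp
  show i: "integrable (K x) V"
    using drift[of x] V_nonneg by (intro integrableI_bounded) (auto simp: le_less_trans)
  show "(\<integral>y. V y \<partial>K x) \<le> \<gamma> * V x + L"
    using drift[of x] i V_nonneg n by (subst (asm) nn_integral_eq_integral) auto
qed

text \<open>\<open>f\<close> is \<open>c\<close>-Lipschitz for the Hairer--Mattingly metric, which is \<open>2 + wt * V x + wt * V y\<close> off the diagonal.\<close>
definition osc_le :: "real \<Rightarrow> ('a \<Rightarrow> real) \<Rightarrow> bool" where
  "osc_le c f \<longleftrightarrow> (\<forall>x y. \<bar>f x - f y\<bar> \<le> c * (2 + wt * V x + wt * V y))"

text \<open>The intervals around \<open>f x\<close> with radius \<open>c * (1 + wt * V x)\<close>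
  meet pairwise, hence have a common point, the supremum of their left ends. This turns the
  Lipschitz condition into a weighted sup norm bound modulo constants.\<close>

lemma osc_le_centre:
  assumes "unit_fun f" "osc_le c f" "0 \<le> c"
  obtains a where "\<And>x. \<bar>f x - a\<bar> \<le> c * (1 + wt * V x)"
proof -
  define a where "a = (SUP x. f x - c * (1 + wt * V x))"
  have *: "f x - c * (1 + wt * V x) \<le> f y + c * (1 + wt * V y)" for x y
    using assms(2)[unfolded osc_le_def, rule_format, of x y] by (simp add: algebra_simps)
  have "bdd_above (range (\<lambda>x. f x - c * (1 + wt * V x)))"
    using * by (intro bdd_aboveI) auto
  then have "f x - c * (1 + wt * V x) \<le> a" for x
    unfolding a_def by (intro cSUP_upper) auto
  moreover have "a \<le> f y + c * (1 + wt * V y)" for y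
    unfolding a_def using * by (intro cSUP_least) auto
  ultimately have "\<bar>f x - a\<bar> \<le> c * (1 + wt * V x)" for x
    by (simp add: abs_le_iff algebra_simps)
  then show thesis by (rule that)
qed

lemma minorization_integral:
  fixes f :: "'a \<Rightarrow> real"
  assumes "V x \<le> 4 * L / (1 - \<gamma>)" "integrable (K x) f" "\<And>y. 0 \<le> f y"
  shows "integrable \<nu> f" "(\<integral>y. f y \<partial>\<nu>) \<le> (\<integral>y. f y \<partial>K x)"
proof -
  have m: "f \<in> borel_measurable borel" using assms(2) by (auto dest: borel_measurable_integrable)
  then have le: "(\<integral>\<^sup>+y. ennreal (f y) \<partial>\<nu>) \<le> (\<integral>\<^sup>+y. ennreal (f y) \<partial>K x)"
    by (intro minorization assms) auto
  also have e: "(\<integral>\<^sup>+y. ennreal (f y) \<partial>K x) = ennreal (\<integral>y. f y \<partial>K x)"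
    using assms by (intro nn_integral_eq_integral) auto
  finally have le': "(\<integral>\<^sup>+y. ennreal (f y) \<partial>\<nu>) \<le> ennreal (\<integral>y. f y \<partial>K x)" .
  then show i: "integrable \<nu> f"
    using assms(3) m by (intro integrableI_bounded) (auto simp: le_less_trans cong: measurable_cong_sets)
  show "(\<integral>y. f y \<partial>\<nu>) \<le> (\<integral>y. f y \<partial>K x)"
    using le' assms(3) i by (subst (asm) nn_integral_eq_integral) (auto intro!: integral_nonneg_AE)
qed

text \<open>One step contracts the Lipschitz constant. Distant pairs contract through the drift
  alone. For near pairs \<nu> is subtracted from both kernels: the integral of \<open>g\<close>
  against \<nu> cancels in the difference, while that of the dominating \<open>W\<close> is saved
  twice.\<close>

lemma osc_le_step:
  assumes f: "unit_fun f" and osc: "osc_le c f" and c: "0 \<le> c"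
  shows "osc_le (rate * c) (step f)"
  unfolding osc_le_def
proof (intro allI)
  fix x y
  obtain a where a: "\<And>x. \<bar>f x - a\<bar> \<le> c * (1 + wt * V x)"
    using osc_le_centre[OF f osc c] by blast
  define W where "W z = c * (1 + wt * V z)" for z
  define g where "g z = f z - a" for z
  define S where "S = V x + V y"
  have S0: "0 \<le> S" using V_nonneg by (simp add: S_def)
  have [measurable]: "f \<in> borel_measurable borel" using f by (simp add: unit_fun_def)
  have Wi: "integrable (K z) W" and gi: "integrable (K z) g"
    and Wd: "(\<integral>u. W u \<partial>K z) \<le> c * (1 + wt * (\<gamma> * V z + L))"
    and g: "step f z = a + (\<integral>u. g u \<partial>K z)" for z
  proof -
    interpret prob_space "K z" by (rule K_prob)
    show "integrable (K z) W" unfolding W_def using V_integrable by simp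
    have fi: "integrable (K z) f" by (rule unit_fun_integrable[OF f]) (auto intro: finite_measure_axioms)
    then show "integrable (K z) g" unfolding g_def by simp
    have "(\<integral>u. W u \<partial>K z) = c * (1 + wt * (\<integral>u. V u \<partial>K z))"
      unfolding W_def using V_integrable[of z] by simp
    also have "\<dots> \<le> c * (1 + wt * (\<gamma> * V z + L))"
      using c wt_pos V_drift[of z] by (intro mult_left_mono add_left_mono) auto
    finally show "(\<integral>u. W u \<partial>K z) \<le> c * (1 + wt * (\<gamma> * V z + L))" .
    show "step f z = a + (\<integral>u. g u \<partial>K z)" unfolding g_def step_def using fi by simp
  qed
  have wL: "wt * L = \<alpha> / 2" using L by (simp add: wt_def)
  have gW: "\<bar>g z\<bar> \<le> W z" for z using a by (simp add: g_def W_def)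
  have goal_eq: "rate * c * (2 + wt * V x + wt * V y) = c * (rate * (2 + wt * S))"
    by (simp add: S_def algebra_simps)
  show "\<bar>step f x - step f y\<bar> \<le> rate * c * (2 + wt * V x + wt * V y)"
  proof (cases "4 * L / (1 - \<gamma>) \<le> S")
    case True
    have abs: "\<bar>\<integral>u. g u \<partial>K z\<bar> \<le> (\<integral>u. W u \<partial>K z)" for z
    proof -
      have "\<bar>\<integral>u. g u \<partial>K z\<bar> \<le> (\<integral>u. \<bar>g u\<bar> \<partial>K z)" by (rule integral_abs_bound)
      also have "\<dots> \<le> (\<integral>u. W u \<partial>K z)" using gW gi Wi by (intro integral_mono) auto
      finally show ?thesis .
    qed
    have "\<bar>step f x - step f y\<bar> \<le> (\<integral>u. W u \<partial>K x) + (\<integral>u. W u \<partial>K y)"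
      using abs[of x] abs[of y] by (simp add: g)
    also have "\<dots> \<le> c * (2 + wt * \<gamma> * S + 2 * (wt * L))"
      using Wd[of x] Wd[of y] by (simp add: S_def algebra_simps)
    also have "\<dots> \<le> c * (rate * (2 + wt * S))"
    proof (rule mult_left_mono[OF _ c])
      \<comment> \<open>The value of \<open>wt * S\<close> at the threshold of the case
        distinction.\<close>
      define r where "r = 2 * \<alpha> / (1 - \<gamma>)"
      have r: "0 < r" using \<alpha> \<gamma> by (simp add: r_def)
      define t where "t = wt * S"
      have "wt * (4 * L / (1 - \<gamma>)) \<le> t" unfolding t_def using True wt_pos by (intro mult_left_mono) auto
      moreover have "wt * (4 * L / (1 - \<gamma>)) = r" using L by (simp add: wt_def r_def field_simps)
      ultimately have t: "r \<le> t" by simp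
      have "(1 - \<gamma>) * r \<le> (1 - \<gamma>) * t" using \<gamma> t by (intro mult_left_mono) auto
      then have at: "2 * \<alpha> \<le> (1 - \<gamma>) * t" using \<gamma> by (simp add: r_def)
      \<comment> \<open>The quotient of \<open>2 + (1 + \<gamma>) / 2 * t\<close> by
        \<open>2 + t\<close> decreases in \<open>t\<close>, so its value at the threshold
        \<open>r\<close> is the worst case.\<close>
      define g1 where "g1 = (2 + (1 + \<gamma>) / 2 * r) / (2 + r)"
      have "wt * \<gamma> * S + 2 * (wt * L) + 2 \<le> 2 + (1 + \<gamma>) / 2 * t"
        unfolding wL using at \<open>t = wt * S\<close> by (simp add: field_simps)
      also have "\<dots> \<le> g1 * (2 + t)"
      proof -
        have "(2 + (1 + \<gamma>) / 2 * t) * (2 + r) \<le> (2 + (1 + \<gamma>) / 2 * r) * (2 + t)"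
        proof -
          have "(2 + (1 + \<gamma>) / 2 * r) * (2 + t) - (2 + (1 + \<gamma>) / 2 * t) * (2 + r) = (1 - \<gamma>) * (t - r)"
            by (simp add: field_simps)
          moreover have "0 \<le> (1 - \<gamma>) * (t - r)" using t \<gamma> by simp
          ultimately show ?thesis by (metis diff_ge_0_iff_ge)
        qed
        then show ?thesis using r by (simp add: g1_def pos_le_divide_eq)
      qed
      also have "\<dots> \<le> rate * (2 + t)"
        using t r by (intro mult_right_mono) (auto simp: rate_def harris_rate_def g1_def r_def)
      finally show "2 + wt * \<gamma> * S + 2 * (wt * L) \<le> rate * (2 + wt * S)" by (simp add: t_def)
    qed
    finally show ?thesis by (simp add: goal_eq)
  next
    case False
    then have small: "V x \<le> 4 * L / (1 - \<gamma>)" "V y \<le> 4 * L / (1 - \<gamma>)"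
      using V_nonneg[of x] V_nonneg[of y] by (auto simp: S_def)
    have W\<nu>: "integrable \<nu> W" and g\<nu>: "integrable \<nu> g" and W\<alpha>: "c * \<alpha> \<le> (\<integral>u. W u \<partial>\<nu>)"
    proof -
      have W0: "0 \<le> W u" for u using gW[of u] by linarith
      show Wn: "integrable \<nu> W" by (rule minorization_integral(1)[OF small(1) Wi W0])
      have p: "integrable \<nu> (\<lambda>u. W u + g u)"
      proof (rule minorization_integral(1)[OF small(1)])
        show "0 \<le> W u + g u" for u using gW[of u] by linarith
      qed (use Wi gi in simp)
      from Bochner_Integration.integrable_diff[OF p Wn] show "integrable \<nu> g" by simp
      \<comment> \<open>As soon as one state lies in the small set, \<nu> is dominated by a
        probability measure.\<close>
      have fin: "emeasure \<nu> UNIV \<le> 1"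
        using minorization[OF small(1), of "\<lambda>_. 1"] prob_space.emeasure_space_1[OF K_prob[of x]] by simp
      then interpret finite_measure \<nu> by (intro finite_measureI) (auto simp: top_unique)
      have "\<alpha> \<le> measure \<nu> UNIV" using \<nu>_mass \<alpha> by (simp add: emeasure_eq_measure)
      then have "c * \<alpha> \<le> c * measure \<nu> UNIV" by (rule mult_left_mono[OF _ c])
      also have "\<dots> = (\<integral>u. c \<partial>\<nu>)" by simp
      also have "\<dots> \<le> (\<integral>u. W u \<partial>\<nu>)"
      proof (rule integral_mono)
        show "c \<le> W u" for u using c wt_pos V_nonneg[of u] by (simp add: W_def algebra_simps)
      qed (use Wn in simp_all)
      finally show "c * \<alpha> \<le> (\<integral>u. W u \<partial>\<nu>)" .
    qed
    \<comment> \<open>\<open>W + g\<close> and \<open>W - g\<close> are nonnegative, so minorization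
      applies to each; together they bound the change in \<open>g\<close> by the change in
      \<open>W\<close>.\<close>
    have diff: "\<bar>(\<integral>u. g u \<partial>K z) - (\<integral>u. g u \<partial>\<nu>)\<bar> \<le> (\<integral>u. W u \<partial>K z) - c * \<alpha>"
      if z: "V z \<le> 4 * L / (1 - \<gamma>)" for z
    proof -
      have "(\<integral>u. W u + g u \<partial>\<nu>) \<le> (\<integral>u. W u + g u \<partial>K z)"
      proof (rule minorization_integral(2)[OF z])
        show "0 \<le> W u + g u" for u using gW[of u] by linarith
      qed (use Wi gi in simp)
      moreover have "(\<integral>u. W u - g u \<partial>\<nu>) \<le> (\<integral>u. W u - g u \<partial>K z)"
      proof (rule minorization_integral(2)[OF z])
        show "0 \<le> W u - g u" for u using gW[of u] by linarith
      qed (use Wi gi in simp)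
      ultimately show ?thesis using W\<nu> g\<nu> Wi[of z] gi[of z] W\<alpha> by (simp add: abs_le_iff)
    qed
    have "\<bar>step f x - step f y\<bar> \<le> (\<integral>u. W u \<partial>K x) + (\<integral>u. W u \<partial>K y) - 2 * (c * \<alpha>)"
      using diff[OF small(1)] diff[OF small(2)] by (simp add: g)
    also have "\<dots> \<le> c * (2 + wt * \<gamma> * S + 2 * (wt * L) - 2 * \<alpha>)"
      using Wd[of x] Wd[of y] by (simp add: S_def algebra_simps)
    also have "\<dots> \<le> c * (rate * (2 + wt * S))"
    proof (rule mult_left_mono[OF _ c])
      \<comment> \<open>Since \<open>2 * (wt * L)\<close> equals \<alpha>, the constant part is
        \<open>2 + \<alpha> - 2 * \<alpha>\<close>, which is
        \<open>(1 - \<alpha> / 2) * 2\<close>.\<close>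
      have "(1 - \<alpha> / 2) * 2 \<le> rate * 2" "\<gamma> * (wt * S) \<le> rate * (wt * S)"
        using S0 wt_pos by (intro mult_right_mono; simp add: rate_def harris_rate_def)+
      then show "2 + wt * \<gamma> * S + 2 * (wt * L) - 2 * \<alpha> \<le> rate * (2 + wt * S)"
        unfolding wL by (simp add: algebra_simps)
    qed
    finally show ?thesis by (simp add: goal_eq)
  qed
qed

lemma rate: "0 \<le> rate" "rate < 1"
  using harris_rate \<alpha> \<gamma> by (auto simp: rate_def)

lemma osc_le_funpow:
  assumes "unit_fun f" "osc_le c f" "0 \<le> c"
  shows "osc_le (rate ^ m * c) ((step ^^ m) f)"
proof (induction m)
  case (Suc m)
  then show ?case
    using osc_le_step[OF unit_fun_funpow_step[OF assms(1)] Suc] rate(1) assms(3) by (simp add: mult.assoc)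
qed (use assms in simp)

text \<open>Indicators are 1-Lipschitz for the metric. By invariance the deviation at
  \<open>x\<close> is an average over \<pi> of differences of the iterated indicator, and each of
  these has contracted by \<open>rate ^ m\<close>.\<close>

lemma geometric_convergence:
  assumes \<pi>: "prob_space \<pi>" "sets \<pi> = sets borel" "\<pi> \<bind> K = \<pi>" and V\<pi>: "integrable \<pi> V"
  shows "tv_dist (iter m x) \<pi> \<le> (2 + wt * V x + wt * (\<integral>y. V y \<partial>\<pi>)) * rate ^ m"
  unfolding tv_dist_def
proof (rule cSUP_least)
  fix A :: "'a set" assume A: "A \<in> sets borel"
  interpret P: prob_space \<pi> by fact
  interpret I: prob_space "iter m x" using iter_prob by simp
  let ?f = "indicator A :: 'a \<Rightarrow> real"
  have f: "unit_fun ?f" using A by (auto simp: unit_fun_def split: split_indicator)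
  have "osc_le 1 ?f"
    using V_nonneg wt_pos by (auto simp: osc_le_def indicator_def add_nonneg_nonneg)
  then have osc: "osc_le (rate ^ m) ((step ^^ m) ?f)" using osc_le_funpow[OF f, of 1 m] by simp
  have i: "integrable \<pi> ((step ^^ m) ?f)"
    by (rule unit_fun_integrable[OF unit_fun_funpow_step[OF f]]) (auto simp: \<pi> P.finite_measure_axioms)
  have "measure (iter m x) A = (step ^^ m) ?f x"
    using integral_iter[OF f, of m x] A iter_prob[of m x] I.finite_measure_axioms by simp
  moreover have "measure \<pi> A = (\<integral>y. (step ^^ m) ?f y \<partial>\<pi>)"
    using integral_invariant[OF f \<pi>, of m] A \<pi>(2) by simp
  ultimately have "\<bar>measure (iter m x) A - measure \<pi> A\<bar> = \<bar>\<integral>y. (step ^^ m) ?f x - (step ^^ m) ?f y \<partial>\<pi>\<bar>"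
    using i by (simp add: P.prob_space)
  also have "\<dots> \<le> (\<integral>y. \<bar>(step ^^ m) ?f x - (step ^^ m) ?f y\<bar> \<partial>\<pi>)" by (rule integral_abs_bound)
  also have "\<dots> \<le> (\<integral>y. rate ^ m * (2 + wt * V x + wt * V y) \<partial>\<pi>)"
    using i V\<pi> osc by (intro integral_mono) (auto simp: osc_le_def)
  also have "\<dots> = (2 + wt * V x + wt * (\<integral>y. V y \<partial>\<pi>)) * rate ^ m"
    using V\<pi> by (simp add: P.prob_space algebra_simps)
  finally show "\<bar>measure (iter m x) A - measure \<pi> A\<bar> \<le> (2 + wt * V x + wt * (\<integral>y. V y \<partial>\<pi>)) * rate ^ m" .
qed auto

lemma geo_rate_le:
  assumes "prob_space \<pi>" "sets \<pi> = sets borel" "\<pi> \<bind> K = \<pi>" "integrable \<pi> V"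
  shows "geo_rate iter \<pi> \<le> harris_rate \<alpha> \<gamma>"
  unfolding geo_rate_def
proof (rule cInf_lower)
  have "0 \<le> (\<integral>y. V y \<partial>\<pi>)" using V_nonneg by (intro integral_nonneg_AE) auto
  then have "0 \<le> 2 + wt * V x + wt * (\<integral>y. V y \<partial>\<pi>)" for x
    using wt_pos V_nonneg[of x] by (simp add: add_nonneg_nonneg)
  with geometric_convergence[OF assms] rate
  show "harris_rate \<alpha> \<gamma> \<in> {\<rho>. 0 \<le> \<rho> \<and> \<rho> \<le> 1 \<and>
      (\<exists>M::'a \<Rightarrow> real. \<forall>x. 0 \<le> M x \<and> (\<forall>m. tv_dist (iter m x) \<pi> \<le> M x * \<rho> ^ m))}"
    unfolding rate_def by (auto intro!: exI[of _ "\<lambda>x. 2 + wt * V x + wt * (\<integral>y. V y \<partial>\<pi>)"])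
qed (auto intro: bdd_belowI[of _ 0])

end

section \<open>The Albert--Chib chain\<close>

lemma Phi_measurable [measurable]: "Phi \<in> borel_measurable borel"
proof -
  have "isCont Phi x" for x
    using DERIV_Phi[OF DERIV_ident, of x UNIV] by (auto intro: DERIV_isCont)
  then show ?thesis by (intro borel_measurable_continuous_onI continuous_at_imp_continuous_on) auto
qed

definition tn_dens :: "real \<Rightarrow> bool \<Rightarrow> real \<Rightarrow> real" where
  "tn_dens \<theta> y z = (if y then indicator {0<..} z * normal_density \<theta> 1 z / Phi \<theta>
     else indicator {..<0} z * normal_density \<theta> 1 z / (1 - Phi \<theta>))"

lemma tn_measure_eq: "tn_measure \<theta> y = density lborel (\<lambda>z. ennreal (tn_dens \<theta> y z))"
  unfolding tn_measure_def tn_dens_def by (auto intro!: arg_cong2[where f=density])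

lemma tn_dens_nonneg: "0 \<le> tn_dens \<theta> y z"
  using Phi_pos[of \<theta>] Phi_less_1[of \<theta>] by (auto simp: tn_dens_def)

lemma measurable_tn_dens [measurable]:
  assumes [measurable]: "f \<in> borel_measurable M" "g \<in> borel_measurable M"
  shows "(\<lambda>x. tn_dens (f x) y (g x)) \<in> borel_measurable M"
  unfolding tn_dens_def normal_density_def by (cases y) (simp; measurable)+

lemma Sigma_mat_mult:
  fixes Q :: "real^'p^'p"
  shows "Sigma_mat xs n Q *v b = (\<Sum>i<n. (xs i \<bullet> b) *\<^sub>R xs i) + Q *v b"
proof -
  have "(\<chi> j k. x $ j * x $ k) *v b = (x \<bullet> b) *\<^sub>R x" for x :: "real^'p"
    by (simp add: vec_eq_iff matrix_vector_mult_def inner_vec_def sum_distrib_left mult_ac)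
  moreover have "(\<Sum>i<n. A i) *v b = (\<Sum>i<n. A i *v b)" for A :: "nat \<Rightarrow> real^'p^'p"
    by (induction n) (simp_all add: matrix_vector_mult_add_rdistrib)
  ultimately show ?thesis by (simp add: Sigma_mat_def matrix_vector_mult_add_rdistrib)
qed

lemma inner_Sigma_mat: "a \<bullet> (Sigma_mat xs n Q *v b) = (\<Sum>i<n. (xs i \<bullet> a) * (xs i \<bullet> b)) + a \<bullet> (Q *v b)"
  by (simp add: Sigma_mat_mult inner_add_right inner_sum_right inner_commute[of a] mult.commute)

text \<open>The hypotheses \<open>contraction\<close> and \<open>tail\<close> are what the data have to satisfy: the first bounds the
  derivative of the mean map of the chain, the second makes the posterior proper.\<close>
locale albert_chib = whitened "Sigma_mat xs n Q" B
  for xs :: "nat \<Rightarrow> real^'p" and n :: nat and Q B :: "real^'p^'p" +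
  fixes ys :: "nat \<Rightarrow> bool" and v :: "real^'p" and \<kappa> c\<^sub>0 :: real
  assumes Q_sym: "\<And>i j. Q $ i $ j = Q $ j $ i" and Q_psd: "\<And>a. 0 \<le> a \<bullet> (Q *v a)"
    and \<kappa>: "0 < \<kappa>" "\<kappa> < 1"
    and contraction: "\<And>\<beta> a. (\<Sum>i<n. tn_var (ysign (ys i) * (xs i \<bullet> \<beta>)) * (xs i \<bullet> a)\<^sup>2) \<le> \<kappa> * (a \<bullet> (Sigma_mat xs n Q *v a))"
    and c0: "0 < c\<^sub>0"
    and tail: "\<And>\<beta>. likelihood xs ys n \<beta> * prior_dens v Q \<beta> \<le> exp (- (c\<^sub>0 * (\<beta> \<bullet> \<beta>)))"
begin

section \<open>The latent draw, the kernel and their densities\<close>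

abbreviation S :: "real^'p^'p" where "S \<equiv> Sigma_mat xs n Q"

abbreviation \<theta> :: "nat \<Rightarrow> real^'p \<Rightarrow> real" where "\<theta> i \<beta> \<equiv> ysign (ys i) * (xs i \<bullet> \<beta>)"

definition latent :: "real^'p \<Rightarrow> (nat \<Rightarrow> real) measure" where
  "latent \<beta> = PiM {..<n} (\<lambda>i. tn_measure (xs i \<bullet> \<beta>) (ys i))"

definition post_mean :: "(nat \<Rightarrow> real) \<Rightarrow> real^'p" where
  "post_mean z = matrix_inv S *v ((\<Sum>i<n. z i *\<^sub>R xs i) + Q *v v)"

abbreviation zsp :: "(nat \<Rightarrow> real) measure" where "zsp \<equiv> PiM {..<n} (\<lambda>_. lborel)"

abbreviation leb :: "(real^'p) measure" where "leb \<equiv> lborel"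

abbreviation K :: "real^'p \<Rightarrow> (real^'p) measure" where "K \<equiv> ac_kernel xs ys n v Q"

lemma K_eq: "K \<beta> = latent \<beta> \<bind> (\<lambda>z. mvn_prec (post_mean z) S)"
  by (simp add: ac_kernel_def latent_def post_mean_def)

lemma S_post_mean: "S *v post_mean z = (\<Sum>i<n. z i *\<^sub>R xs i) + Q *v v"
  unfolding post_mean_def by (rule S_inverse)

lemma sets_latent [measurable_cong, simp]: "sets (latent \<beta>) = sets zsp"
  unfolding latent_def by (rule sets_PiM_cong) auto

lemma post_mean_measurable [measurable]: "post_mean \<in> borel_measurable zsp"
  unfolding post_mean_def by measurable

interpretation lebs: product_sigma_finite "\<lambda>i::nat. lborel :: real measure" ..

interpretation leb_n: sigma_finite_measure zsp
  by (rule lebs.sigma_finite) simp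

interpretation leb_pair: pair_sigma_finite zsp leb ..

definition latent_dens :: "real^'p \<Rightarrow> (nat \<Rightarrow> real) \<Rightarrow> real" where
  "latent_dens \<beta> z = (\<Prod>i<n. tn_dens (xs i \<bullet> \<beta>) (ys i) (z i))"

lemma latent_dens_measurable [measurable]:
  "(\<lambda>(\<beta>, z). latent_dens \<beta> z) \<in> borel_measurable (borel \<Otimes>\<^sub>M zsp)"
  unfolding latent_dens_def split_beta by measurable

lemma latent_dens_measurable1 [measurable]:
  "latent_dens \<beta> \<in> borel_measurable zsp"
  unfolding latent_dens_def[abs_def] by measurable

lemma latent_eq: "latent \<beta> = density zsp (\<lambda>z. ennreal (latent_dens \<beta> z))"
proof -
  interpret T: product_sigma_finite "\<lambda>i. tn_measure (xs i \<bullet> \<beta>) (ys i)"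
    by (simp add: product_sigma_finite_def prob_space_tn prob_space_imp_sigma_finite)
  have "density zsp (\<lambda>z. ennreal (latent_dens \<beta> z)) = latent \<beta>"
    unfolding latent_def
  proof (rule T.PiM_eqI)
    fix A assume A: "\<And>i. i \<in> {..<n} \<Longrightarrow> A i \<in> sets (tn_measure (xs i \<bullet> \<beta>) (ys i))"
    then have A': "\<And>i. i < n \<Longrightarrow> A i \<in> sets borel" by simp
    let ?P = zsp
    have "emeasure (density ?P (\<lambda>z. ennreal (latent_dens \<beta> z))) (Pi\<^sub>E {..<n} A)
       = (\<integral>\<^sup>+z. ennreal (latent_dens \<beta> z) * indicator (Pi\<^sub>E {..<n} A) z \<partial>?P)"
      by (rule emeasure_density) (auto intro!: sets_PiM_I_finite A')
    also have "\<dots> = (\<integral>\<^sup>+z. (\<Prod>i<n. ennreal (tn_dens (xs i \<bullet> \<beta>) (ys i) (z i)) * indicator (A i) (z i)) \<partial>?P)"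
    proof (rule nn_integral_cong)
      fix z assume "z \<in> space ?P"
      then have ext: "z \<in> extensional {..<n}" by (simp add: space_PiM PiE_def)
      have "indicator (Pi\<^sub>E {..<n} A) z = (\<Prod>i<n. indicator (A i) (z i) :: ennreal)"
        using ext by (auto simp: indicator_def PiE_iff prod_eq_1_iff)
      then show "ennreal (latent_dens \<beta> z) * indicator (Pi\<^sub>E {..<n} A) z
          = (\<Prod>i<n. ennreal (tn_dens (xs i \<bullet> \<beta>) (ys i) (z i)) * indicator (A i) (z i))"
        by (simp add: latent_dens_def prod.distrib prod_ennreal tn_dens_nonneg)
    qed
    also have "\<dots> = (\<Prod>i<n. \<integral>\<^sup>+z. ennreal (tn_dens (xs i \<bullet> \<beta>) (ys i) z) * indicator (A i) z \<partial>lborel)"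
      by (rule lebs.product_nn_integral_prod) (auto intro!: borel_measurable_times_ennreal borel_measurable_indicator A')
    also have "\<dots> = (\<Prod>i<n. emeasure (tn_measure (xs i \<bullet> \<beta>) (ys i)) (A i))"
      unfolding tn_measure_eq by (intro prod.cong refl emeasure_density[symmetric]) (auto simp: A')
    finally show "emeasure (density ?P (\<lambda>z. ennreal (latent_dens \<beta> z))) (Pi\<^sub>E {..<n} A)
        = (\<Prod>i<n. emeasure (tn_measure (xs i \<bullet> \<beta>) (ys i)) (A i))" .
  qed (auto intro!: sets_PiM_cong)
  then show ?thesis ..
qed

lemma prob_space_latent: "prob_space (latent \<beta>)"
  unfolding latent_def by (rule prob_space_PiM) (rule prob_space_tn)

lemma nn_integral_latent:
  "f \<in> borel_measurable zsp \<Longrightarrow>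
   (\<integral>\<^sup>+z. f z \<partial>latent \<beta>) = (\<integral>\<^sup>+z. ennreal (latent_dens \<beta> z) * f z \<partial>zsp)"
  unfolding latent_eq by (rule nn_integral_density) auto

lemma nn_integral_mvn_dens:
  "f \<in> borel_measurable borel \<Longrightarrow> (\<integral>\<^sup>+x. f x \<partial>mvn_prec m S) = (\<integral>\<^sup>+x. ennreal (mvn_dens m S x) * f x \<partial>lborel)"
  unfolding mvn_prec_eq by (rule nn_integral_density) auto

lemma mvn_kernel_measurable [measurable]:
  "(\<lambda>z. mvn_prec (post_mean z) S) \<in> zsp \<rightarrow>\<^sub>M subprob_algebra borel"
proof (rule measurable_subprob_algebra)
  show "subprob_space (mvn_prec (post_mean z) S)" for z
    using prob_space_mvn by (rule prob_space_imp_subprob_space)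
  fix A :: "(real^'p) set" assume [measurable]: "A \<in> sets borel"
  have "emeasure (mvn_prec (post_mean z) S) A = (\<integral>\<^sup>+x. ennreal (mvn_dens (post_mean z) S x) * indicator A x \<partial>lborel)" for z
    unfolding mvn_prec_eq by (rule emeasure_density) auto
  then show "(\<lambda>z. emeasure (mvn_prec (post_mean z) S) A) \<in> borel_measurable zsp"
    by simp
qed simp

lemma nn_integral_K:
  assumes [measurable]: "f \<in> borel_measurable borel"
  shows "(\<integral>\<^sup>+x. f x \<partial>K \<beta>) = (\<integral>\<^sup>+z. \<integral>\<^sup>+x. f x \<partial>mvn_prec (post_mean z) S \<partial>latent \<beta>)"
  unfolding K_eq
  by (rule nn_integral_bind[where B=borel]) (auto simp: measurable_cong_sets[OF sets_latent refl])

lemma sets_K' [simp, measurable_cong]: "sets (K \<beta>) = sets borel"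
  unfolding K_eq using prob_space.not_empty[OF prob_space_latent] by (intro sets_bind) auto

lemma emeasure_K:
  assumes [measurable]: "A \<in> sets borel"
  shows "emeasure (K \<beta>) A = (\<integral>\<^sup>+z. ennreal (latent_dens \<beta> z) *
     (\<integral>\<^sup>+x. ennreal (mvn_dens (post_mean z) S x) * indicator A x \<partial>lborel) \<partial>zsp)"
proof -
  have "emeasure (K \<beta>) A = (\<integral>\<^sup>+x. indicator A x \<partial>K \<beta>)" by simp
  also have "\<dots> = (\<integral>\<^sup>+z. \<integral>\<^sup>+x. ennreal (mvn_dens (post_mean z) S x) * indicator A x \<partial>lborel \<partial>latent \<beta>)"
    by (subst nn_integral_K) (auto simp: nn_integral_mvn_dens simp del: nn_integral_indicator)
  also have "\<dots> = (\<integral>\<^sup>+z. ennreal (latent_dens \<beta> z) *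
     (\<integral>\<^sup>+x. ennreal (mvn_dens (post_mean z) S x) * indicator A x \<partial>lborel) \<partial>zsp)"
    by (rule nn_integral_latent) measurable
  finally show ?thesis .
qed

lemma prob_space_K: "prob_space (K \<beta>)"
  unfolding K_eq
  by (rule prob_space.prob_space_bind[OF prob_space_latent, where S=borel])
     (auto simp: prob_space_mvn measurable_cong_sets[OF sets_latent refl])

sublocale markov_kernel K
proof (rule markov_kernel.intro)
  show "K \<in> borel \<rightarrow>\<^sub>M subprob_algebra borel"
  proof (rule measurable_subprob_algebra)
    fix A :: "(real^'p) set" assume [measurable]: "A \<in> sets borel"
    show "(\<lambda>\<beta>. emeasure (K \<beta>) A) \<in> borel_measurable borel"
      unfolding emeasure_K[OF \<open>A \<in> sets borel\<close>] by measurable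
  qed (auto intro: prob_space_imp_subprob_space prob_space_K)
qed (rule prob_space_K)

lemma iter_eq: "iter = ac_iter xs ys n v Q"
proof (intro ext)
  fix m x show "iter m x = ac_iter xs ys n v Q m x" by (induction m) simp_all
qed

subsection \<open>Invariance of the posterior\<close>

abbreviation signs :: "(nat \<Rightarrow> real) \<Rightarrow> real" where
  "signs z \<equiv> (\<Prod>i<n. (if ys i then indicator {0<..} (z i) else indicator {..<0} (z i)) / sqrt (2 * pi))"

definition upost :: "real^'p \<Rightarrow> real" where
  "upost \<beta> = likelihood xs ys n \<beta> * prior_dens v Q \<beta>"

lemma likelihood_pos: "0 < likelihood xs ys n \<beta>"
  unfolding likelihood_def using Phi_pos Phi_less_1 by (intro prod_pos) auto

lemma upost_pos: "0 < upost \<beta>"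
  using likelihood_pos by (simp add: upost_def prior_dens_def)

lemma upost_measurable [measurable]: "upost \<in> borel_measurable borel"
  unfolding upost_def likelihood_def prior_dens_def by measurable

text \<open>The unnormalised marginal density of the latent vector in the augmented model: what is
  left of the joint density when the normal density of \<beta> given \<open>z\<close> is split
  off.\<close>

definition joint_factor :: "(nat \<Rightarrow> real) \<Rightarrow> real" where
  "joint_factor z = signs z *
     exp (- ((\<Sum>i<n. (z i)\<^sup>2) + v \<bullet> (Q *v v) - post_mean z \<bullet> (S *v post_mean z)) / 2) *
     ((2 * pi) powr (real CARD('p) / 2) / sqrt (det S))"

lemma joint_factor_nonneg: "0 \<le> joint_factor z"
  unfolding joint_factor_def using det_S_pos by (intro mult_nonneg_nonneg prod_nonneg) auto

lemma joint_factor_measurable [measurable]: "joint_factor \<in> borel_measurable zsp"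
  unfolding joint_factor_def by measurable

lemma Q_inner_commute: "a \<bullet> (Q *v b) = b \<bullet> (Q *v a)"
proof -
  have "transpose Q = Q" using Q_sym by (simp add: vec_eq_iff transpose_def)
  then show ?thesis using inner_matrix_transpose[of a Q b] by (simp add: inner_commute)
qed

text \<open>Completing the square in \<beta>: the cross terms match because
  \<open>post_mean z\<close> solves the normal equations \<open>S_post_mean\<close>.\<close>

lemma complete_square:
  "(\<Sum>i<n. (z i - xs i \<bullet> \<beta>)\<^sup>2) + (\<beta> - v) \<bullet> (Q *v (\<beta> - v))
   = ((\<Sum>i<n. (z i)\<^sup>2) + v \<bullet> (Q *v v) - post_mean z \<bullet> (S *v post_mean z))
     + (\<beta> - post_mean z) \<bullet> (S *v (\<beta> - post_mean z))"
proof -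
  let ?m = "post_mean z"
  have a: "\<beta> \<bullet> (S *v ?m) = (\<Sum>i<n. z i * (xs i \<bullet> \<beta>)) + \<beta> \<bullet> (Q *v v)"
    by (simp add: S_post_mean inner_add_right inner_sum_right inner_commute)
  have b: "?m \<bullet> (S *v \<beta>) = \<beta> \<bullet> (S *v ?m)"
    using pos_def_inner_commute[OF pd, of ?m \<beta>] by (simp add: inner_commute)
  have c: "\<beta> \<bullet> (S *v \<beta>) = (\<Sum>i<n. (xs i \<bullet> \<beta>)\<^sup>2) + \<beta> \<bullet> (Q *v \<beta>)"
    by (simp add: inner_Sigma_mat power2_eq_square)
  have d: "(\<Sum>i<n. (z i - xs i \<bullet> \<beta>)\<^sup>2) = (\<Sum>i<n. (z i)\<^sup>2) - 2 * (\<Sum>i<n. z i * (xs i \<bullet> \<beta>)) + (\<Sum>i<n. (xs i \<bullet> \<beta>)\<^sup>2)"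
    by (simp add: power2_diff sum.distrib sum_subtractf sum_distrib_left mult.assoc)
  have e: "(\<beta> - v) \<bullet> (Q *v (\<beta> - v)) = \<beta> \<bullet> (Q *v \<beta>) - 2 * (\<beta> \<bullet> (Q *v v)) + v \<bullet> (Q *v v)"
    by (simp add: matrix_vector_mult_diff_distrib inner_diff_left inner_diff_right Q_inner_commute[of v \<beta>])
  have f: "(\<beta> - ?m) \<bullet> (S *v (\<beta> - ?m)) = \<beta> \<bullet> (S *v \<beta>) - 2 * (\<beta> \<bullet> (S *v ?m)) + ?m \<bullet> (S *v ?m)"
    by (simp add: matrix_vector_mult_diff_distrib inner_diff_left inner_diff_right b)
  show ?thesis unfolding d e f c a by simp
qed

text \<open>Data augmentation: the probit factors of the likelihood cancel the normalising constants
  of the truncated normals. Both draws of the chain are thus conditionals of one joint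
  density.\<close>

lemma upost_latent_dens: "upost \<beta> * latent_dens \<beta> z = joint_factor z * mvn_dens (post_mean z) S \<beta>"
proof -
  have exp_split: "exp (- (a + b) / 2) = exp (- a / 2) * exp (- b / 2)" for a b :: real
    by (simp add: mult_exp_exp add_divide_distrib)
  have 1: "(if ys i then Phi (xs i \<bullet> \<beta>) else 1 - Phi (xs i \<bullet> \<beta>)) * tn_dens (xs i \<bullet> \<beta>) (ys i) (z i)
      = (if ys i then indicator {0<..} (z i) else indicator {..<0} (z i)) / sqrt (2 * pi) * exp (- (z i - xs i \<bullet> \<beta>)\<^sup>2 / 2)" for i
    using Phi_pos[of "xs i \<bullet> \<beta>"] Phi_less_1[of "xs i \<bullet> \<beta>"]
    by (auto simp: tn_dens_def normal_density_def)
  have "likelihood xs ys n \<beta> * latent_dens \<beta> z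
      = signs z * (\<Prod>i<n. exp (- (z i - xs i \<bullet> \<beta>)\<^sup>2 / 2))"
    unfolding likelihood_def latent_dens_def prod.distrib[symmetric] 1 ..
  also have "(\<Prod>i<n. exp (- (z i - xs i \<bullet> \<beta>)\<^sup>2 / 2)) = exp (- (\<Sum>i<n. (z i - xs i \<bullet> \<beta>)\<^sup>2) / 2)"
    by (simp add: exp_sum[symmetric] sum_negf[symmetric] sum_divide_distrib)
  finally have l: "likelihood xs ys n \<beta> * latent_dens \<beta> z
      = signs z
        * exp (- (\<Sum>i<n. (z i - xs i \<bullet> \<beta>)\<^sup>2) / 2)" .
  have "upost \<beta> * latent_dens \<beta> z = (likelihood xs ys n \<beta> * latent_dens \<beta> z) * exp (- ((\<beta> - v) \<bullet> (Q *v (\<beta> - v))) / 2)"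
    by (simp add: upost_def prior_dens_def)
  also have "\<dots> = signs z
      * exp (- ((\<Sum>i<n. (z i - xs i \<bullet> \<beta>)\<^sup>2) + (\<beta> - v) \<bullet> (Q *v (\<beta> - v))) / 2)"
    unfolding l exp_split by (simp only: mult.assoc)
  also have "\<dots> = joint_factor z * mvn_dens (post_mean z) S \<beta>"
    unfolding complete_square joint_factor_def mvn_dens_def exp_split using det_S_pos by simp
  finally show ?thesis .
qed

lemma nn_integral_latent_dens: "(\<integral>\<^sup>+z. ennreal (latent_dens \<beta> z) \<partial>zsp) = 1"
  using nn_integral_latent[of "\<lambda>_. 1" \<beta>] prob_space.emeasure_space_1[OF prob_space_latent[of \<beta>]] by simp

lemma nn_integral_mvn_dens_1: "(\<integral>\<^sup>+x. ennreal (mvn_dens m S x) \<partial>lborel) = 1"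
  using nn_integral_mvn_dens[of "\<lambda>_. 1" m] prob_space.emeasure_space_1[OF prob_space_mvn[of m]] by simp

text \<open>The Gibbs sampler argument. The joint density is factored through \<open>z\<close>,
  \<beta> is integrated out and replaced by a fresh conditional draw, and then \<open>z\<close> is
  integrated out, with Tonelli in between.\<close>

lemma upost_invariant:
  assumes [measurable]: "A \<in> sets borel"
  shows "(\<integral>\<^sup>+\<beta>. ennreal (upost \<beta>) * emeasure (K \<beta>) A \<partial>lborel) = (\<integral>\<^sup>+\<beta>. ennreal (upost \<beta>) * indicator A \<beta> \<partial>lborel)"
proof -
  let ?P = zsp
  define N where "N z = (\<integral>\<^sup>+x. ennreal (mvn_dens (post_mean z) S x) * indicator A x \<partial>lborel)" for z
  have [measurable]: "N \<in> borel_measurable ?P" unfolding N_def by measurable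
  have j: "ennreal (upost \<beta>) * ennreal (latent_dens \<beta> z) = ennreal (joint_factor z) * ennreal (mvn_dens (post_mean z) S \<beta>)" for \<beta> z
    using upost_pos[of \<beta>] by (simp add: ennreal_mult'[symmetric] upost_latent_dens joint_factor_nonneg less_imp_le)
  have "(\<integral>\<^sup>+\<beta>. ennreal (upost \<beta>) * emeasure (K \<beta>) A \<partial>lborel)
     = (\<integral>\<^sup>+\<beta>. \<integral>\<^sup>+z. ennreal (joint_factor z) * ennreal (mvn_dens (post_mean z) S \<beta>) * N z \<partial>?P \<partial>lborel)"
    unfolding emeasure_K[OF assms] N_def[symmetric]
    by (subst nn_integral_cmult[symmetric]) (auto simp: j mult.assoc[symmetric])
  also have "\<dots> = (\<integral>\<^sup>+z. \<integral>\<^sup>+\<beta>. ennreal (joint_factor z) * N z * ennreal (mvn_dens (post_mean z) S \<beta>) \<partial>lborel \<partial>?P)"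
    by (subst leb_pair.Fubini') (auto simp: mult_ac split_beta)
  also have "\<dots> = (\<integral>\<^sup>+z. ennreal (joint_factor z) * N z \<partial>?P)"
    by (subst nn_integral_cmult) (auto simp: nn_integral_mvn_dens_1)
  also have "\<dots> = (\<integral>\<^sup>+z. \<integral>\<^sup>+x. ennreal (joint_factor z) * ennreal (mvn_dens (post_mean z) S x) * indicator A x \<partial>lborel \<partial>?P)"
    unfolding N_def by (subst nn_integral_cmult[symmetric]) (auto simp: mult.assoc)
  also have "\<dots> = (\<integral>\<^sup>+x. \<integral>\<^sup>+z. (ennreal (upost x) * indicator A x) * ennreal (latent_dens x z) \<partial>?P \<partial>lborel)"
    by (subst leb_pair.Fubini') (auto simp: j[symmetric] mult_ac split_beta)
  also have "\<dots> = (\<integral>\<^sup>+x. ennreal (upost x) * indicator A x \<partial>lborel)"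
    by (subst nn_integral_cmult) (auto simp: nn_integral_latent_dens)
  finally show ?thesis .
qed

end

text \<open>Expands the squared norm of \<open>(1 - t) *\<^sub>R a - t *\<^sub>R b\<close>. With
  \<open>t\<close> the contraction factor, dividing its square by \<open>t\<close> still leaves one
  factor below 1.\<close>

lemma norm_add_sq_le:
  fixes a b :: "'a::real_inner"
  assumes "0 < t" "t < 1"
  shows "(norm (a + b))\<^sup>2 \<le> (norm a)\<^sup>2 / t + (norm b)\<^sup>2 / (1 - t)"
proof -
  have "0 \<le> (norm ((1 - t) *\<^sub>R a - t *\<^sub>R b))\<^sup>2" by simp
  also have "\<dots> = (1-t)\<^sup>2 * (norm a)\<^sup>2 + t\<^sup>2 * (norm b)\<^sup>2 - 2 * t * (1 - t) * (a \<bullet> b)"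
    unfolding power2_norm_eq_inner
    by (simp add: inner_diff_left inner_diff_right inner_commute[of b a]) (simp add: power2_eq_square algebra_simps)
  finally have "t * (1 - t) * (2 * (a \<bullet> b)) \<le> (1-t)\<^sup>2 * (norm a)\<^sup>2 + t\<^sup>2 * (norm b)\<^sup>2"
    by (simp add: algebra_simps)
  also have "\<dots> = t * (1 - t) * ((1 - t) / t * (norm a)\<^sup>2 + t / (1 - t) * (norm b)\<^sup>2)"
    using assms by (simp add: field_simps power2_eq_square)
  finally have "2 * (a \<bullet> b) \<le> (1 - t) / t * (norm a)\<^sup>2 + t / (1 - t) * (norm b)\<^sup>2"
    using assms by (simp add: mult_le_cancel_left_pos)
  moreover have "(norm (a + b))\<^sup>2 = (norm a)\<^sup>2 + (norm b)\<^sup>2 + 2 * (a \<bullet> b)"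
    by (simp add: power2_norm_eq_inner inner_add_left inner_add_right inner_commute[of b a])
  moreover have "(norm a)\<^sup>2 / t = (norm a)\<^sup>2 + (1 - t) / t * (norm a)\<^sup>2"
    "(norm b)\<^sup>2 / (1 - t) = (norm b)\<^sup>2 + t / (1 - t) * (norm b)\<^sup>2"
    using assms by (auto simp: field_simps)
  ultimately show ?thesis by linarith
qed

section \<open>The posterior as an invariant probability measure\<close>

context albert_chib
begin

definition evidence :: real where "evidence = (\<integral>\<beta>. upost \<beta> \<partial>lborel)"

lemma integrable_upost: "integrable lborel upost"
proof (rule integrableI_bounded)
  have "(\<integral>\<^sup>+\<beta>. ennreal (norm (upost \<beta>)) \<partial>lborel) \<le> (\<integral>\<^sup>+\<beta>. ennreal (exp (- (c\<^sub>0 * (\<beta> \<bullet> \<beta>)))) \<partial>leb)"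
  proof (rule nn_integral_mono)
    fix \<beta> show "ennreal (norm (upost \<beta>)) \<le> ennreal (exp (- (c\<^sub>0 * (\<beta> \<bullet> \<beta>))))"
      using tail[of \<beta>] upost_pos[of \<beta>] by (intro ennreal_leI) (simp add: upost_def)
  qed
  then show "(\<integral>\<^sup>+\<beta>. ennreal (norm (upost \<beta>)) \<partial>lborel) < \<infinity>"
    using c0 by (simp add: nn_integral_gaussian le_less_trans)
qed simp

lemma evidence_pos: "0 < evidence"
proof -
  have "0 \<le> evidence" unfolding evidence_def using upost_pos by (intro integral_nonneg_AE) (auto simp: less_imp_le)
  moreover have "evidence \<noteq> 0"
  proof
    assume "evidence = 0"
    then have "AE \<beta> in lborel. upost \<beta> = 0"
      unfolding evidence_def using upost_pos integrable_upost
      by (subst (asm) integral_nonneg_eq_0_iff_AE) (auto simp: less_imp_le)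
    then have "AE \<beta> in leb. False"
      by eventually_elim (metis upost_pos less_irrefl)
    then show False by (simp add: AE_iff_measurable[OF _ refl] emeasure_lborel_UNIV)
  qed
  ultimately show ?thesis by simp
qed

abbreviation post :: "(real^'p) measure" where "post \<equiv> posterior xs ys n v Q"

lemma post_eq: "post = density lborel (\<lambda>\<beta>. ennreal (upost \<beta> / evidence))"
  by (simp add: posterior_def upost_def evidence_def)

lemma sets_post [simp, measurable_cong]: "sets post = sets borel"
  by (simp add: post_eq)

lemma nn_integral_post:
  assumes [measurable]: "f \<in> borel_measurable borel"
  shows "(\<integral>\<^sup>+\<beta>. f \<beta> \<partial>post) = ennreal (1 / evidence) * (\<integral>\<^sup>+\<beta>. ennreal (upost \<beta>) * f \<beta> \<partial>lborel)"
proof -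
  have "(\<integral>\<^sup>+\<beta>. f \<beta> \<partial>post) = (\<integral>\<^sup>+\<beta>. ennreal (1 / evidence) * (ennreal (upost \<beta>) * f \<beta>) \<partial>lborel)"
    unfolding post_eq using evidence_pos upost_pos
    by (subst nn_integral_density) (auto simp: ennreal_mult'[symmetric] mult.assoc[symmetric])
  then show ?thesis by (simp add: nn_integral_cmult)
qed

lemma prob_space_post: "prob_space post"
proof (rule prob_spaceI)
  have "emeasure post (space post) = (\<integral>\<^sup>+\<beta>. 1 \<partial>post)" by simp
  also have "\<dots> = ennreal (1 / evidence) * ennreal evidence"
    using upost_pos by (subst nn_integral_post)
      (auto simp: evidence_def less_imp_le intro!: nn_integral_eq_integral integrable_upost arg_cong2[where f="(*)"])
  also have "\<dots> = 1" using evidence_pos by (simp add: ennreal_mult'[symmetric])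
  finally show "emeasure post (space post) = 1" .
qed

lemma post_invariant: "post \<bind> K = post"
proof (rule measure_eqI)
  interpret prob_space post by (rule prob_space_post)
  show s: "sets (post \<bind> K) = sets post" by (simp add: sets_bind[where N=borel] not_empty)
  fix A assume "A \<in> sets (post \<bind> K)"
  then have A [measurable]: "A \<in> sets borel" by (simp add: s)
  have "emeasure (post \<bind> K) A = (\<integral>\<^sup>+\<beta>. emeasure (K \<beta>) A \<partial>post)"
    by (rule emeasure_bind[where N=borel]) (auto simp: not_empty)
  also have "\<dots> = ennreal (1 / evidence) * (\<integral>\<^sup>+\<beta>. ennreal (upost \<beta>) * indicator A \<beta> \<partial>lborel)"
    by (simp add: nn_integral_post upost_invariant)
  also have "\<dots> = (\<integral>\<^sup>+\<beta>. indicator A \<beta> \<partial>post)"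
    by (simp add: nn_integral_post del: nn_integral_indicator)
  finally show "emeasure (post \<bind> K) A = emeasure post A" by simp
qed

section \<open>The mean map and the latent noise in whitened coordinates\<close>

definition w :: "nat \<Rightarrow> real^'p" where "w i = transpose B *v xs i"

lemma w_inner: "w i \<bullet> e = xs i \<bullet> (B *v e)"
  by (simp add: w_def inner_matrix_transpose)

definition w\<^sub>0 :: "real^'p" where "w\<^sub>0 = transpose B *v (Q *v v)"

text \<open>Whitening replaces the inverse of \<open>S\<close> by the transpose of \<open>B\<close>,
  so the whitened conditional mean is affine in \<open>z\<close> with coefficient vectors
  \<open>w i\<close>.\<close>

lemma C_post_mean: "C *v post_mean z = (\<Sum>i<n. z i *\<^sub>R w i) + w\<^sub>0"
proof -
  have "transpose B *v (\<Sum>i<n. z i *\<^sub>R xs i) = (\<Sum>i<n. z i *\<^sub>R w i)"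
    by (simp add: linear_sum[OF matrix_vector_mul_linear] w_def matrix_vector_mult_scaleR)
  then show ?thesis
    by (simp add: post_mean_def C_matrix_inv w\<^sub>0_def matrix_vector_right_distrib)
qed

definition lmean :: "nat \<Rightarrow> real^'p \<Rightarrow> real" where
  "lmean i \<beta> = ysign (ys i) * tn_mean (\<theta> i \<beta>)"

text \<open>The argument is in original coordinates, the value in whitened ones; composition with
  \<open>B\<close> gives a self-map.\<close>

definition mean_map :: "real^'p \<Rightarrow> real^'p" where
  "mean_map \<beta> = (\<Sum>i<n. lmean i \<beta> *\<^sub>R w i) + w\<^sub>0"

text \<open>The mean value theorem along the segment between the two states, for the component of
  the map in the direction of the difference \<open>e\<close> itself. The derivative is a bilinear
  form weighted by truncated variances, and \<open>contraction\<close> bounds its quadratic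
  form.\<close>

lemma mean_map_lipschitz: "norm (mean_map \<beta> - mean_map \<beta>') \<le> \<kappa> * norm (C *v (\<beta> - \<beta>'))"
proof -
  define e where "e = mean_map \<beta> - mean_map \<beta>'"
  define d where "d = \<beta> - \<beta>'"
  define \<tau> where "\<tau> t i = tn_var (\<theta> i (\<beta>' + t *\<^sub>R d))" for t i
  define g where "g t = e \<bullet> mean_map (\<beta>' + t *\<^sub>R d)" for t
  have g_eq: "g t = (\<Sum>i<n. ysign (ys i) * tn_mean (ysign (ys i) * (xs i \<bullet> \<beta>' + t * (xs i \<bullet> d))) * (xs i \<bullet> (B *v e))) + e \<bullet> w\<^sub>0" for t
    by (simp add: g_def mean_map_def inner_add_right inner_sum_right lmean_def w_inner[symmetric] inner_commute)
  have "(g has_real_derivative (\<Sum>i<n. \<tau> t i * (xs i \<bullet> d) * (xs i \<bullet> (B *v e)))) (at t)" for t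
    unfolding g_eq[abs_def]
    by (rule derivative_eq_intros refl)+
       (simp add: \<tau>_def inner_add_right mult_ac)
  then obtain t where t: "g 1 - g 0 = (1 - 0) * (\<Sum>i<n. \<tau> t i * (xs i \<bullet> d) * (xs i \<bullet> (B *v e)))"
    using MVT2[of 0 1 g "\<lambda>t. (\<Sum>i<n. \<tau> t i * (xs i \<bullet> d) * (xs i \<bullet> (B *v e)))"] by auto
  have \<tau>0: "0 \<le> \<tau> t i" for i by (simp add: \<tau>_def tn_var_nonneg)
  have con: "(\<Sum>i<n. \<tau> t i * (xs i \<bullet> a)\<^sup>2) \<le> \<kappa> * (norm (C *v a))\<^sup>2" for a
    using contraction[of "\<beta>' + t *\<^sub>R d" a] by (simp add: \<tau>_def norm_C)
  \<comment> \<open>Splitting each weight into two square roots, Cauchy-Schwarz leaves two quadratic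
    forms at the same intermediate point, in the directions \<open>d\<close> and
    \<open>B *v e\<close>; the latter has whitened norm \<open>norm e\<close>.\<close>
  have "((norm e)\<^sup>2)\<^sup>2 = (\<Sum>i<n. (sqrt (\<tau> t i) * (xs i \<bullet> d)) * (sqrt (\<tau> t i) * (xs i \<bullet> (B *v e))))\<^sup>2"
  proof -
    have "(norm e)\<^sup>2 = g 1 - g 0"
      by (simp add: g_def e_def d_def inner_diff_right[symmetric] power2_norm_eq_inner)
    also have "\<dots> = (\<Sum>i<n. (sqrt (\<tau> t i) * (xs i \<bullet> d)) * (sqrt (\<tau> t i) * (xs i \<bullet> (B *v e))))"
      unfolding t by (auto intro!: sum.cong simp: \<tau>0 algebra_simps)
    finally show ?thesis by simp
  qed
  also have "\<dots> \<le> (\<Sum>i<n. (sqrt (\<tau> t i) * (xs i \<bullet> d))\<^sup>2) * (\<Sum>i<n. (sqrt (\<tau> t i) * (xs i \<bullet> (B *v e)))\<^sup>2)"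
    by (rule Cauchy_Schwarz_ineq_sum)
  also have "\<dots> = (\<Sum>i<n. \<tau> t i * (xs i \<bullet> d)\<^sup>2) * (\<Sum>i<n. \<tau> t i * (xs i \<bullet> (B *v e))\<^sup>2)"
    by (simp add: power_mult_distrib \<tau>0)
  also have "\<dots> \<le> (\<kappa> * (norm (C *v d))\<^sup>2) * (\<kappa> * (norm (C *v (B *v e)))\<^sup>2)"
    using con \<kappa> by (intro mult_mono) (auto intro!: sum_nonneg mult_nonneg_nonneg \<tau>0)
  also have "\<dots> = (\<kappa> * norm (C *v d) * norm e)\<^sup>2"
    by (simp add: C_B power2_eq_square mult_ac)
  finally have "(norm e)\<^sup>2 \<le> \<kappa> * norm (C *v d) * norm e"
    using \<kappa> by (auto intro: power2_le_imp_le)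
  then have "norm e \<le> \<kappa> * norm (C *v d)"
    using \<kappa> by (cases "e = 0") (auto simp: power2_eq_square)
  then show ?thesis by (simp add: e_def d_def)
qed

definition u\<^sub>f :: "real^'p" where "u\<^sub>f = (SOME u. mean_map (B *v u) = u)"

lemma u_star: "mean_map (B *v u\<^sub>f) = u\<^sub>f"
proof -
  have "dist (mean_map (B *v u)) (mean_map (B *v u')) \<le> \<kappa> * dist u u'" for u u'
    using mean_map_lipschitz[of "B *v u" "B *v u'"]
    by (simp add: dist_norm C_B flip: matrix_vector_mult_diff_distrib)
  then have "\<exists>!u. mean_map (B *v u) = u"
    using \<kappa> by (intro banach_fix_type[of \<kappa>]) auto
  then show ?thesis unfolding u\<^sub>f_def by (metis (mono_tags) someI_ex)
qed

text \<open>Squared distance, in the norm of \<open>S\<close>, to the state whose mean update is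
  itself; \<open>u\<^sub>f\<close> is that state in whitened coordinates.\<close>

definition V :: "real^'p \<Rightarrow> real" where "V \<beta> = (norm (C *v \<beta> - u\<^sub>f))\<^sup>2"

lemma V_measurable [measurable]: "V \<in> borel_measurable borel"
  unfolding V_def by measurable

lemma V_nonneg: "0 \<le> V \<beta>" by (simp add: V_def)

lemma mean_map_V: "(norm (mean_map \<beta> - u\<^sub>f))\<^sup>2 \<le> \<kappa>\<^sup>2 * V \<beta>"
proof -
  have "norm (mean_map \<beta> - u\<^sub>f) \<le> \<kappa> * norm (C *v \<beta> - u\<^sub>f)"
    using mean_map_lipschitz[of \<beta> "B *v u\<^sub>f"] by (simp add: u_star C_B matrix_vector_mult_diff_distrib)
  then have "(norm (mean_map \<beta> - u\<^sub>f))\<^sup>2 \<le> (\<kappa> * norm (C *v \<beta> - u\<^sub>f))\<^sup>2" by (rule power_mono) simp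
  then show ?thesis by (simp add: V_def power_mult_distrib)
qed

text \<open>The sum is the trace of Sigma^{-1} X^T X. Along each basis vector the form of X^T X is
  at most that of Sigma, which is 1 after whitening, so the bound is free of
  \<open>n\<close>.\<close>

lemma sum_norm_w: "(\<Sum>i<n. (norm (w i))\<^sup>2) \<le> real CARD('p)"
proof -
  have "(\<Sum>i<n. (norm (w i))\<^sup>2) = (\<Sum>i<n. \<Sum>k\<in>UNIV. (xs i \<bullet> (B *v axis k 1))\<^sup>2)"
  proof (rule sum.cong)
    fix i
    have "(norm (w i))\<^sup>2 = (\<Sum>k\<in>UNIV. (w i $ k)\<^sup>2)"
      unfolding power2_norm_eq_inner by (simp add: inner_vec_def power2_eq_square)
    also have "\<dots> = (\<Sum>k\<in>UNIV. (xs i \<bullet> (B *v axis k 1))\<^sup>2)"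
      by (simp add: w_inner[symmetric] inner_axis)
    finally show "(norm (w i))\<^sup>2 = (\<Sum>k\<in>UNIV. (xs i \<bullet> (B *v axis k 1))\<^sup>2)" .
  qed simp
  also have "\<dots> = (\<Sum>k\<in>UNIV. \<Sum>i<n. (xs i \<bullet> (B *v axis k 1))\<^sup>2)" by (rule sum.swap)
  also have "\<dots> \<le> (\<Sum>k\<in>(UNIV::'p set). 1)"
  proof (rule sum_mono)
    fix k
    have "(\<Sum>i<n. (xs i \<bullet> (B *v axis k 1))\<^sup>2) \<le> (B *v axis k 1) \<bullet> (S *v (B *v axis k 1))"
      using Q_psd[of "B *v axis k 1"] by (simp add: inner_Sigma_mat power2_eq_square)
    then show "(\<Sum>i<n. (xs i \<bullet> (B *v axis k 1))\<^sup>2) \<le> 1" by (simp add: inner_B inner_axis_axis)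
  qed
  finally show ?thesis by simp
qed

definition noise :: "real^'p \<Rightarrow> (nat \<Rightarrow> real) \<Rightarrow> real^'p" where
  "noise \<beta> z = (\<Sum>i<n. (z i - lmean i \<beta>) *\<^sub>R w i)"

lemma noise_measurable [measurable]: "noise \<beta> \<in> borel_measurable zsp"
  unfolding noise_def[abs_def] by measurable

lemma C_post_mean_noise: "C *v post_mean z = mean_map \<beta> + noise \<beta> z"
  by (simp add: C_post_mean mean_map_def noise_def scaleR_diff_left sum_subtractf)

lemma latent_covariance:
  assumes "i < n" "j < n"
  shows "integrable (latent \<beta>) (\<lambda>z. (z i - lmean i \<beta>) * (z j - lmean j \<beta>))" (is ?I)
    and "(\<integral>z. (z i - lmean i \<beta>) * (z j - lmean j \<beta>) \<partial>latent \<beta>)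
      = (if i = j then tn_var (\<theta> i \<beta>) else 0)" (is ?E)
proof -
  let ?T = "\<lambda>k. tn_measure (xs k \<bullet> \<beta>) (ys k)"
  interpret T: product_sigma_finite ?T
    by (simp add: product_sigma_finite_def prob_space_tn prob_space_imp_sigma_finite)
  \<comment> \<open>Padding with factors 1 writes the product of two centred coordinates as a
    product over all coordinates; for \<open>i = j\<close> both factors fall on the same
    one.\<close>
  define f :: "nat \<Rightarrow> real \<Rightarrow> real" where
    "f k x = (if k = i then x - lmean i \<beta> else 1) * (if k = j then x - lmean j \<beta> else 1)" for k x
  have prod: "(z i - lmean i \<beta>) * (z j - lmean j \<beta>) = (\<Prod>k<n. f k (z k))" for z
    using assms by (simp add: f_def prod.distrib prod.delta)
  have fi: "integrable (?T k) (f k)" for k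
  proof -
    interpret prob_space "?T k" by (rule prob_space_tn)
    have "integrable (?T k) (\<lambda>x. (x - a) * (x - b))" for a b
    proof -
      have "(\<lambda>x. (x - a) * (x - b)) = (\<lambda>x. x\<^sup>2 - (a + b) * x + a * b)"
        by (auto simp: power2_eq_square algebra_simps)
      then show ?thesis using tn_moments(1,2) by simp
    qed
    moreover have "integrable (?T k) (\<lambda>x. x - a)" for a using tn_moments(1) by simp
    ultimately show ?thesis unfolding f_def[abs_def] by (cases "k = i"; cases "k = j") simp_all
  qed
  show ?I unfolding prod latent_def by (rule T.product_integrable_prod) (auto intro: fi)
  have mean: "(\<integral>x. x - lmean k \<beta> \<partial>?T k) = 0" for k
  proof -
    interpret prob_space "?T k" by (rule prob_space_tn)
    have "(\<integral>x. x - lmean k \<beta> \<partial>?T k) = (\<integral>x. x \<partial>?T k) - lmean k \<beta>"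
      using tn_moments(1)[of "xs k \<bullet> \<beta>" "ys k"] prob_space by simp
    then show ?thesis by (simp add: tn_moments(3) lmean_def)
  qed
  have "(\<integral>z. (z i - lmean i \<beta>) * (z j - lmean j \<beta>) \<partial>latent \<beta>) = (\<Prod>k<n. \<integral>x. f k x \<partial>?T k)"
    unfolding prod latent_def by (rule T.product_integral_prod) (auto intro: fi)
  also have "\<dots> = (if i = j then tn_var (\<theta> i \<beta>) else 0)"
  proof (cases "i = j")
    case True
    have "(\<integral>x. f k x \<partial>?T k) = (if k = i then tn_var (\<theta> i \<beta>) else 1)" for k
      using tn_moments(4)[of "xs i \<bullet> \<beta>" "ys i"] prob_space.prob_space[OF prob_space_tn] True
      by (simp add: f_def[abs_def] lmean_def power2_eq_square)
    then show ?thesis using True assms by simp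
  next
    case False
    then have "(\<integral>x. f i x \<partial>?T i) = 0" using mean[of i] by (simp add: f_def[abs_def])
    then show ?thesis using False assms by (auto intro!: prod_zero)
  qed
  finally show ?E .
qed

text \<open>Independence kills the mixed terms, the truncated variances are at most 1, and the trace
  bound does the rest.\<close>

lemma nn_integral_noise: "(\<integral>\<^sup>+z. ennreal ((norm (noise \<beta> z))\<^sup>2) \<partial>latent \<beta>) \<le> ennreal (real CARD('p))"
proof -
  have eq: "(norm (noise \<beta> z))\<^sup>2 = (\<Sum>i<n. \<Sum>j<n. (w i \<bullet> w j) * ((z i - lmean i \<beta>) * (z j - lmean j \<beta>)))" for z
    by (simp add: power2_norm_eq_inner noise_def inner_sum_left inner_sum_right mult_ac inner_commute)
  have int: "integrable (latent \<beta>) (\<lambda>z. (norm (noise \<beta> z))\<^sup>2)"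
    unfolding eq by (intro Bochner_Integration.integrable_sum integrable_mult_right latent_covariance(1)) auto
  have "(\<integral>z. (norm (noise \<beta> z))\<^sup>2 \<partial>latent \<beta>)
      = (\<Sum>i<n. \<Sum>j<n. (w i \<bullet> w j) * (if i = j then tn_var (\<theta> i \<beta>) else 0))"
    unfolding eq
    by (subst Bochner_Integration.integral_sum; (intro Bochner_Integration.integrable_sum sum.cong refl)?)
       (auto simp: latent_covariance Bochner_Integration.integral_sum intro!: sum.cong)
  also have "\<dots> = (\<Sum>i<n. (norm (w i))\<^sup>2 * tn_var (\<theta> i \<beta>))"
    by (simp add: if_distrib power2_norm_eq_inner cong: if_cong)
  also have "\<dots> \<le> (\<Sum>i<n. (norm (w i))\<^sup>2)"
    using tn_var_le_1 by (intro sum_mono) (simp add: mult_left_le)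
  also have "\<dots> \<le> real CARD('p)" by (rule sum_norm_w)
  finally show ?thesis using int by (subst nn_integral_eq_integral) (auto intro: ennreal_leI)
qed

end

text \<open>From a state with \<open>V \<le> 4 * drift_const p \<kappa> / (1 - \<kappa>)\<close>, the squared distance from the whitened conditional mean
  to the fixed point is at most \<open>minor_radius p \<kappa>\<close> with probability at least one half, by Markov's inequality;
  \<open>minor_mass p \<kappa>\<close> is the integral of a common lower bound for half the corresponding Gaussian densities.\<close>

definition drift_const :: "nat \<Rightarrow> real \<Rightarrow> real" where
  "drift_const p \<kappa> = (2 * real p + 8 * sqrt 2 ^ p) / (1 - \<kappa>)"

definition minor_radius :: "nat \<Rightarrow> real \<Rightarrow> real" where
  "minor_radius p \<kappa> = 4 * (4 * drift_const p \<kappa> / (1 - \<kappa>) + real p)"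

definition minor_mass :: "nat \<Rightarrow> real \<Rightarrow> real" where
  "minor_mass p \<kappa> = exp (- minor_radius p \<kappa>) / (2 * sqrt 2 ^ p)"

definition ac_rate_bound :: "nat \<Rightarrow> real \<Rightarrow> real" where
  "ac_rate_bound p \<kappa> = harris_rate (minor_mass p \<kappa>) \<kappa>"

section \<open>Drift and minorization with constants in the dimension and \<kappa> only\<close>

context albert_chib
begin

lemma drift_const_pos: "0 < drift_const CARD('p) \<kappa>"
  using \<kappa> unfolding drift_const_def by (intro divide_pos_pos add_nonneg_pos) auto

lemma minor_radius_pos: "0 < minor_radius CARD('p) \<kappa>"
  using drift_const_pos \<kappa> unfolding minor_radius_def
  by (intro mult_pos_pos add_pos_nonneg divide_pos_pos) auto

lemma minor_mass: "0 < minor_mass CARD('p) \<kappa>" "minor_mass CARD('p) \<kappa> \<le> 1"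
proof -
  show "0 < minor_mass CARD('p) \<kappa>" by (simp add: minor_mass_def)
  have "exp (- minor_radius CARD('p) \<kappa>) \<le> 1" using minor_radius_pos by simp
  also have "1 \<le> 2 * sqrt 2 ^ CARD('p)"
  proof -
    have "1 \<le> sqrt 2 ^ CARD('p)" by (rule one_le_power) simp
    then show ?thesis by linarith
  qed
  finally show "minor_mass CARD('p) \<kappa> \<le> 1" by (simp add: minor_mass_def)
qed

lemma post_mean_B: "post_mean z + B *v u = B *v (C *v post_mean z + u)"
  by (simp add: matrix_vector_right_distrib B_C)

lemma nn_integral_K_white:
  assumes [measurable]: "f \<in> borel_measurable borel"
  shows "(\<integral>\<^sup>+x. f x \<partial>K \<beta>) = (\<integral>\<^sup>+z. \<integral>\<^sup>+u. ennreal (gdens u) * f (B *v (mean_map \<beta> + noise \<beta> z + u)) \<partial>lborel \<partial>latent \<beta>)"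
  by (simp add: nn_integral_K nn_integral_mvn post_mean_B C_post_mean_noise[of _ \<beta>])

text \<open>The whitened new state minus the fixed point is a contracted part plus latent and
  Gaussian noise. Splitting off the noise with weight \<kappa> turns \<kappa> squared into \<kappa>;
  the two noises are then separated at the cost of the factor \<open>b\<close>.\<close>

lemma drift_K: "(\<integral>\<^sup>+x. ennreal (V x) \<partial>K \<beta>) \<le> ennreal (\<kappa> * V \<beta> + drift_const CARD('p) \<kappa>)"
proof -
  interpret L: prob_space "latent \<beta>" by (rule prob_space_latent)
  define a where "a = (norm (mean_map \<beta> - u\<^sub>f))\<^sup>2 / \<kappa>"
  define b where "b = 2 / (1 - \<kappa>)"
  have ab: "0 \<le> a" "0 \<le> b" using \<kappa> by (auto simp: a_def b_def)
  have pt: "V (B *v (mean_map \<beta> + noise \<beta> z + u)) \<le> a + b * (norm (noise \<beta> z))\<^sup>2 + b * (norm u)\<^sup>2" for z u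
  proof -
    have "V (B *v (mean_map \<beta> + noise \<beta> z + u)) = (norm ((mean_map \<beta> - u\<^sub>f) + (noise \<beta> z + u)))\<^sup>2"
      by (simp add: V_def C_B algebra_simps)
    also have "\<dots> \<le> a + (norm (noise \<beta> z + u))\<^sup>2 / (1 - \<kappa>)"
      unfolding a_def using \<kappa> by (rule norm_add_sq_le)
    also have "(norm (noise \<beta> z + u))\<^sup>2 \<le> (norm (noise \<beta> z))\<^sup>2 / (1/2) + (norm u)\<^sup>2 / (1 - 1/2)"
      by (rule norm_add_sq_le) auto
    finally show ?thesis using \<kappa> by (simp add: b_def divide_right_mono add_divide_distrib mult.commute)
  qed
  let ?c = "\<lambda>z. a + b * (norm (noise \<beta> z))\<^sup>2"
  have "(\<integral>\<^sup>+x. ennreal (V x) \<partial>K \<beta>)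
      \<le> (\<integral>\<^sup>+z. \<integral>\<^sup>+u. ennreal (gdens u) * ennreal (?c z + b * (norm u)\<^sup>2) \<partial>leb \<partial>latent \<beta>)"
    using pt by (subst nn_integral_K_white) (auto intro!: nn_integral_mono mult_left_mono ennreal_leI)
  also have "\<dots> \<le> (\<integral>\<^sup>+z. ennreal (?c z) + ennreal (b * (4 * sqrt 2 ^ CARD('p))) \<partial>latent \<beta>)"
  proof (rule nn_integral_mono)
    fix z
    have "(\<integral>\<^sup>+u. ennreal (gdens u) * ennreal (?c z + b * (norm u)\<^sup>2) \<partial>leb)
      = (\<integral>\<^sup>+u. ennreal (?c z) * ennreal (gdens u) + ennreal b * ennreal (gdens u * (norm u)\<^sup>2) \<partial>leb)"
    proof (rule nn_integral_cong)
      fix u :: "real^'p"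
      define c where "c = ?c z"
      have c: "0 \<le> c" using ab by (simp add: c_def)
      have s: "0 \<le> gdens u" using gdens_pos[of u] by simp
      have "ennreal (gdens u) * ennreal (c + b * (norm u)\<^sup>2) = ennreal (c * gdens u + b * (gdens u * (norm u)\<^sup>2))"
        using s by (simp add: ennreal_mult'[symmetric] algebra_simps del: ennreal_plus)
      also have "\<dots> = ennreal c * ennreal (gdens u) + ennreal b * ennreal (gdens u * (norm u)\<^sup>2)"
        using s c ab by (subst ennreal_plus) (auto simp: ennreal_mult)
      finally show "ennreal (gdens u) * ennreal (?c z + b * (norm u)\<^sup>2)
        = ennreal (?c z) * ennreal (gdens u) + ennreal b * ennreal (gdens u * (norm u)\<^sup>2)"
        by (simp only: c_def)
    qed
    also have "\<dots> = ennreal (?c z) + ennreal b * (\<integral>\<^sup>+u. ennreal (gdens u * (norm u)\<^sup>2) \<partial>leb)"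
      by (subst nn_integral_add) (auto simp: nn_integral_cmult nn_integral_gdens)
    also have "\<dots> \<le> ennreal (?c z) + ennreal b * ennreal (4 * sqrt 2 ^ CARD('p))"
      by (intro add_left_mono mult_left_mono nn_integral_gdens_norm2) auto
    finally show "(\<integral>\<^sup>+u. ennreal (gdens u) * ennreal (?c z + b * (norm u)\<^sup>2) \<partial>leb)
      \<le> ennreal (?c z) + ennreal (b * (4 * sqrt 2 ^ CARD('p)))"
      using ab by (simp add: ennreal_mult)
  qed
  also have "\<dots> = (\<integral>\<^sup>+z. ennreal (a + b * (4 * sqrt 2 ^ CARD('p))) + ennreal b * ennreal ((norm (noise \<beta> z))\<^sup>2) \<partial>latent \<beta>)"
    using ab by (intro nn_integral_cong)
      (simp add: ennreal_plus[symmetric] ennreal_mult[symmetric] algebra_simps del: ennreal_plus)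
  also have "\<dots> = ennreal (a + b * (4 * sqrt 2 ^ CARD('p))) + ennreal b * (\<integral>\<^sup>+z. ennreal ((norm (noise \<beta> z))\<^sup>2) \<partial>latent \<beta>)"
    by (subst nn_integral_add) (auto simp: nn_integral_cmult L.emeasure_space_1)
  also have "\<dots> \<le> ennreal (a + b * (4 * sqrt 2 ^ CARD('p))) + ennreal b * ennreal (real CARD('p))"
    by (intro add_left_mono mult_left_mono nn_integral_noise) auto
  also have "\<dots> = ennreal (a + (b * (4 * sqrt 2 ^ CARD('p)) + b * real CARD('p)))"
    using ab by (simp add: ennreal_plus[symmetric] ennreal_mult[symmetric] add.assoc del: ennreal_plus)
  also have "\<dots> \<le> ennreal (\<kappa> * V \<beta> + drift_const CARD('p) \<kappa>)"
  proof (rule ennreal_leI, rule add_mono)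
    have "a \<le> \<kappa>\<^sup>2 * V \<beta> / \<kappa>" unfolding a_def using mean_map_V \<kappa> by (intro divide_right_mono) auto
    then show "a \<le> \<kappa> * V \<beta>" using \<kappa> by (simp add: power2_eq_square)
    show "b * (4 * sqrt 2 ^ CARD('p)) + b * real CARD('p) \<le> drift_const CARD('p) \<kappa>"
      by (simp add: b_def drift_const_def add_divide_distrib)
  qed
  finally show ?thesis .
qed

text \<open>In whitened coordinates the common lower bound of \<open>gdens_shift_ge\<close>, centred
  at the fixed point; the additional factor 1/2 is the probability left by Markov's
  inequality.\<close>

definition minor :: "(real^'p) measure" where
  "minor = distr (density lborel (\<lambda>u. ennreal (exp (- minor_radius CARD('p) \<kappa>) / (2 * sqrt (2 * pi) ^ CARD('p)) * exp (- (u \<bullet> u)))))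
     borel (\<lambda>u. B *v (u\<^sub>f + u))"

lemma sets_minor [simp]: "sets minor = sets borel" by (simp add: minor_def)

lemma nn_integral_minor:
  assumes [measurable]: "f \<in> borel_measurable borel"
  shows "(\<integral>\<^sup>+x. f x \<partial>minor) = ennreal (exp (- minor_radius CARD('p) \<kappa>) / (2 * sqrt (2 * pi) ^ CARD('p))) *
    (\<integral>\<^sup>+u. ennreal (exp (- (u \<bullet> u))) * f (B *v (u\<^sub>f + u)) \<partial>lborel)"
proof -
  let ?k = "exp (- minor_radius CARD('p) \<kappa>) / (2 * sqrt (2 * pi) ^ CARD('p))"
  have "(\<integral>\<^sup>+x. f x \<partial>minor) = (\<integral>\<^sup>+u. ennreal (?k * exp (- (u \<bullet> u))) * f (B *v (u\<^sub>f + u)) \<partial>lborel)"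
    unfolding minor_def by (subst nn_integral_distr) (auto simp: nn_integral_density)
  also have "\<dots> = (\<integral>\<^sup>+u. ennreal ?k * (ennreal (exp (- (u \<bullet> u))) * f (B *v (u\<^sub>f + u))) \<partial>lborel)"
    by (subst ennreal_mult) (auto simp: mult.assoc)
  finally show ?thesis by (subst (asm) nn_integral_cmult) auto
qed

lemma emeasure_minor: "ennreal (minor_mass CARD('p) \<kappa>) \<le> emeasure minor UNIV"
proof -
  have "emeasure minor UNIV = (\<integral>\<^sup>+x. 1 \<partial>minor)"
    using sets_eq_imp_space_eq[OF sets_minor] by simp
  also have "\<dots> = ennreal (exp (- minor_radius CARD('p) \<kappa>) / (2 * sqrt (2 * pi) ^ CARD('p))) * ennreal (sqrt pi ^ CARD('p))"
    using nn_integral_gaussian[where 'p='p and c=1] by (subst nn_integral_minor) auto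
  also have "\<dots> = ennreal (minor_mass CARD('p) \<kappa>)"
    by (subst ennreal_mult'[symmetric]) (auto simp: minor_mass_def real_sqrt_mult power_mult_distrib)
  finally show ?thesis by simp
qed

text \<open>Doubling the exponent in \<open>u\<close> absorbs the shift: the lower bound depends on
  \<open>b\<close> only through \<open>r\<close>, so it serves all centres in a ball.\<close>

lemma gdens_shift_ge:
  fixes u b :: "real^'p"
  assumes "(norm b)\<^sup>2 \<le> r"
  shows "exp (- r) / sqrt (2 * pi) ^ CARD('p) * exp (- (u \<bullet> u)) \<le> gdens (u - b)"
proof -
  have "(norm (u + (- b)))\<^sup>2 \<le> (norm u)\<^sup>2 / (1/2) + (norm (- b))\<^sup>2 / (1 - 1/2)" by (rule norm_add_sq_le) auto
  then have "(u - b) \<bullet> (u - b) / 2 \<le> u \<bullet> u + r"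
    using assms by (simp add: power2_norm_eq_inner)
  then have "exp (- (r + u \<bullet> u)) \<le> exp (- ((u - b) \<bullet> (u - b)) / 2)" by simp
  then show ?thesis
    by (simp add: gdens_def two_pi_powr mult_exp_exp divide_right_mono)
qed

text \<open>On the event that the whitened conditional mean is within the radius of the fixed point,
  every Gaussian density dominates one fixed profile; outside this event nothing is used.\<close>

lemma minorization_K:
  assumes V: "V \<beta> \<le> 4 * drift_const CARD('p) \<kappa> / (1 - \<kappa>)" and [measurable]: "f \<in> borel_measurable borel"
  shows "(\<integral>\<^sup>+x. f x \<partial>minor) \<le> (\<integral>\<^sup>+x. f x \<partial>K \<beta>)"
proof -
  interpret L: prob_space "latent \<beta>" by (rule prob_space_latent)
  define b where "b z = mean_map \<beta> + noise \<beta> z - u\<^sub>f" for z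
  have [measurable]: "b \<in> borel_measurable zsp" unfolding b_def by measurable
  let ?r = "minor_radius CARD('p) \<kappa>"
  define E where "E = {z \<in> space (latent \<beta>). ?r < (norm (b z))\<^sup>2}"
  have [measurable]: "E \<in> sets (latent \<beta>)" unfolding E_def by measurable
  have "(\<integral>\<^sup>+z. ennreal ((norm (b z))\<^sup>2) \<partial>latent \<beta>) \<le> ennreal (?r / 2)"
  proof -
    have pt: "(norm (b z))\<^sup>2 \<le> 2 * V \<beta> + 2 * (norm (noise \<beta> z))\<^sup>2" for z
    proof -
      have "(norm ((mean_map \<beta> - u\<^sub>f) + noise \<beta> z))\<^sup>2 \<le> (norm (mean_map \<beta> - u\<^sub>f))\<^sup>2 / (1/2) + (norm (noise \<beta> z))\<^sup>2 / (1 - 1/2)"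
        by (rule norm_add_sq_le) auto
      moreover have "(norm (mean_map \<beta> - u\<^sub>f))\<^sup>2 \<le> V \<beta>"
      proof -
        have "\<kappa>\<^sup>2 * V \<beta> \<le> 1 * V \<beta>" using \<kappa> V_nonneg by (intro mult_right_mono) (auto simp: power_le_one)
        with mean_map_V[of \<beta>] show ?thesis by simp
      qed
      ultimately show ?thesis by (simp add: b_def algebra_simps)
    qed
    have "(\<integral>\<^sup>+z. ennreal ((norm (b z))\<^sup>2) \<partial>latent \<beta>) \<le> (\<integral>\<^sup>+z. ennreal (2 * V \<beta>) + ennreal 2 * ennreal ((norm (noise \<beta> z))\<^sup>2) \<partial>latent \<beta>)"
      using pt V_nonneg by (intro nn_integral_mono)
        (simp add: ennreal_plus[symmetric] ennreal_mult[symmetric] ennreal_leI del: ennreal_plus ennreal_numeral)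
    also have "\<dots> = ennreal (2 * V \<beta>) + ennreal 2 * (\<integral>\<^sup>+z. ennreal ((norm (noise \<beta> z))\<^sup>2) \<partial>latent \<beta>)"
      by (subst nn_integral_add) (auto simp: nn_integral_cmult L.emeasure_space_1)
    also have "\<dots> \<le> ennreal (2 * V \<beta>) + ennreal 2 * ennreal (real CARD('p))"
      by (intro add_left_mono mult_left_mono nn_integral_noise) auto
    also have "\<dots> = ennreal (2 * V \<beta> + 2 * real CARD('p))"
      using V_nonneg by (simp add: ennreal_plus[symmetric] ennreal_mult[symmetric] del: ennreal_plus ennreal_numeral)
    also have "\<dots> \<le> ennreal (?r / 2)" using V by (intro ennreal_leI) (simp add: minor_radius_def)
    finally show ?thesis .
  qed
  moreover have "ennreal ?r * emeasure (latent \<beta>) E \<le> (\<integral>\<^sup>+z. ennreal ((norm (b z))\<^sup>2) \<partial>latent \<beta>)"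
  proof -
    have "ennreal ?r * emeasure (latent \<beta>) E = (\<integral>\<^sup>+z. ennreal ?r * indicator E z \<partial>latent \<beta>)"
      by (rule nn_integral_cmult_indicator[symmetric]) fact
    also have "\<dots> \<le> (\<integral>\<^sup>+z. ennreal ((norm (b z))\<^sup>2) \<partial>latent \<beta>)"
      by (auto intro!: nn_integral_mono ennreal_leI simp: E_def split: split_indicator)
    finally show ?thesis .
  qed
  ultimately have "ennreal ?r * ennreal (L.prob E) \<le> ennreal (?r / 2)"
    by (simp add: L.emeasure_eq_measure)
  then have "?r * L.prob E \<le> ?r / 2"
    using minor_radius_pos by (simp add: ennreal_mult[symmetric])
  then have "L.prob E \<le> 1 / 2" using minor_radius_pos by (simp add: field_simps)
  then have half: "ennreal (1/2) \<le> emeasure (latent \<beta>) (space (latent \<beta>) - E)"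
    using L.prob_compl[OF \<open>E \<in> sets (latent \<beta>)\<close>]
    unfolding L.emeasure_eq_measure by (intro ennreal_leI) simp
  define F where "F = (\<integral>\<^sup>+u. ennreal (exp (- ?r) / sqrt (2 * pi) ^ CARD('p) * exp (- (u \<bullet> u))) * f (B *v (u\<^sub>f + u)) \<partial>lborel)"
  have "(\<integral>\<^sup>+x. f x \<partial>minor) = ennreal (1/2) * F"
  proof -
    let ?k = "exp (- ?r) / sqrt (2 * pi) ^ CARD('p)"
    let ?G = "\<integral>\<^sup>+u. ennreal (exp (- (u \<bullet> u))) * f (B *v (u\<^sub>f + u)) \<partial>lborel"
    have "F = (\<integral>\<^sup>+u. ennreal ?k * (ennreal (exp (- (u \<bullet> u))) * f (B *v (u\<^sub>f + u))) \<partial>lborel)"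
      unfolding F_def by (subst ennreal_mult) (auto simp: mult.assoc)
    then have "F = ennreal ?k * ?G" by (subst (asm) nn_integral_cmult) auto
    moreover have "(\<integral>\<^sup>+x. f x \<partial>minor) = ennreal (1/2 * ?k) * ?G"
      by (subst nn_integral_minor) auto
    moreover have "ennreal (1/2 * ?k) = ennreal (1/2) * ennreal ?k" by (rule ennreal_mult) auto
    ultimately show ?thesis by (simp only: mult.assoc)
  qed
  also have "\<dots> \<le> emeasure (latent \<beta>) (space (latent \<beta>) - E) * F"
    using half by (rule mult_right_mono) simp
  also have "\<dots> = (\<integral>\<^sup>+z. F * indicator (space (latent \<beta>) - E) z \<partial>latent \<beta>)"
    using \<open>E \<in> sets (latent \<beta>)\<close>
    by (subst nn_integral_cmult_indicator) (auto simp del: sets_latent simp: mult.commute)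
  also have "\<dots> \<le> (\<integral>\<^sup>+z. \<integral>\<^sup>+u. ennreal (gdens u) * f (B *v (mean_map \<beta> + noise \<beta> z + u)) \<partial>lborel \<partial>latent \<beta>)"
  proof (rule nn_integral_mono)
    fix z assume z: "z \<in> space (latent \<beta>)"
    show "F * indicator (space (latent \<beta>) - E) z \<le> (\<integral>\<^sup>+u. ennreal (gdens u) * f (B *v (mean_map \<beta> + noise \<beta> z + u)) \<partial>lborel)"
    proof (cases "z \<in> E")
      case False
      then have bz: "(norm (b z))\<^sup>2 \<le> ?r" using z by (simp add: E_def)
      have "F \<le> (\<integral>\<^sup>+u. ennreal (gdens (u - b z)) * f (B *v (u\<^sub>f + u)) \<partial>lborel)"
        unfolding F_def using gdens_shift_ge[OF bz]
        by (intro nn_integral_mono mult_right_mono ennreal_leI) auto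
      \<comment> \<open>Translation by \<open>b z\<close> moves the centre from the fixed point to
        the actual conditional mean.\<close>
      also have "\<dots> = (\<integral>\<^sup>+u. ennreal (gdens (b z + u - b z)) * f (B *v (u\<^sub>f + (b z + u))) \<partial>lborel)"
        by (subst lborel_distr_plus[of "b z", symmetric], subst nn_integral_distr) auto
      also have "\<dots> = (\<integral>\<^sup>+u. ennreal (gdens u) * f (B *v (mean_map \<beta> + noise \<beta> z + u)) \<partial>lborel)"
        by (simp add: b_def add.assoc)
      finally show ?thesis using False z by simp
    qed simp
  qed
  also have "\<dots> = (\<integral>\<^sup>+x. f x \<partial>K \<beta>)" by (simp add: nn_integral_K_white)
  finally show ?thesis .
qed

sublocale harris_chain K V \<kappa> "drift_const CARD('p) \<kappa>" "minor_mass CARD('p) \<kappa>" minor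
  by unfold_locales
     (use V_nonneg \<kappa> drift_const_pos minor_mass drift_K emeasure_minor minorization_K in auto)

text \<open>Needed to average the Harris bound over the invariant law. \<open>V\<close> grows
  quadratically, so half of the Gaussian exponent of the posterior absorbs it.\<close>

lemma integrable_post_V: "integrable post V"
proof (rule integrableI_bounded)
  obtain k where k: "0 < k" "\<And>x. norm (C *v x) \<le> norm x * k"
    using bounded_linear.pos_bounded[OF matrix_vector_mul_bounded_linear[of C]] by blast
  define a where "a = 4 * k\<^sup>2 / c\<^sub>0 + 2 * (norm u\<^sub>f)\<^sup>2"
  have a: "0 \<le> a" using c0 by (simp add: a_def)
  have pt: "upost \<beta> * V \<beta> \<le> a * exp (- (c\<^sub>0 / 2 * (\<beta> \<bullet> \<beta>)))" for \<beta>
  proof -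
    let ?e = "exp (c\<^sub>0 / 2 * (\<beta> \<bullet> \<beta>))"
    have e: "c\<^sub>0 / 2 * (\<beta> \<bullet> \<beta>) \<le> ?e" "1 \<le> ?e"
      using exp_ge_add_one_self[of "c\<^sub>0 / 2 * (\<beta> \<bullet> \<beta>)"] c0 by (linarith, simp)
    have "V \<beta> \<le> (norm (C *v \<beta>))\<^sup>2 / (1/2) + (norm (- u\<^sub>f))\<^sup>2 / (1 - 1/2)"
      unfolding V_def using norm_add_sq_le[of "1/2" "C *v \<beta>" "- u\<^sub>f"] by simp
    also have "\<dots> \<le> 2 * (norm \<beta> * k)\<^sup>2 + 2 * (norm u\<^sub>f)\<^sup>2"
      using power_mono[OF k(2)[of \<beta>], of 2] by simp
    also have "\<dots> = 4 * k\<^sup>2 / c\<^sub>0 * (c\<^sub>0 / 2 * (\<beta> \<bullet> \<beta>)) + 2 * (norm u\<^sub>f)\<^sup>2 * 1"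
      using c0 by (simp add: power_mult_distrib power2_norm_eq_inner field_simps)
    also have "\<dots> \<le> 4 * k\<^sup>2 / c\<^sub>0 * ?e + 2 * (norm u\<^sub>f)\<^sup>2 * ?e"
      using e c0 by (intro add_mono mult_left_mono) auto
    finally have "V \<beta> \<le> a * ?e" by (simp add: a_def algebra_simps)
    then have "upost \<beta> * V \<beta> \<le> exp (- (c\<^sub>0 * (\<beta> \<bullet> \<beta>))) * (a * ?e)"
      using tail[of \<beta>] V_nonneg by (intro mult_mono) (auto simp: upost_def)
    also have "\<dots> = a * exp (- (c\<^sub>0 / 2 * (\<beta> \<bullet> \<beta>)))"
      by (simp add: mult_exp_exp mult_ac)
    finally show ?thesis .
  qed
  have "(\<integral>\<^sup>+\<beta>. ennreal (norm (V \<beta>)) \<partial>post) = ennreal (1 / evidence) * (\<integral>\<^sup>+\<beta>. ennreal (upost \<beta> * V \<beta>) \<partial>lborel)"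
    using upost_pos V_nonneg by (simp add: nn_integral_post ennreal_mult'[symmetric] less_imp_le)
  also have "\<dots> \<le> ennreal (1 / evidence) * (\<integral>\<^sup>+\<beta>. ennreal a * ennreal (exp (- (c\<^sub>0 / 2 * (\<beta> \<bullet> \<beta>)))) \<partial>leb)"
    using pt a by (intro mult_left_mono nn_integral_mono) (auto simp: ennreal_mult'[symmetric] intro: ennreal_leI)
  also have "\<dots> = ennreal (1 / evidence) * (ennreal a * ennreal (sqrt (pi / (c\<^sub>0 / 2)) ^ CARD('p)))"
    using c0 by (subst nn_integral_cmult, simp, subst nn_integral_gaussian) auto
  also have "\<dots> < \<infinity>" by (simp add: ennreal_mult_less_top)
  finally show "(\<integral>\<^sup>+\<beta>. ennreal (norm (V \<beta>)) \<partial>post) < \<infinity>" .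
qed (simp add: measurable_cong_sets[OF sets_post refl])

lemma ac_rate_le: "ac_rate xs ys n v Q \<le> ac_rate_bound CARD('p) \<kappa>"
  using geo_rate_le[OF prob_space_post sets_post post_invariant integrable_post_V]
  by (simp add: ac_rate_def ac_rate_bound_def iter_eq)

lemma posterior_proper: "posterior_proper xs ys n v Q"
  using integrable_upost upost_pos
  by (simp add: posterior_proper_def integrable_iff_bounded upost_def less_imp_le)

end

lemma ac_rate_bound_less_1:
  assumes "0 < \<kappa>" "\<kappa> < 1"
  shows "ac_rate_bound p \<kappa> < 1"
  unfolding ac_rate_bound_def using assms by (intro harris_rate) (auto simp: minor_mass_def)

section \<open>Informative observations\<close>

text \<open>In both cases \<open>ysign y\<close> times the covariate lies in the orthant
  \<open>s\<close>; a negative response flips the covariate.\<close>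

definition informative :: "('p::finite \<Rightarrow> bool) \<Rightarrow> (real^'p) \<times> bool \<Rightarrow> bool" where
  "informative s = (\<lambda>(x, y). (y \<and> x \<in> open_orthant s) \<or> (\<not> y \<and> - x \<in> open_orthant s))"

text \<open>All terms of the inner product are nonpositive. Zero coordinates of \<beta> contribute
  nothing, so assigning them to the positive side is harmless.\<close>

lemma inner_orthant_nonpos:
  assumes "x \<in> open_orthant (\<lambda>i. \<beta> $ i \<le> 0)"
  shows "x \<bullet> \<beta> \<le> 0"
  unfolding inner_vec_def
proof (rule sum_nonpos)
  fix i :: 'a
  from assms have "if \<beta> $ i \<le> 0 then 0 < x $ i else x $ i < 0" by (simp add: open_orthant_def)
  then show "x $ i \<bullet> \<beta> $ i \<le> 0"
    by (cases "\<beta> $ i \<le> 0") (simp_all add: mult_nonneg_nonpos mult_nonpos_nonneg)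
qed

lemma informative_nonpos:
  assumes "informative (\<lambda>i. \<beta> $ i \<le> 0) (x, y)"
  shows "ysign y * (x \<bullet> \<beta>) \<le> 0"
  using assms inner_orthant_nonpos[of x \<beta>] inner_orthant_nonpos[of "- x" \<beta>]
  by (auto simp: informative_def ysign_def)

text \<open>Whatever \<open>\<beta>\<close> is, the observations informative for the orthant opposite to it see a truncated normal
  law cut off beyond its mode. These have variance at most \<open>1/2\<close> and likelihood with Gaussian decay.\<close>
lemma ac_rate_le_informative:
  fixes xs :: "nat \<Rightarrow> real^'p" and Q :: "real^'p^'p"
  assumes Q: "pos_def Q \<or> Q = 0" and \<delta>: "0 < \<delta>" "\<delta> < 1" and c: "0 < c"
    and lower: "\<And>s a. c * (norm a)\<^sup>2 \<le> (\<Sum>i | i < n \<and> informative s (xs i, ys i). (xs i \<bullet> a)\<^sup>2)"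
    and ratio: "\<And>s a. 2 * \<delta> * (a \<bullet> (Sigma_mat xs n Q *v a)) \<le> (\<Sum>i | i < n \<and> informative s (xs i, ys i). (xs i \<bullet> a)\<^sup>2)"
  shows "posterior_proper xs ys n v Q \<and> ac_rate xs ys n v Q \<le> ac_rate_bound CARD('p) (1 - \<delta>)"
proof -
  have Q_sym: "Q $ i $ j = Q $ j $ i" for i j using Q by (auto simp: pos_def_def)
  have Q_psd: "0 \<le> a \<bullet> (Q *v a)" for a
    using Q by (cases "a = 0") (auto simp: pos_def_def less_imp_le)
  let ?I = "\<lambda>s. {i. i < n \<and> informative s (xs i, ys i)}"
  have sub: "(\<Sum>i\<in>?I s. (xs i \<bullet> a)\<^sup>2) \<le> (\<Sum>i<n. (xs i \<bullet> a)\<^sup>2)" for s a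
    by (rule sum_mono2) auto
  have le_S: "(\<Sum>i<n. (xs i \<bullet> a)\<^sup>2) \<le> a \<bullet> (Sigma_mat xs n Q *v a)" for a
    using Q_psd[of a] by (simp add: inner_Sigma_mat power2_eq_square)
  have pd: "pos_def (Sigma_mat xs n Q)"
    unfolding pos_def_def
  proof (intro conjI allI impI)
    show "Sigma_mat xs n Q $ i $ j = Sigma_mat xs n Q $ j $ i" for i j
      by (simp add: Sigma_mat_def Q_sym[of i j] mult.commute)
    fix a :: "real^'p" assume "a \<noteq> 0"
    then have "0 < c * (norm a)\<^sup>2" using c by simp
    with lower[of a "\<lambda>_. True"] sub[of a "\<lambda>_. True"] le_S[of a]
    show "0 < a \<bullet> (Sigma_mat xs n Q *v a)" by linarith
  qed
  then obtain B where "whitened (Sigma_mat xs n Q) B" using pos_def_whitening by blast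
  then interpret whitened "Sigma_mat xs n Q" B .
  interpret albert_chib xs n Q B ys v "1 - \<delta>" "c / 2"
  proof
    fix \<beta> a :: "real^'p"
    let ?s = "\<lambda>i. \<beta> $ i \<le> 0"
    have "(\<Sum>i<n. tn_var (ysign (ys i) * (xs i \<bullet> \<beta>)) * (xs i \<bullet> a)\<^sup>2)
        \<le> (\<Sum>i<n. (xs i \<bullet> a)\<^sup>2 - (if informative ?s (xs i, ys i) then (xs i \<bullet> a)\<^sup>2 / 2 else 0))"
    proof (rule sum_mono)
      fix i
      show "tn_var (ysign (ys i) * (xs i \<bullet> \<beta>)) * (xs i \<bullet> a)\<^sup>2
        \<le> (xs i \<bullet> a)\<^sup>2 - (if informative ?s (xs i, ys i) then (xs i \<bullet> a)\<^sup>2 / 2 else 0)"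
      proof (cases "informative ?s (xs i, ys i)")
        case True
        from tn_var_le_half[OF informative_nonpos[OF True]]
        have "tn_var (ysign (ys i) * (xs i \<bullet> \<beta>)) * (xs i \<bullet> a)\<^sup>2 \<le> 1 / 2 * (xs i \<bullet> a)\<^sup>2"
          by (intro mult_right_mono) auto
        with True show ?thesis by simp
      next
        case False
        have "tn_var (ysign (ys i) * (xs i \<bullet> \<beta>)) * (xs i \<bullet> a)\<^sup>2 \<le> 1 * (xs i \<bullet> a)\<^sup>2"
          by (intro mult_right_mono tn_var_le_1) auto
        with False show ?thesis by simp
      qed
    qed
    also have "\<dots> = (\<Sum>i<n. (xs i \<bullet> a)\<^sup>2) - (\<Sum>i\<in>?I ?s. (xs i \<bullet> a)\<^sup>2) / 2"
      by (simp add: sum_subtractf sum_divide_distrib sum.inter_filter[symmetric])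
    \<comment> \<open>Each informative observation saves half of its square, which turns the share
      \<open>2 * \<delta>\<close> into \<delta>.\<close>
    also have "\<dots> \<le> (1 - \<delta>) * (a \<bullet> (Sigma_mat xs n Q *v a))"
      using le_S[of a] ratio[of a ?s] by (simp add: algebra_simps)
    finally show "(\<Sum>i<n. tn_var (ysign (ys i) * (xs i \<bullet> \<beta>)) * (xs i \<bullet> a)\<^sup>2) \<le> (1 - \<delta>) * (a \<bullet> (Sigma_mat xs n Q *v a))" .
  next
    fix \<beta> :: "real^'p"
    let ?s = "\<lambda>i. \<beta> $ i \<le> 0"
    have "likelihood xs ys n \<beta> = (\<Prod>i<n. Phi (ysign (ys i) * (xs i \<bullet> \<beta>)))"
      unfolding likelihood_def by (intro prod.cong) (auto simp: ysign_def Phi_minus)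
    also have "\<dots> \<le> (\<Prod>i<n. if informative ?s (xs i, ys i) then exp (- (xs i \<bullet> \<beta>)\<^sup>2 / 2) else 1)"
    proof (rule prod_mono, intro conjI)
      fix i
      show "Phi (ysign (ys i) * (xs i \<bullet> \<beta>)) \<le> (if informative ?s (xs i, ys i) then exp (- (xs i \<bullet> \<beta>)\<^sup>2 / 2) else 1)"
        using Phi_less_1 Phi_le_exp[OF informative_nonpos[of \<beta> "xs i" "ys i"]]
        by (auto simp: power_mult_distrib less_imp_le)
    qed (simp add: Phi_nonneg)
    also have "\<dots> = (\<Prod>i\<in>?I ?s. exp (- (xs i \<bullet> \<beta>)\<^sup>2 / 2))"
      by (simp add: prod.If_cases) (auto intro!: prod.cong simp: Int_def lessThan_def)
    also have "\<dots> = exp (- (\<Sum>i\<in>?I ?s. (xs i \<bullet> \<beta>)\<^sup>2) / 2)"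
      by (subst exp_sum[symmetric]) (auto simp: sum_negf sum_divide_distrib)
    also have "\<dots> \<le> exp (- (c / 2 * (\<beta> \<bullet> \<beta>)))"
      using lower[of \<beta> ?s] by (simp add: power2_norm_eq_inner)
    finally have "likelihood xs ys n \<beta> \<le> exp (- (c / 2 * (\<beta> \<bullet> \<beta>)))" .
    moreover have "prior_dens v Q \<beta> \<le> 1" using Q_psd[of "\<beta> - v"] by (simp add: prior_dens_def)
    moreover have "0 \<le> prior_dens v Q \<beta>" by (simp add: prior_dens_def)
    ultimately have "likelihood xs ys n \<beta> * prior_dens v Q \<beta> \<le> exp (- (c / 2 * (\<beta> \<bullet> \<beta>))) * 1"
      by (intro mult_mono) auto
    then show "likelihood xs ys n \<beta> * prior_dens v Q \<beta> \<le> exp (- (c / 2 * (\<beta> \<bullet> \<beta>)))" by simp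
  qed (use \<delta> c Q_sym Q_psd in auto)
  show ?thesis using posterior_proper ac_rate_le by blast
qed

section \<open>Laws of large numbers\<close>

context prob_space
begin

text \<open>Chebyshev with deviation 1 per term, the variance being bounded by the second moment
  \<open>q\<close>. The bound \<open>B\<close> secures integrability but does not enter the
  estimate, so the truncation level may grow with \<open>n\<close>.\<close>

lemma truncated_sum_deviation:
  fixes Z :: "nat \<Rightarrow> 'a \<Rightarrow> real"
  assumes indep: "indep_vars (\<lambda>_. borel) Z {..<n}" and bd: "\<And>i x. \<bar>Z i x\<bar> \<le> B"
    and mean: "\<And>i. i < n \<Longrightarrow> expectation (Z i) = \<mu>" and sq: "\<And>i. i < n \<Longrightarrow> expectation (\<lambda>x. (Z i x)\<^sup>2) = q"
    and n: "0 < n"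
  shows "prob {x \<in> space M. real n * (\<mu> + 1) \<le> (\<Sum>i<n. Z i x)} \<le> q / real n"
proof -
  have rv [measurable]: "i < n \<Longrightarrow> random_variable borel (Z i)" for i
    using indep by (auto simp: indep_vars_def)
  define D where "D i x = Z i x - \<mu>" for i x
  have rvD [measurable]: "i < n \<Longrightarrow> random_variable borel (D i)" for i unfolding D_def by measurable
  have bD: "\<bar>D i x\<bar> \<le> B + \<bar>\<mu>\<bar>" for i x using bd[of i x] by (simp add: D_def)
  have iZ: "integrable M (Z i)" if "i < n" for i
    using that bd by (intro integrable_const_bound[where B=B]) auto
  have iZ2: "integrable M (\<lambda>x. (Z i x)\<^sup>2)" if "i < n" for i
  proof (rule integrable_const_bound[where B="B\<^sup>2"])
    show "AE x in M. norm ((Z i x)\<^sup>2) \<le> B\<^sup>2"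
      using power_mono[OF bd[of i] abs_ge_zero, of _ 2] by (intro AE_I2) simp
  qed (use that in measurable)
  have iD: "integrable M (D i)" if "i < n" for i
    using that bD by (intro integrable_const_bound[where B="B + \<bar>\<mu>\<bar>"]) auto
  have iDD: "integrable M (\<lambda>x. D i x * D j x)" if "i < n" "j < n" for i j
  proof (rule integrable_const_bound[where B="(B + \<bar>\<mu>\<bar>) * (B + \<bar>\<mu>\<bar>)"])
    show "AE x in M. norm (D i x * D j x) \<le> (B + \<bar>\<mu>\<bar>) * (B + \<bar>\<mu>\<bar>)"
      using bD order_trans[OF abs_ge_zero bD] by (auto intro!: AE_I2 mult_mono simp: abs_mult)
  qed (use that in measurable)
  have ED: "expectation (D i) = 0" if "i < n" for i
    unfolding D_def[abs_def] using iZ[OF that] mean[OF that] by (simp add: prob_space)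
  have EDD: "expectation (\<lambda>x. D i x * D j x) = (if i = j then q - \<mu>\<^sup>2 else 0)" if ij: "i < n" "j < n" for i j
  proof (cases "i = j")
    case True
    have "expectation (\<lambda>x. D i x * D i x) = expectation (\<lambda>x. (Z i x)\<^sup>2 - 2 * \<mu> * Z i x + \<mu>\<^sup>2)"
      by (intro Bochner_Integration.integral_cong) (auto simp: D_def power2_eq_square algebra_simps)
    also have "\<dots> = q - \<mu>\<^sup>2"
      using iZ[OF ij(1)] iZ2[OF ij(1)] mean[OF ij(1)] sq[OF ij(1)] by (simp add: prob_space power2_eq_square)
    finally show ?thesis using True by simp
  next
    case False
    have "indep_vars (\<lambda>_. borel) D {..<n}"
      unfolding D_def by (rule indep_vars_compose2[OF indep]) measurable
    then have "indep_vars (\<lambda>_. borel) D {i, j}" by (rule indep_vars_subset) (use ij in auto)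
    then have "expectation (\<lambda>x. \<Prod>k\<in>{i, j}. D k x) = (\<Prod>k\<in>{i, j}. expectation (D k))"
      by (rule indep_vars_lebesgue_integral[rotated]) (use ij iD in auto)
    then show ?thesis using False ED ij by simp
  qed
  define S where "S x = (\<Sum>i<n. D i x)" for x
  have [measurable]: "random_variable borel S" unfolding S_def by measurable
  have S2: "(S x)\<^sup>2 = (\<Sum>i<n. \<Sum>j<n. D i x * D j x)" for x
    by (simp add: S_def power2_eq_square sum_product)
  have iS2: "integrable M (\<lambda>x. (S x)\<^sup>2)"
    unfolding S2 by (intro Bochner_Integration.integrable_sum iDD) auto
  have "expectation (\<lambda>x. (S x)\<^sup>2) = (\<Sum>i<n. \<Sum>j<n. expectation (\<lambda>x. D i x * D j x))"
    unfolding S2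
    by (subst Bochner_Integration.integral_sum; (intro Bochner_Integration.integrable_sum sum.cong refl)?)
       (auto simp: iDD Bochner_Integration.integral_sum)
  also have "\<dots> = (\<Sum>i<n. \<Sum>j<n. if i = j then q - \<mu>\<^sup>2 else 0)"
    by (intro sum.cong refl EDD) auto
  also have "\<dots> = real n * (q - \<mu>\<^sup>2)" by simp
  finally have ES2: "expectation (\<lambda>x. (S x)\<^sup>2) \<le> real n * q" by (simp add: mult_left_mono)
  have "prob {x \<in> space M. real n * (\<mu> + 1) \<le> (\<Sum>i<n. Z i x)} \<le> prob {x \<in> space M. (real n)\<^sup>2 \<le> (S x)\<^sup>2}"
  proof (rule finite_measure_mono)
    show "{x \<in> space M. real n * (\<mu> + 1) \<le> (\<Sum>i<n. Z i x)} \<subseteq> {x \<in> space M. (real n)\<^sup>2 \<le> (S x)\<^sup>2}"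
      by (auto simp: S_def D_def sum_subtractf algebra_simps intro!: power_mono)
  qed measurable
  also have "\<dots> \<le> expectation (\<lambda>x. (S x)\<^sup>2) / (real n)\<^sup>2"
    using n by (intro integral_Markov_inequality_measure[where A="{}"]) (auto intro: iS2)
  also have "\<dots> \<le> real n * q / (real n)\<^sup>2" using ES2 by (rule divide_right_mono) simp
  also have "\<dots> = q / real n" using n by (simp add: power2_eq_square)
  finally show ?thesis .
qed

end

text \<open>A geometric sum is at most twice its last term, and that term is below \<open>w\<close>.
  This makes the tail probabilities at dyadic levels summable under a first moment.\<close>

lemma dyadic_sum_below: "(\<Sum>k<N. 2 ^ k * of_bool (2 ^ k < w)) \<le> 2 * w" if "0 \<le> w" for w :: real
proof -
  \<comment> \<open>The second conjunct strengthens the induction: a new term \<open>2 ^ N\<close>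
    below \<open>w\<close> brings the sum to at most \<open>2 ^ Suc N - 1\<close>, hence below
    \<open>2 * w\<close>.\<close>
  have "(\<Sum>k<N. 2 ^ k * of_bool (2 ^ k < w)) \<le> 2 * w \<and> (\<Sum>k<N. 2 ^ k * of_bool (2 ^ k < w)) \<le> (2 :: real) ^ N - 1"
  proof (induction N)
    case (Suc N)
    define s :: real where "s = (\<Sum>k<N. 2 ^ k * of_bool (2 ^ k < w))"
    have s: "s \<le> 2 * w" "s \<le> 2 ^ N - 1" using Suc by (auto simp: s_def)
    have "s + 2 ^ N * of_bool (2 ^ N < w) \<le> 2 * w \<and> s + 2 ^ N * of_bool (2 ^ N < w) \<le> 2 ^ Suc N - 1"
    proof (cases "2 ^ N < w")
      case False
      have "s \<le> 2 ^ Suc N - 1" using s(2) by (rule order_trans) simp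
      with False s(1) show ?thesis by simp
    qed (use s in auto)
    then show ?case by (simp only: sum.lessThan_Suc s_def)
  qed (use that in simp)
  then show ?thesis by simp
qed

text \<open>The counterpart for truncated second moments: the series starts at a term of at most
  \<open>1 / w\<close> and sums to at most twice that.\<close>

lemma dyadic_sum_above: "w\<^sup>2 * (\<Sum>k<N. of_bool (w \<le> 2 ^ k) / 2 ^ k) \<le> 2 * w" if "0 \<le> w" for w :: real
proof (cases "w = 0")
  case False
  with that have w: "0 < w" by simp
  let ?T = "\<lambda>N. \<Sum>k<N. of_bool (w \<le> 2 ^ k) / 2 ^ k :: real"
  have zero: "?T N = 0" if "2 ^ N < w" for N
  proof -
    have "2 ^ k < w" if "k < N" for k
      using \<open>2 ^ N < w\<close> power_increasing[of k N "2::real"] that by linarith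
    then show ?thesis by (intro sum.neutral) (auto simp: not_le)
  qed
  \<comment> \<open>The extra summand is the whole remaining tail of the geometric series, so the
    left side stays constant once the terms are nonzero.\<close>
  have "?T N + 2 / 2 ^ N * of_bool (w \<le> 2 ^ N) \<le> 2 / w"
  proof (induction N)
    case 0
    then show ?case using w by (simp add: of_bool_def field_simps)
  next
    case (Suc N)
    show ?case
    proof (cases "w \<le> 2 ^ N")
      case True
      moreover have "(2::real) ^ N \<le> 2 ^ Suc N" by simp
      ultimately have "w \<le> 2 ^ Suc N" by linarith
      with True Suc show ?thesis by simp
    next
      case False
      then have "?T N = 0" by (intro zero) simp
      with False w show ?thesis by (auto simp: of_bool_def field_simps)
    qed
  qed
  then have "?T N \<le> 2 / w"
    by (smt (verit) divide_nonneg_nonneg mult_nonneg_nonneg of_bool_def zero_le_power)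
  then have "w\<^sup>2 * ?T N \<le> w\<^sup>2 * (2 / w)" by (intro mult_left_mono) auto
  then show ?thesis using w by (simp add: power2_eq_square)
qed simp

context prob_space
begin

text \<open>Etemadi's argument, truncating at \<open>2 ^ k\<close> for the sum of \<open>2 ^ k\<close> terms. Since only an upper bound is
  wanted, sums of intermediate length are estimated by the next power of two.\<close>
lemma eventually_sum_le:
  fixes W :: "nat \<Rightarrow> 'a \<Rightarrow> real"
  assumes indep: "indep_vars (\<lambda>_. borel) W UNIV"
    and distr: "\<And>i. distr M borel (W i) = distr M borel (W 0)"
    and nn: "\<And>i x. 0 \<le> W i x" and int: "integrable M (W 0)"
  shows "AE x in M. eventually (\<lambda>n. (\<Sum>i<n. W i x) \<le> 2 * real n * (expectation (W 0) + 1)) sequentially"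
proof -
  have rv [measurable]: "random_variable borel (W i)" for i
    using indep by (auto simp: indep_vars_def)
  let ?m = "expectation (W 0)"
  have transfer: "expectation (\<lambda>x. h (W i x)) = expectation (\<lambda>x. h (W 0 x))"
    if [measurable]: "h \<in> borel_measurable borel" for h :: "real \<Rightarrow> real" and i
  proof -
    have "expectation (\<lambda>x. h (W i x)) = (\<integral>y. h y \<partial>distr M borel (W i))" by (simp add: integral_distr)
    also have "\<dots> = expectation (\<lambda>x. h (W 0 x))" unfolding distr[of i] by (simp add: integral_distr)
    finally show ?thesis .
  qed
  \<comment> \<open>Truncation at level \<open>2 ^ k\<close> alters one of the first
    \<open>2 ^ k\<close> variables. A union bound and identical laws give the terms of
    \<open>dyadic_sum_below\<close>.\<close>
  define A where "A k = {x \<in> space M. \<exists>i<2^k. 2 ^ k < W i x}" for k :: nat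
  have A [measurable]: "A k \<in> events" for k unfolding A_def by measurable
  have pA: "prob (A k) \<le> expectation (\<lambda>x. 2 ^ k * of_bool (2 ^ k < W 0 x))" for k
  proof -
    have "prob (A k) \<le> prob (\<Union>i<2^k. {x \<in> space M. 2 ^ k < W i x})"
      by (rule finite_measure_mono) (auto simp: A_def)
    also have "\<dots> \<le> (\<Sum>i<2^k. prob {x \<in> space M. 2 ^ k < W i x})"
      by (rule finite_measure_subadditive_finite) auto
    also have "\<dots> = (\<Sum>i<(2::nat)^k. expectation (\<lambda>x. of_bool (2 ^ k < W 0 x)))"
    proof (rule sum.cong)
      fix i
      have "prob {x \<in> space M. 2 ^ k < W i x} = expectation (indicator {x \<in> space M. 2 ^ k < W i x})" by simp
      also have "\<dots> = expectation (\<lambda>x. of_bool (2 ^ k < W i x))"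
        by (rule Bochner_Integration.integral_cong) (auto simp: indicator_def)
      also have "\<dots> = expectation (\<lambda>x. of_bool (2 ^ k < W 0 x))"
        by (rule transfer) measurable
      finally show "prob {x \<in> space M. 2 ^ k < W i x} = expectation (\<lambda>x. of_bool (2 ^ k < W 0 x))" .
    qed simp
    finally show ?thesis by simp
  qed
  have sA: "summable (\<lambda>k. prob (A k))"
  proof (rule summableI_nonneg_bounded)
    fix N
    have i: "integrable M (\<lambda>x. 2 ^ k * of_bool (2 ^ k < W 0 x) :: real)" for k
      by (rule integrable_const_bound[where B="2 ^ k"]) (auto simp: of_bool_def)
    have "(\<Sum>k<N. prob (A k)) \<le> (\<Sum>k<N. expectation (\<lambda>x. 2 ^ k * of_bool (2 ^ k < W 0 x)))"
      by (intro sum_mono pA)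
    also have "\<dots> = expectation (\<lambda>x. \<Sum>k<N. 2 ^ k * of_bool (2 ^ k < W 0 x))"
      by (rule Bochner_Integration.integral_sum[symmetric]) (rule i)
    also have "\<dots> \<le> expectation (\<lambda>x. 2 * W 0 x)"
      by (intro integral_mono dyadic_sum_below Bochner_Integration.integrable_sum i nn) (use int in simp)
    finally show "(\<Sum>k<N. prob (A k)) \<le> 2 * ?m" by simp
  qed simp
  define Z where "Z k i x = (if W i x \<le> 2 ^ k then W i x else 0)" for k i x
  \<comment> \<open>A large deviation of the truncated sum. Chebyshev bounds its probability by a
    truncated second moment over \<open>2 ^ k\<close>, and \<open>dyadic_sum_above\<close> sums
    these to twice the mean.\<close>
  define B where "B k = {x \<in> space M. real (2 ^ k) * (?m + 1) \<le> (\<Sum>i<2^k. Z k i x)}" for k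
  have [measurable]: "random_variable borel (Z k i)" for k i unfolding Z_def by measurable
  have B [measurable]: "B k \<in> events" for k unfolding B_def by measurable
  have bZ: "\<bar>Z k i x\<bar> \<le> 2 ^ k" "0 \<le> Z k i x" for k i x using nn[of i x] by (auto simp: Z_def)
  have iZ2: "integrable M (\<lambda>x. (Z k 0 x)\<^sup>2)" for k
  proof (rule integrable_const_bound[where B="(2 ^ k)\<^sup>2"])
    show "AE x in M. norm ((Z k 0 x)\<^sup>2) \<le> (2 ^ k)\<^sup>2"
      using power_mono[OF bZ(1)[of k 0] abs_ge_zero, of _ 2] by (intro AE_I2) simp
  qed measurable
  have pB: "prob (B k) \<le> expectation (\<lambda>x. (Z k 0 x)\<^sup>2) / 2 ^ k" for k
  proof -
    have "prob (B k) \<le> prob {x \<in> space M. real (2 ^ k) * (expectation (Z k 0) + 1) \<le> (\<Sum>i<2^k. Z k i x)}"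
    proof (rule finite_measure_mono)
      have "expectation (Z k 0) \<le> ?m"
      proof (rule integral_mono)
        show "integrable M (Z k 0)"
          using bZ by (intro integrable_const_bound[where B="2 ^ k"]) auto
      qed (use nn in \<open>auto simp: Z_def int\<close>)
      then have le: "real (2 ^ k) * (expectation (Z k 0) + 1) \<le> real (2 ^ k) * (?m + 1)"
        by (intro mult_left_mono) auto
      show "B k \<subseteq> {x \<in> space M. real (2 ^ k) * (expectation (Z k 0) + 1) \<le> (\<Sum>i<2^k. Z k i x)}"
        unfolding B_def by (auto simp del: of_nat_power intro: order_trans[OF le])
    qed measurable
    also have "\<dots> \<le> expectation (\<lambda>x. (Z k 0 x)\<^sup>2) / real (2 ^ k)"
    proof (rule truncated_sum_deviation[where B="2 ^ k"])
      have "indep_vars (\<lambda>_. borel) (Z k) UNIV"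
        unfolding Z_def by (rule indep_vars_compose2[OF indep]) measurable
      then show "indep_vars (\<lambda>_. borel) (Z k) {..<2 ^ k}" by (rule indep_vars_subset) simp
      show "expectation (Z k i) = expectation (Z k 0)" for i
        unfolding Z_def by (rule transfer) measurable
      show "expectation (\<lambda>x. (Z k i x)\<^sup>2) = expectation (\<lambda>x. (Z k 0 x)\<^sup>2)" for i
        unfolding Z_def by (rule transfer) measurable
    qed (use bZ in auto)
    finally show ?thesis by simp
  qed
  have sB: "summable (\<lambda>k. prob (B k))"
  proof (rule summableI_nonneg_bounded)
    fix N
    have "(\<Sum>k<N. prob (B k)) \<le> (\<Sum>k<N. expectation (\<lambda>x. (Z k 0 x)\<^sup>2 / 2 ^ k))"
      using pB by (intro sum_mono) simp
    also have "\<dots> = expectation (\<lambda>x. \<Sum>k<N. (Z k 0 x)\<^sup>2 / 2 ^ k)"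
      by (rule Bochner_Integration.integral_sum[symmetric]) (use iZ2 in simp)
    also have "\<dots> = expectation (\<lambda>x. (W 0 x)\<^sup>2 * (\<Sum>k<N. of_bool (W 0 x \<le> 2 ^ k) / 2 ^ k))"
      by (intro Bochner_Integration.integral_cong) (auto simp: Z_def sum_distrib_left of_bool_def intro!: sum.cong)
    also have "\<dots> \<le> expectation (\<lambda>x. 2 * W 0 x)"
    proof (rule integral_mono)
      have "integrable M (\<lambda>x. \<Sum>k<N. (Z k 0 x)\<^sup>2 / 2 ^ k)"
        using iZ2 by (intro Bochner_Integration.integrable_sum) simp
      also have "(\<lambda>x. \<Sum>k<N. (Z k 0 x)\<^sup>2 / 2 ^ k) = (\<lambda>x. (W 0 x)\<^sup>2 * (\<Sum>k<N. of_bool (W 0 x \<le> 2 ^ k) / 2 ^ k))"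
        by (auto simp: Z_def sum_distrib_left of_bool_def fun_eq_iff intro!: sum.cong)
      finally show "integrable M (\<lambda>x. (W 0 x)\<^sup>2 * (\<Sum>k<N. of_bool (W 0 x \<le> 2 ^ k) / 2 ^ k))" .
    qed (use int nn in \<open>auto intro: dyadic_sum_above\<close>)
    finally show "(\<Sum>k<N. prob (B k)) \<le> 2 * ?m" by simp
  qed simp
  have m0: "0 \<le> ?m" using nn by (intro integral_nonneg_AE) auto
  have "AE x in M. eventually (\<lambda>k. x \<in> space M - A k) sequentially"
    by (rule borel_cantelli_AE1[OF A _ sA]) (simp add: emeasure_eq_measure)
  moreover have "AE x in M. eventually (\<lambda>k. x \<in> space M - B k) sequentially"
    by (rule borel_cantelli_AE1[OF B _ sB]) (simp add: emeasure_eq_measure)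
  ultimately show ?thesis
  proof eventually_elim
    fix x assume "eventually (\<lambda>k. x \<in> space M - A k) sequentially" "eventually (\<lambda>k. x \<in> space M - B k) sequentially"
    then have "eventually (\<lambda>k. (\<Sum>i<2^k. W i x) \<le> 2 ^ k * (?m + 1)) sequentially"
    proof eventually_elim
      fix k assume x: "x \<in> space M - A k" "x \<in> space M - B k"
      have "W i x = Z k i x" if "i < 2 ^ k" for i
      proof -
        have "\<not> 2 ^ k < W i x" using x(1) that by (auto simp: A_def)
        then show ?thesis by (simp add: Z_def)
      qed
      then have "(\<Sum>i<2^k. W i x) = (\<Sum>i<2^k. Z k i x)" by simp
      also have "\<dots> \<le> 2 ^ k * (?m + 1)" using x by (simp add: B_def not_le less_imp_le)
      finally show "(\<Sum>i<2^k. W i x) \<le> 2 ^ k * (?m + 1)" .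
    qed
    then obtain K where K: "\<And>k. K \<le> k \<Longrightarrow> (\<Sum>i<2^k. W i x) \<le> 2 ^ k * (?m + 1)"
      by (auto simp: eventually_sequentially)
    show "eventually (\<lambda>n. (\<Sum>i<n. W i x) \<le> 2 * real n * (?m + 1)) sequentially"
      unfolding eventually_sequentially
    proof (intro exI allI impI)
      fix n :: nat assume n: "2 ^ K \<le> n"
      then have n0: "0 < n" using zero_less_power[of "2::nat" K] by linarith
      \<comment> \<open>Nonnegativity allows passing to the next power of two, which is at most
        \<open>2 * n\<close>; this is the factor 2 of the conclusion.\<close>
      obtain k where k: "2 ^ k \<le> n" "n < 2 ^ (k + 1)" using ex_power_ivl1[of 2 n] n0 by auto
      have "K \<le> k + 1"
      proof (rule ccontr)
        assume "\<not> K \<le> k + 1"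
        then have "(2::nat) ^ (k + 1) \<le> 2 ^ K" by (intro power_increasing) auto
        with k n show False by simp
      qed
      have "(\<Sum>i<n. W i x) \<le> (\<Sum>i<2^(k+1). W i x)"
        using k nn by (intro sum_mono2) auto
      also have "\<dots> \<le> 2 ^ (k + 1) * (?m + 1)" by (rule K) fact
      also have "\<dots> \<le> 2 * real n * (?m + 1)"
      proof (rule mult_right_mono)
        have "real (2 ^ k) \<le> real n" using k(1) by (rule of_nat_mono)
        then show "2 ^ (k + 1) \<le> 2 * real n" by simp
      qed (use m0 in simp)
      finally show "(\<Sum>i<n. W i x) \<le> 2 * real n * (?m + 1)" .
    qed
  qed
qed

text \<open>Hoeffding's inequality gives a geometric bound in \<open>n\<close>, so Borel-Cantelli
  applies directly.\<close>

lemma eventually_mean_deviation_less: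
  fixes Z :: "nat \<Rightarrow> 'a \<Rightarrow> real"
  assumes indep: "indep_vars (\<lambda>_. borel) Z UNIV"
    and distr: "\<And>i. distr M borel (Z i) = distr M borel (Z 0)"
    and bd: "\<And>i x. \<bar>Z i x\<bar> \<le> 1" and \<epsilon>: "0 < \<epsilon>"
  shows "AE x in M. eventually (\<lambda>n. \<bar>(\<Sum>i<n. Z i x) - real n * expectation (Z 0)\<bar> \<le> real n * \<epsilon>) sequentially"
proof -
  have rv [measurable]: "random_variable borel (Z i)" for i
    using indep by (auto simp: indep_vars_def)
  let ?m = "expectation (Z 0)"
  define A where "A n = {x \<in> space M. real n * \<epsilon> < \<bar>(\<Sum>i<n. Z i x) - real n * ?m\<bar>}" for n
  have A [measurable]: "A n \<in> events" for n unfolding A_def by measurable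
  have p: "prob (A n) \<le> 2 * exp (- (\<epsilon>\<^sup>2 / 2)) ^ n" for n
  proof (cases "n = 0")
    case False
    interpret H: Hoeffding_ineq_iid M "{..<n}" Z "Z 0" "-1" 1 ?m
    proof unfold_locales
      show "indep_vars (\<lambda>_. borel) Z {..<n}" by (rule indep_vars_subset[OF indep]) simp
      show "AE x in M. Z 0 x \<in> {-1..1}" using bd[of 0] by (auto simp: abs_le_iff minus_le_iff)
    qed (use distr in auto)
    have "prob (A n) \<le> prob {x \<in> space M. real n * \<epsilon> \<le> \<bar>(\<Sum>i\<in>{..<n}. Z i x) - real (card {..<n}) * ?m\<bar>}"
      by (rule finite_measure_mono) (auto simp: A_def)
    also have "\<dots> \<le> 2 * exp (- 2 * (real n * \<epsilon>)\<^sup>2 / (real (card {..<n}) * (1 - (- 1))\<^sup>2))"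
      using \<epsilon> False by (intro H.Hoeffding_ineq_abs_ge) auto
    also have "- 2 * (real n * \<epsilon>)\<^sup>2 / (real (card {..<n}) * (1 - (- 1))\<^sup>2) = real n * (- (\<epsilon>\<^sup>2 / 2))"
      using False by (simp add: power2_eq_square field_simps)
    also have "exp (real n * (- (\<epsilon>\<^sup>2 / 2))) = exp (- (\<epsilon>\<^sup>2 / 2)) ^ n" by (rule exp_of_nat_mult)
    finally show ?thesis .
  qed (use prob_le_1 in \<open>auto intro: order_trans\<close>)
  have "summable (\<lambda>n. prob (A n))"
  proof (rule summable_comparison_test')
    show "summable (\<lambda>n. 2 * exp (- (\<epsilon>\<^sup>2 / 2)) ^ n)"
      using \<epsilon> by (intro summable_mult summable_geometric) auto
  qed (use p in auto)
  then have "AE x in M. eventually (\<lambda>n. x \<in> space M - A n) sequentially"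
    by (intro borel_cantelli_AE1[OF A]) (auto simp: emeasure_eq_measure)
  then show ?thesis
    by eventually_elim (auto simp: A_def not_less elim!: eventually_mono)
qed

end

section \<open>Random data\<close>

abbreviation obs :: "((real^'p) \<times> bool) measure" where "obs \<equiv> borel \<Otimes>\<^sub>M count_space UNIV"

lemma open_orthant_measurable [measurable]:
  "open_orthant s \<in> sets (borel :: (real^'p) measure)"
proof -
  have "{x :: real^'p. if s i then x $ i > 0 else x $ i < 0} \<in> sets borel" for i
  proof -
    have "{x :: real^'p. x $ i > 0} \<in> sets borel" "{x :: real^'p. x $ i < 0} \<in> sets borel" by measurable
    then show ?thesis by (cases "s i") simp_all
  qed
  then have "(\<Inter>i\<in>UNIV. {x :: real^'p. if s i then x $ i > 0 else x $ i < 0}) \<in> sets borel"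
    by (intro sets.finite_INT) auto
  also have "(\<Inter>i\<in>UNIV. {x :: real^'p. if s i then x $ i > 0 else x $ i < 0}) = open_orthant s"
    by (auto simp: open_orthant_def)
  finally show ?thesis .
qed

text \<open>The denominator makes the entries bounded, so that Hoeffding's inequality applies without further moments.\<close>
definition score :: "('p::finite \<Rightarrow> bool) \<Rightarrow> 'p \<Rightarrow> 'p \<Rightarrow> (real^'p) \<times> bool \<Rightarrow> real" where
  "score s j k w = (if informative s w then fst w $ j * fst w $ k / (1 + (norm (fst w))\<^sup>2) else 0)"

lemma informative_measurable [measurable]:
  "Measurable.pred obs (informative s)"
  unfolding informative_def split_beta by measurable

lemma score_measurable [measurable]:
  "score s j k \<in> borel_measurable obs"
proof -
  have [measurable]: "(\<lambda>w :: (real^'p) \<times> bool. fst w $ j) \<in> borel_measurable obs" for j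
    by (rule measurable_compose[OF measurable_fst]) measurable
  show ?thesis unfolding score_def[abs_def] by (rule measurable_If; measurable)
qed

lemma score_bounded: "\<bar>score s j k w\<bar> \<le> 1"
proof -
  let ?x = "fst w"
  have "\<bar>?x $ j * ?x $ k\<bar> \<le> norm ?x * norm ?x"
    unfolding abs_mult by (intro mult_mono component_le_norm_cart) auto
  also have "\<dots> \<le> 1 + (norm ?x)\<^sup>2" by (simp add: power2_eq_square)
  finally show ?thesis by (auto simp: score_def divide_le_eq_1_pos add_pos_nonneg)
qed

lemma inner_sq_expand: "(x \<bullet> a)\<^sup>2 = (\<Sum>j\<in>UNIV. \<Sum>k\<in>UNIV. a $ j * a $ k * (x $ j * x $ k))"
  for x a :: "real^'p"
  by (simp add: inner_vec_def power2_eq_square sum_product mult_ac)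

text \<open>Summing this form over the observations reduces a bound uniform in \<open>a\<close> to
  finitely many scalar averages.\<close>

lemma score_form:
  "(\<Sum>j\<in>UNIV. \<Sum>k\<in>UNIV. a $ j * a $ k * score s j k (x, y))
     = (if informative s (x, y) then (x \<bullet> a)\<^sup>2 / (1 + (norm x)\<^sup>2) else 0)"
  by (simp add: score_def inner_sq_expand sum_divide_distrib)

lemma quadratic_form_le:
  fixes Q :: "real^'p^'p"
  shows "a \<bullet> (Q *v a) \<le> onorm ((*v) Q) * (norm a)\<^sup>2"
proof -
  have "a \<bullet> (Q *v a) \<le> norm a * norm (Q *v a)" by (rule norm_cauchy_schwarz)
  also have "\<dots> \<le> norm a * (onorm ((*v) Q) * norm a)"
    by (intro mult_left_mono onorm matrix_vector_mul_bounded_linear) auto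
  finally show ?thesis by (simp add: power2_eq_square mult_ac)
qed

locale probit_data = prob_space M for M :: "'a measure" +
  fixes X :: "nat \<Rightarrow> 'a \<Rightarrow> real^'p" and Y :: "nat \<Rightarrow> 'a \<Rightarrow> bool" and G :: "real^'p \<Rightarrow> real"
  assumes X_measurable [measurable]: "\<And>i. X i \<in> borel_measurable M"
    and Y_measurable [measurable]: "\<And>i. Y i \<in> measurable M (count_space UNIV)"
    and indep: "indep_vars (\<lambda>_. obs) (\<lambda>i \<omega>. (X i \<omega>, Y i \<omega>)) UNIV"
    and distr: "\<And>i. distr M obs (\<lambda>\<omega>. (X i \<omega>, Y i \<omega>))
             = distr M obs (\<lambda>\<omega>. (X 0 \<omega>, Y 0 \<omega>))"
    and G_measurable [measurable]: "G \<in> borel_measurable borel"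
    and G: "\<And>x. 0 < G x \<and> G x < 1"
    and link: "\<And>i A. A \<in> sets borel \<Longrightarrow>
           measure M {\<omega> \<in> space M. X i \<omega> \<in> A \<and> Y i \<omega>} = (\<integral>\<omega>. indicator A (X i \<omega>) * G (X i \<omega>) \<partial>M)"
    and moments: "\<And>j k. integrable M (\<lambda>\<omega>. X 0 \<omega> $ j * X 0 \<omega> $ k)"
    and orthants: "\<And>s \<beta>. \<beta> \<noteq> 0 \<Longrightarrow>
           measure M {\<omega> \<in> space M. ((indicator (open_orthant s) (X 0 \<omega>) :: real)
              + indicator (open_orthant s) (- X 0 \<omega>)) * (X 0 \<omega> \<bullet> \<beta>) \<noteq> 0} > 0"
begin

abbreviation info_sum :: "'a \<Rightarrow> nat \<Rightarrow> ('p \<Rightarrow> bool) \<Rightarrow> real^'p \<Rightarrow> real" where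
  "info_sum \<omega> n s a \<equiv> (\<Sum>i | i < n \<and> informative s (X i \<omega>, Y i \<omega>). (X i \<omega> \<bullet> a)\<^sup>2)"

text \<open>The two probabilities are the means of the indicator of \<open>A\<close> times
  \<open>G\<close> and times \<open>1 - G\<close>. Both weights are strictly positive, so neither
  response can be almost surely absent on a set of positive probability.\<close>

lemma prob_success_pos:
  assumes [measurable]: "A \<in> sets borel" and "0 < prob {\<omega> \<in> space M. X 0 \<omega> \<in> A}"
  shows "0 < prob {\<omega> \<in> space M. X 0 \<omega> \<in> A \<and> Y 0 \<omega>}" and "0 < prob {\<omega> \<in> space M. X 0 \<omega> \<in> A \<and> \<not> Y 0 \<omega>}"
proof -
  have null: "\<not> (AE \<omega> in M. X 0 \<omega> \<notin> A)"
    using assms(2) by (subst AE_iff_measurable[OF _ refl]) (auto simp: emeasure_eq_measure)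
  have pos: "0 < (\<integral>\<omega>. indicator A (X 0 \<omega>) * h (X 0 \<omega>) \<partial>M)"
    if h [measurable]: "h \<in> borel_measurable borel" and h01: "\<And>x. 0 < h x \<and> h x < 1" for h :: "real^'p \<Rightarrow> real"
  proof -
    have i: "integrable M (\<lambda>\<omega>. indicator A (X 0 \<omega>) * h (X 0 \<omega>))"
    proof (rule integrable_const_bound[where B=1])
      have "norm (indicator A x * h x) \<le> 1" for x using h01[of x] by (simp add: indicator_def)
      then show "AE \<omega> in M. norm (indicator A (X 0 \<omega>) * h (X 0 \<omega>)) \<le> 1" by simp
    qed measurable
    have n: "AE \<omega> in M. 0 \<le> indicator A (X 0 \<omega>) * h (X 0 \<omega>)"
      using h01 by (auto simp: indicator_def less_imp_le)
    have "(\<integral>\<omega>. indicator A (X 0 \<omega>) * h (X 0 \<omega>) \<partial>M) \<noteq> 0"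
    proof
      assume "(\<integral>\<omega>. indicator A (X 0 \<omega>) * h (X 0 \<omega>) \<partial>M) = 0"
      then have "AE \<omega> in M. indicator A (X 0 \<omega>) * h (X 0 \<omega>) = 0"
        using integral_nonneg_eq_0_iff_AE[OF i n] by simp
      then have "AE \<omega> in M. X 0 \<omega> \<notin> A"
      proof eventually_elim
        fix \<omega> assume "indicator A (X 0 \<omega>) * h (X 0 \<omega>) = 0"
        then show "X 0 \<omega> \<notin> A" using h01[of "X 0 \<omega>"] by (auto simp: indicator_def split: if_splits)
      qed
      with null show False ..
    qed
    with integral_nonneg_AE[OF n] show ?thesis by simp
  qed
  show "0 < prob {\<omega> \<in> space M. X 0 \<omega> \<in> A \<and> Y 0 \<omega>}"
    unfolding link[OF assms(1)] by (rule pos) (use G in auto)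
  have "prob {\<omega> \<in> space M. X 0 \<omega> \<in> A \<and> \<not> Y 0 \<omega>}
      = prob ({\<omega> \<in> space M. X 0 \<omega> \<in> A} - {\<omega> \<in> space M. X 0 \<omega> \<in> A \<and> Y 0 \<omega>})"
    by (rule arg_cong[where f=prob]) auto
  also have "\<dots> = prob {\<omega> \<in> space M. X 0 \<omega> \<in> A} - prob {\<omega> \<in> space M. X 0 \<omega> \<in> A \<and> Y 0 \<omega>}"
    by (rule finite_measure_Diff) auto
  also have "prob {\<omega> \<in> space M. X 0 \<omega> \<in> A} = expectation (\<lambda>\<omega>. indicator A (X 0 \<omega>))"
  proof -
    have "prob {\<omega> \<in> space M. X 0 \<omega> \<in> A} = expectation (indicator {\<omega> \<in> space M. X 0 \<omega> \<in> A})" by simp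
    also have "\<dots> = expectation (\<lambda>\<omega>. indicator A (X 0 \<omega>))"
      by (rule Bochner_Integration.integral_cong) (auto simp: indicator_def)
    finally show ?thesis .
  qed
  also have "\<dots> - prob {\<omega> \<in> space M. X 0 \<omega> \<in> A \<and> Y 0 \<omega>} = (\<integral>\<omega>. indicator A (X 0 \<omega>) * (1 - G (X 0 \<omega>)) \<partial>M)"
  proof -
    have "norm (indicator A x :: real) \<le> 1" "norm (indicator A x * G x) \<le> 1" for x
      using G[of x] by (auto simp: indicator_def)
    then have "integrable M (\<lambda>\<omega>. indicator A (X 0 \<omega>) :: real)" "integrable M (\<lambda>\<omega>. indicator A (X 0 \<omega>) * G (X 0 \<omega>))"
      by (auto intro!: integrable_const_bound[where B=1])
    then show ?thesis unfolding link[OF assms(1)] by (simp add: algebra_simps)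
  qed
  also have "0 < \<dots>" using pos[of "\<lambda>x. 1 - G x"] G by simp
  finally show "0 < prob {\<omega> \<in> space M. X 0 \<omega> \<in> A \<and> \<not> Y 0 \<omega>}" .
qed

text \<open>The orthant hypothesis puts mass on the orthant or on its reflection; the former is
  informative with response 1, the latter with response 0, and either response occurs there with
  positive probability.\<close>

lemma prob_informative_pos:
  assumes "a \<noteq> 0"
  shows "0 < prob {\<omega> \<in> space M. informative s (X 0 \<omega>, Y 0 \<omega>) \<and> X 0 \<omega> \<bullet> a \<noteq> 0}"
proof -
  define A where "A = {x. x \<in> open_orthant s \<and> x \<bullet> a \<noteq> 0}"
  define A' where "A' = {x. - x \<in> open_orthant s \<and> x \<bullet> a \<noteq> 0}"
  have [measurable]: "A \<in> sets borel" "A' \<in> sets borel" unfolding A_def A'_def by measurable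
  have "0 < prob ({\<omega> \<in> space M. X 0 \<omega> \<in> A} \<union> {\<omega> \<in> space M. X 0 \<omega> \<in> A'})"
  proof (rule less_le_trans[OF orthants[OF assms, of s]], rule finite_measure_mono)
    show "{\<omega> \<in> space M. ((indicator (open_orthant s) (X 0 \<omega>) :: real)
        + indicator (open_orthant s) (- X 0 \<omega>)) * (X 0 \<omega> \<bullet> a) \<noteq> 0}
        \<subseteq> {\<omega> \<in> space M. X 0 \<omega> \<in> A} \<union> {\<omega> \<in> space M. X 0 \<omega> \<in> A'}"
      by (auto simp: A_def A'_def indicator_def split: if_splits)
  qed measurable
  also have "\<dots> \<le> prob {\<omega> \<in> space M. X 0 \<omega> \<in> A} + prob {\<omega> \<in> space M. X 0 \<omega> \<in> A'}"
    by (rule measure_Un_le) measurable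
  finally have "0 < prob {\<omega> \<in> space M. X 0 \<omega> \<in> A} \<or> 0 < prob {\<omega> \<in> space M. X 0 \<omega> \<in> A'}"
    by linarith
  then show ?thesis
  proof
    assume 1: "0 < prob {\<omega> \<in> space M. X 0 \<omega> \<in> A}"
    have "0 < prob {\<omega> \<in> space M. X 0 \<omega> \<in> A \<and> Y 0 \<omega>}" by (rule prob_success_pos(1)) (use 1 in auto)
    also have "\<dots> \<le> prob {\<omega> \<in> space M. informative s (X 0 \<omega>, Y 0 \<omega>) \<and> X 0 \<omega> \<bullet> a \<noteq> 0}"
    proof (rule finite_measure_mono)
      show "{\<omega> \<in> space M. X 0 \<omega> \<in> A \<and> Y 0 \<omega>} \<subseteq> {\<omega> \<in> space M. informative s (X 0 \<omega>, Y 0 \<omega>) \<and> X 0 \<omega> \<bullet> a \<noteq> 0}"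
        by (auto simp: A_def informative_def)
    qed measurable
    finally show ?thesis .
  next
    assume 2: "0 < prob {\<omega> \<in> space M. X 0 \<omega> \<in> A'}"
    have "0 < prob {\<omega> \<in> space M. X 0 \<omega> \<in> A' \<and> \<not> Y 0 \<omega>}" by (rule prob_success_pos(2)) (use 2 in auto)
    also have "\<dots> \<le> prob {\<omega> \<in> space M. informative s (X 0 \<omega>, Y 0 \<omega>) \<and> X 0 \<omega> \<bullet> a \<noteq> 0}"
    proof (rule finite_measure_mono)
      show "{\<omega> \<in> space M. X 0 \<omega> \<in> A' \<and> \<not> Y 0 \<omega>} \<subseteq> {\<omega> \<in> space M. informative s (X 0 \<omega>, Y 0 \<omega>) \<and> X 0 \<omega> \<bullet> a \<noteq> 0}"
        by (auto simp: A'_def informative_def)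
    qed measurable
    finally show ?thesis .
  qed
qed

section \<open>Expected information and its empirical counterpart\<close>

definition mscore :: "('p \<Rightarrow> bool) \<Rightarrow> 'p \<Rightarrow> 'p \<Rightarrow> real" where
  "mscore s j k = expectation (\<lambda>\<omega>. score s j k (X 0 \<omega>, Y 0 \<omega>))"

definition info_form :: "('p \<Rightarrow> bool) \<Rightarrow> real^'p \<Rightarrow> real" where
  "info_form s a = (\<Sum>j\<in>UNIV. \<Sum>k\<in>UNIV. a $ j * a $ k * mscore s j k)"

abbreviation score_close :: "real \<Rightarrow> ('p \<Rightarrow> bool) \<Rightarrow> 'p \<Rightarrow> 'p \<Rightarrow> 'a \<Rightarrow> nat \<Rightarrow> bool" where
  "score_close \<epsilon> s j k \<omega> n \<equiv> \<bar>(\<Sum>i<n. score s j k (X i \<omega>, Y i \<omega>)) - real n * mscore s j k\<bar> \<le> real n * \<epsilon>"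

abbreviation info_ge :: "real \<Rightarrow> 'a \<Rightarrow> nat \<Rightarrow> bool" where
  "info_ge c \<omega> n \<equiv> \<forall>s a. real n * c * (norm a)\<^sup>2 \<le> info_sum \<omega> n s a"

abbreviation total_le :: "real \<Rightarrow> 'a \<Rightarrow> nat \<Rightarrow> bool" where
  "total_le D \<omega> n \<equiv> \<forall>a. (\<Sum>i<n. (X i \<omega> \<bullet> a)\<^sup>2) \<le> real n * D * (norm a)\<^sup>2"

abbreviation rate_le :: "real \<Rightarrow> real^'p \<Rightarrow> real^'p^'p \<Rightarrow> 'a \<Rightarrow> nat \<Rightarrow> bool" where
  "rate_le \<rho> v Q \<omega> n \<equiv> posterior_proper (\<lambda>i. X i \<omega>) (\<lambda>i. Y i \<omega>) n v Q
     \<and> ac_rate (\<lambda>i. X i \<omega>) (\<lambda>i. Y i \<omega>) n v Q \<le> \<rho>"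

lemma score_integrable: "integrable M (\<lambda>\<omega>. score s j k (X i \<omega>, Y i \<omega>))"
  by (rule integrable_const_bound[where B=1]) (auto simp: score_bounded)

text \<open>The form is the mean of a nonnegative variable that is nonzero on an event of positive
  probability.\<close>

lemma info_form_pos:
  assumes "a \<noteq> 0"
  shows "0 < info_form s a"
proof -
  define g where "g \<omega> = (if informative s (X 0 \<omega>, Y 0 \<omega>) then (X 0 \<omega> \<bullet> a)\<^sup>2 / (1 + (norm (X 0 \<omega>))\<^sup>2) else 0)" for \<omega>
  have g: "g \<omega> = (\<Sum>j\<in>UNIV. \<Sum>k\<in>UNIV. a $ j * a $ k * score s j k (X 0 \<omega>, Y 0 \<omega>))" for \<omega>
    by (simp add: g_def score_form)
  have gi: "integrable M g"
    unfolding g[abs_def] by (intro Bochner_Integration.integrable_sum integrable_mult_right score_integrable)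
  have ge: "info_form s a = expectation g"
    unfolding g[abs_def] info_form_def mscore_def
    by (subst Bochner_Integration.integral_sum; (intro Bochner_Integration.integrable_sum integrable_mult_right score_integrable sum.cong refl)?)
       (simp add: Bochner_Integration.integral_sum score_integrable)
  have gn: "AE \<omega> in M. 0 \<le> g \<omega>" by (simp add: g_def)
  have "expectation g \<noteq> 0"
  proof
    assume "expectation g = 0"
    then have "AE \<omega> in M. g \<omega> = 0" using integral_nonneg_eq_0_iff_AE[OF gi gn] by simp
    then have "AE \<omega> in M. \<not> (informative s (X 0 \<omega>, Y 0 \<omega>) \<and> X 0 \<omega> \<bullet> a \<noteq> 0)"
    proof eventually_elim
      fix \<omega> assume "g \<omega> = 0"
      moreover have "1 + (norm (X 0 \<omega>))\<^sup>2 \<noteq> 0" by (metis add_pos_nonneg less_irrefl zero_le_power2 zero_less_one)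
      ultimately show "\<not> (informative s (X 0 \<omega>, Y 0 \<omega>) \<and> X 0 \<omega> \<bullet> a \<noteq> 0)"
        by (auto simp: g_def)
    qed
    then have "prob {\<omega> \<in> space M. informative s (X 0 \<omega>, Y 0 \<omega>) \<and> X 0 \<omega> \<bullet> a \<noteq> 0} = 0"
      by (subst (asm) AE_iff_measurable[OF _ refl]) (auto simp: emeasure_eq_measure)
    with prob_informative_pos[OF assms, of s] show False by simp
  qed
  with integral_nonneg_AE[OF gn] show ?thesis by (simp add: ge)
qed

text \<open>The form is continuous and homogeneous of degree 2, so its minimum on the unit sphere is
  a constant for each sign pattern, and there are finitely many patterns.\<close>

lemma info_form_lower_bound: "\<exists>c>0. \<forall>s a. c * (norm a)\<^sup>2 \<le> info_form s a"
proof -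
  have "\<exists>c>0. \<forall>a. c * (norm a)\<^sup>2 \<le> info_form s a" for s
  proof -
    have "continuous_on (sphere 0 1) (info_form s)"
      unfolding info_form_def by (intro continuous_intros)
    moreover have "sphere (0 :: real^'p) 1 \<noteq> {}" by simp
    ultimately obtain a0 where a0: "a0 \<in> sphere 0 1" "\<And>a. a \<in> sphere 0 1 \<Longrightarrow> info_form s a0 \<le> info_form s a"
      using continuous_attains_inf[OF compact_sphere] by blast
    have "info_form s a0 * (norm a)\<^sup>2 \<le> info_form s a" for a
    proof (cases "a = 0")
      case False
      have "info_form s a = (norm a)\<^sup>2 * info_form s (a /\<^sub>R norm a)"
        using False by (simp add: info_form_def sum_distrib_left power2_eq_square field_simps)
      moreover have "info_form s a0 \<le> info_form s (a /\<^sub>R norm a)"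
        using False by (intro a0) simp
      ultimately show ?thesis by (simp add: mult.commute[of "info_form s a0"] mult_left_mono)
    qed (simp add: info_form_def)
    moreover have "0 < info_form s a0" using a0(1) by (intro info_form_pos) auto
    ultimately show ?thesis by blast
  qed
  then obtain c where c: "\<And>s. 0 < c s" "\<And>s a. c s * (norm a)\<^sup>2 \<le> info_form s a" by metis
  have "Min (range c) * (norm a)\<^sup>2 \<le> info_form s a" for s a
  proof -
    have "Min (range c) * (norm a)\<^sup>2 \<le> c s * (norm a)\<^sup>2" by (intro mult_right_mono) auto
    then show ?thesis using c(2) order_trans by blast
  qed
  moreover have "0 < Min (range c)" using c(1) by simp
  ultimately show ?thesis by blast
qed

lemma eventually_information:
  "\<exists>c>0. AE \<omega> in M. eventually (info_ge c \<omega>) sequentially"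
proof -
  obtain c where c: "0 < c" "\<And>s a. c * (norm a)\<^sup>2 \<le> info_form s a" using info_form_lower_bound by blast
  \<comment> \<open>An entrywise error of \<epsilon> changes the form by at most p^2 times
    \<epsilon> per observation on unit vectors, which costs half of \<open>c\<close>.\<close>
  define \<epsilon> where "\<epsilon> = c / (2 * (real CARD('p))\<^sup>2)"
  have \<epsilon>: "0 < \<epsilon>" using c by (simp add: \<epsilon>_def)
  have "AE \<omega> in M. eventually (score_close \<epsilon> s j k \<omega>) sequentially" for s j k
    unfolding mscore_def
  proof (rule eventually_mean_deviation_less)
    show "indep_vars (\<lambda>_. borel) (\<lambda>i \<omega>. score s j k (X i \<omega>, Y i \<omega>)) UNIV"
      by (rule indep_vars_compose2[OF indep]) measurable
    show "distr M borel (\<lambda>\<omega>. score s j k (X i \<omega>, Y i \<omega>)) = distr M borel (\<lambda>\<omega>. score s j k (X 0 \<omega>, Y 0 \<omega>))" for i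
      using arg_cong[OF distr[of i], of "\<lambda>N. distr N borel (score s j k)"] by (simp add: distr_distr comp_def)
  qed (use \<epsilon> score_bounded in auto)
  then have "AE \<omega> in M. \<forall>s j k. eventually (score_close \<epsilon> s j k \<omega>) sequentially"
    by (simp add: AE_all_countable countable_finite)
  then have "AE \<omega> in M. eventually (info_ge (c / 2) \<omega>) sequentially"
  proof eventually_elim
    case (elim \<omega>)
    then have "eventually (\<lambda>n. \<forall>s j k. score_close \<epsilon> s j k \<omega> n) sequentially"
      by (intro eventually_all_finite) auto
    then show ?case
    proof (eventually_elim, intro allI)
      fix n s and a :: "real^'p"
      assume dev: "\<forall>s j k. score_close \<epsilon> s j k \<omega> n"
      define T where "T j k = (\<Sum>i<n. score s j k (X i \<omega>, Y i \<omega>))" for j k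
      have "real n * info_form s a - (\<Sum>j\<in>UNIV. \<Sum>k\<in>UNIV. a $ j * a $ k * T j k)
          = (\<Sum>j\<in>UNIV. \<Sum>k\<in>UNIV. a $ j * a $ k * (real n * mscore s j k - T j k))"
        by (simp add: info_form_def sum_distrib_left sum_subtractf[symmetric] algebra_simps)
      also have "\<dots> \<le> (\<Sum>j\<in>(UNIV::'p set). \<Sum>k\<in>(UNIV::'p set). (norm a)\<^sup>2 * (real n * \<epsilon>))"
      proof (intro sum_mono)
        fix j k
        have "a $ j * a $ k * (real n * mscore s j k - T j k) \<le> \<bar>a $ j\<bar> * \<bar>a $ k\<bar> * \<bar>T j k - real n * mscore s j k\<bar>"
          by (metis abs_ge_self abs_minus_commute abs_mult)
        also have "\<dots> \<le> norm a * norm a * (real n * \<epsilon>)"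
          using dev by (intro mult_mono component_le_norm_cart) (auto simp: T_def)
        finally show "a $ j * a $ k * (real n * mscore s j k - T j k) \<le> (norm a)\<^sup>2 * (real n * \<epsilon>)"
          by (simp add: power2_eq_square)
      qed
      also have "\<dots> = real n * (c / 2) * (norm a)\<^sup>2"
        by (simp add: \<epsilon>_def power2_eq_square)
      finally have "real n * info_form s a - real n * (c / 2) * (norm a)\<^sup>2 \<le> (\<Sum>j\<in>UNIV. \<Sum>k\<in>UNIV. a $ j * a $ k * T j k)"
        by simp
      moreover have "real n * (c * (norm a)\<^sup>2) \<le> real n * info_form s a"
        using c(2) by (intro mult_left_mono) auto
      ultimately have "real n * (c / 2) * (norm a)\<^sup>2 \<le> (\<Sum>j\<in>UNIV. \<Sum>k\<in>UNIV. a $ j * a $ k * T j k)"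
        by (simp add: algebra_simps)
      also have "\<dots> = (\<Sum>j\<in>UNIV. \<Sum>k\<in>UNIV. \<Sum>i<n. a $ j * a $ k * score s j k (X i \<omega>, Y i \<omega>))"
        by (simp add: T_def sum_distrib_left)
      also have "\<dots> = (\<Sum>j\<in>UNIV. \<Sum>i<n. \<Sum>k\<in>UNIV. a $ j * a $ k * score s j k (X i \<omega>, Y i \<omega>))"
        by (intro sum.cong refl sum.swap)
      also have "\<dots> = (\<Sum>i<n. \<Sum>j\<in>UNIV. \<Sum>k\<in>UNIV. a $ j * a $ k * score s j k (X i \<omega>, Y i \<omega>))"
        by (rule sum.swap)
      also have "\<dots> = (\<Sum>i<n. if informative s (X i \<omega>, Y i \<omega>) then (X i \<omega> \<bullet> a)\<^sup>2 / (1 + (norm (X i \<omega>))\<^sup>2) else 0)"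
        unfolding score_form ..
      \<comment> \<open>Dropping the denominator only increases the sum, so the bounded scores still
        bound the true information from below.\<close>
      also have "\<dots> \<le> (\<Sum>i<n. if informative s (X i \<omega>, Y i \<omega>) then (X i \<omega> \<bullet> a)\<^sup>2 else 0)"
        by (intro sum_mono) (auto simp: divide_le_eq mult_le_cancel_left1 add_pos_nonneg mult_left_le algebra_simps)
      also have "\<dots> = info_sum \<omega> n s a"
        by (simp add: sum.inter_filter[symmetric])
      finally show "real n * (c / 2) * (norm a)\<^sup>2 \<le> info_sum \<omega> n s a" .
    qed
  qed
  then show ?thesis using c(1) by (intro exI[of _ "c / 2"]) auto
qed

text \<open>By Cauchy-Schwarz only the sum of the squared norms matters, and these have a finite
  mean since the second moments of the covariates exist.\<close>

lemma eventually_total: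
  "\<exists>D\<ge>0. AE \<omega> in M. eventually (total_le D \<omega>) sequentially"
proof -
  define W where "W i \<omega> = (norm (X i \<omega>))\<^sup>2" for i \<omega>
  have W: "W i \<omega> = (\<Sum>j\<in>UNIV. X i \<omega> $ j * X i \<omega> $ j)" for i \<omega>
    unfolding W_def power2_norm_eq_inner by (simp add: inner_vec_def)
  let ?D = "2 * (expectation (W 0) + 1)"
  have "AE \<omega> in M. eventually (\<lambda>n. (\<Sum>i<n. W i \<omega>) \<le> 2 * real n * (expectation (W 0) + 1)) sequentially"
  proof (rule eventually_sum_le)
    show "indep_vars (\<lambda>_. borel) W UNIV"
      using indep_vars_compose2[OF indep, of "\<lambda>_ w. (norm (fst w))\<^sup>2" "\<lambda>_. borel"] by (simp add: W_def[abs_def])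
    show "distr M borel (W i) = distr M borel (W 0)" for i
      using arg_cong[OF distr[of i], of "\<lambda>N. distr N borel (\<lambda>w. (norm (fst w))\<^sup>2)"]
      by (simp add: distr_distr comp_def W_def[abs_def])
    show "integrable M (W 0)" unfolding W[abs_def] using moments by simp
  qed (simp add: W_def)
  then have "AE \<omega> in M. eventually (total_le ?D \<omega>) sequentially"
  proof eventually_elim
    case (elim \<omega>)
    then show ?case
    proof (eventually_elim, intro allI)
      fix n and a :: "real^'p"
      assume le: "(\<Sum>i<n. W i \<omega>) \<le> 2 * real n * (expectation (W 0) + 1)"
      have "(\<Sum>i<n. (X i \<omega> \<bullet> a)\<^sup>2) \<le> (\<Sum>i<n. W i \<omega> * (norm a)\<^sup>2)"
      proof (rule sum_mono)
        fix i
        have "\<bar>X i \<omega> \<bullet> a\<bar>\<^sup>2 \<le> (norm (X i \<omega>) * norm a)\<^sup>2"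
          by (intro power_mono Cauchy_Schwarz_ineq2) auto
        then show "(X i \<omega> \<bullet> a)\<^sup>2 \<le> W i \<omega> * (norm a)\<^sup>2" by (simp add: W_def power_mult_distrib)
      qed
      also have "\<dots> \<le> real n * ?D * (norm a)\<^sup>2"
        unfolding sum_distrib_right[symmetric] using le by (intro mult_right_mono) (auto simp: algebra_simps)
      finally show "(\<Sum>i<n. (X i \<omega> \<bullet> a)\<^sup>2) \<le> real n * ?D * (norm a)\<^sup>2" .
    qed
  qed
  moreover have "0 \<le> expectation (W 0)" by (intro integral_nonneg_AE) (simp add: W_def)
  then have "0 \<le> ?D" by simp
  ultimately show ?thesis by blast
qed

lemma eventually_ac_rate_le:
  fixes Q :: "real^'p^'p"
  assumes Q: "pos_def Q \<or> Q = 0"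
  shows "\<exists>\<rho><1. AE \<omega> in M. eventually (rate_le \<rho> v Q \<omega>) sequentially"
proof -
  obtain c where c: "0 < c" and info: "AE \<omega> in M. eventually (info_ge c \<omega>) sequentially"
    using eventually_information by blast
  obtain D where D: "0 \<le> D" and total: "AE \<omega> in M. eventually (total_le D \<omega>) sequentially"
    using eventually_total by blast
  define q where "q = onorm ((*v) Q)"
  have q: "0 \<le> q" unfolding q_def by (rule onorm_pos_le) (rule matrix_vector_mul_bounded_linear)
  \<comment> \<open>The summand \<open>c\<close> keeps the denominator positive and \<delta> below 1
    even when \<open>D\<close> and \<open>q\<close> vanish.\<close>
  define \<delta> where "\<delta> = c / (2 * (D + q + c))"
  have \<delta>: "0 < \<delta>" "\<delta> < 1" "2 * \<delta> * (D + q) \<le> c"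
    using c D q by (auto simp: \<delta>_def field_simps add_pos_nonneg add_nonneg_pos)
  have "AE \<omega> in M. eventually (rate_le (ac_rate_bound CARD('p) (1 - \<delta>)) v Q \<omega>) sequentially"
    using info total
  proof eventually_elim
    case (elim \<omega>)
    then show ?case
      using eventually_ge_at_top[of 1]
    proof eventually_elim
      fix n :: nat
      assume lo: "info_ge c \<omega> n"
        and up: "total_le D \<omega> n" and n: "1 \<le> n"
      have "2 * \<delta> * (a \<bullet> (Sigma_mat (\<lambda>i. X i \<omega>) n Q *v a)) \<le> real n * c * (norm a)\<^sup>2" for a
      proof -
        have "a \<bullet> (Sigma_mat (\<lambda>i. X i \<omega>) n Q *v a) \<le> real n * D * (norm a)\<^sup>2 + q * (norm a)\<^sup>2"
          using up quadratic_form_le[of a Q] by (simp add: inner_Sigma_mat q_def power2_eq_square add_mono)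
        \<comment> \<open>The prior contribution does not grow with the sample; for \<open>n\<close>
          at least 1 it is absorbed into the linear bound.\<close>
        also have "q * (norm a)\<^sup>2 \<le> real n * (q * (norm a)\<^sup>2)"
          using n q by (intro mult_right_le_one_le mult_left_mono[of 1 "real n" "q * (norm a)\<^sup>2", simplified mult.commute mult_1]) auto
        finally have "2 * \<delta> * (a \<bullet> (Sigma_mat (\<lambda>i. X i \<omega>) n Q *v a)) \<le> 2 * \<delta> * (real n * D * (norm a)\<^sup>2 + real n * (q * (norm a)\<^sup>2))"
          using \<delta> by (intro mult_left_mono) auto
        also have "\<dots> = (2 * \<delta> * (D + q)) * (real n * (norm a)\<^sup>2)" by (simp add: algebra_simps)
        also have "\<dots> \<le> c * (real n * (norm a)\<^sup>2)" using \<delta>(3) by (rule mult_right_mono) simp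
        finally show ?thesis by (simp add: algebra_simps)
      qed
      with lo have ratio: "2 * \<delta> * (a \<bullet> (Sigma_mat (\<lambda>i. X i \<omega>) n Q *v a))
          \<le> info_sum \<omega> n s a" for s a
        by (meson order_trans)
      show "rate_le (ac_rate_bound CARD('p) (1 - \<delta>)) v Q \<omega> n"
        by (rule ac_rate_le_informative[where c="real n * c", OF Q \<delta>(1,2)]) (use c n lo ratio in auto)
    qed
  qed
  moreover have "ac_rate_bound CARD('p) (1 - \<delta>) < 1" using \<delta> by (intro ac_rate_bound_less_1) auto
  ultimately show ?thesis by blast
qed

end

theorem theorem2:
  fixes M :: "'a measure"
    and X :: "nat \<Rightarrow> 'a \<Rightarrow> real^'p"
    and Y :: "nat \<Rightarrow> 'a \<Rightarrow> bool"
    and G :: "real^'p \<Rightarrow> real"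
    and v :: "real^'p"
    and Q :: "real^'p^'p"
  assumes "prob_space M"
    and "pos_def Q \<or> Q = 0"
    and "\<And>i. X i \<in> borel_measurable M"
    and "\<And>i. Y i \<in> measurable M (count_space UNIV)"
    and "prob_space.indep_vars M (\<lambda>_. borel \<Otimes>\<^sub>M count_space UNIV) (\<lambda>i \<omega>. (X i \<omega>, Y i \<omega>)) UNIV"
    and "\<And>i. distr M (borel \<Otimes>\<^sub>M count_space UNIV) (\<lambda>\<omega>. (X i \<omega>, Y i \<omega>))
             = distr M (borel \<Otimes>\<^sub>M count_space UNIV) (\<lambda>\<omega>. (X 0 \<omega>, Y 0 \<omega>))"
    and "G \<in> borel_measurable borel"
    and "\<And>x. 0 < G x \<and> G x < 1"
    and "\<And>i A. A \<in> sets borel \<Longrightarrow>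
           measure M {\<omega> \<in> space M. X i \<omega> \<in> A \<and> Y i \<omega>} = (\<integral>\<omega>. indicator A (X i \<omega>) * G (X i \<omega>) \<partial>M)"
    and "\<And>j k. integrable M (\<lambda>\<omega>. X 0 \<omega> $ j * X 0 \<omega> $ k)"
    and "pos_def (\<chi> j k. \<integral>\<omega>. X 0 \<omega> $ j * X 0 \<omega> $ k \<partial>M)"
    and "\<And>s \<beta>. \<beta> \<noteq> 0 \<Longrightarrow>
           measure M {\<omega> \<in> space M. ((indicator (open_orthant s) (X 0 \<omega>) :: real)
              + indicator (open_orthant s) (- X 0 \<omega>)) * (X 0 \<omega> \<bullet> \<beta>) \<noteq> 0} > 0"
  shows "\<exists>\<rho> < 1. AE \<omega> in M.
           eventually (\<lambda>n. posterior_proper (\<lambda>i. X i \<omega>) (\<lambda>i. Y i \<omega>) n v Q) sequentially \<and>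
           limsup (\<lambda>n. ereal (ac_rate (\<lambda>i. X i \<omega>) (\<lambda>i. Y i \<omega>) n v Q)) \<le> ereal \<rho>"
proof -
  interpret probit_data M X Y G
    using assms by (intro probit_data.intro probit_data_axioms.intro)
  obtain \<rho> where "\<rho> < 1" and ev: "AE \<omega> in M. eventually (rate_le \<rho> v Q \<omega>) sequentially"
    using eventually_ac_rate_le[OF assms(2)] by blast
  show ?thesis
    by (intro exI[of _ \<rho>] conjI[OF \<open>\<rho> < 1\<close>] eventually_mono[OF ev])
       (auto simp: eventually_conj_iff intro!: Limsup_bounded)
qed

end
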